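(* Consider a g-vector $g$ with no negative direct summand. Then $g$ is wild if and only if $$\min\hom_\Lambda(\mathcal{Z}_g,\mathcal{Z}_g)>\langle g,d(g)\rangle.$$
   Context: Let $k$ be an algebraically closed field and $\Lambda=kQ/I$ a basic finite-dimensional $k$-algebra given by a connected bound quiver $(Q,I)$ with $n$ vertices. Modules are finitely generated left modules; $P_{(1)},\dots,P_{(n)}$ are the indecomposable projectives up to isomorphism, with $P_{(i)}$ the projective cover of the simple $S_{(i)}$. A g-vector is an element of $K_0(\mathrm{proj}\,\Lambda)\cong\mathbb{Z}^n$ (basis $[P_{(i)}]$). Each g-vector is uniquely $g=[P^{g+}]-[P^{g-}]$ with $P^{g+},P^{g-}$ projective without common nonzero direct summands; $\mathrm{Hom}_\Lambda(g):=\mathrm{Hom}_\Lambda(P^{g-},P^{g+})$, whose elements are regarded as 2-term complexes in $K^b(\mathrm{proj}\,\Lambda)$ (with $P^{g-}$ in degree $-1$). For $a\in\mathrm{Hom}_\Lambda(g)$, $b\in\mathrm{Hom}_\Lambda(h)$ set $e(a,b)=\dim_k\mathrm{Hom}_{K^b(\mathrm{proj}\,\Lambda)}(a,b[1])$ and $e(g,h)=\min\{e(a,b)\}$ over all such $a,b$. One writes $g+h=g\oplus h$, and calls $g,h$ direct summands of $g+h$, when $e(g,h)=0=e(h,g)$. A g-vector $g$ is tame if $2g=g\oplus g$ (i.e. $e(g,g)=0$), otherwise wild. A g-vector $g$ is negative if $[P^{g+}]=0$; "no negative direct summand" means no nonzero negative direct summand. $\mathrm{rep}_d(\Lambda)$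 is the affine variety of representations of dimension vector $d$, with the conjugation action of $\mathrm{GL}_d(k)$, and $\mathcal{O}_M$ is the orbit of $M$. By a theorem of Plamondon, for each g-vector $g$ there are a dimension vector $d(g)$ and a nonempty open subset $\mathcal{U}\subseteq\mathrm{Hom}_\Lambda(g)$ such that $\mathrm{Coker}(a)$ has dimension vector $d(g)$ for all $a\in\mathcal{U}$, $\mathrm{Coker}:\mathcal{U}\to\mathrm{rep}_{d(g)}(\Lambda)$ is a morphism of varieties, and $\mathcal{Z}_g:=\overline{\bigcup_{a\in\mathcal{U}}\mathcal{O}_{\mathrm{Coker}(a)}}$ is an irreducible component of $\mathrm{rep}_{d(g)}(\Lambda)$ (a generically $\tau$-reduced one). For subvarieties $\mathcal{X},\mathcal{Y}$ of representation varieties, $\min\hom_\Lambda(\mathcal{X},\mathcal{Y})=\min\{\dim_k\mathrm{Hom}_\Lambda(X,Y)\mid X\in\mathcal{X},Y\in\mathcal{Y}\}$ ($X$ and $Y$ vary independently). $\langle-,-\rangle$ is the standard inner product on $\mathbb{Z}^n$, where g-vectors are written in the basis $[P_{(i)}]$ and dimension vectors in the basis $[S_{(i)}]$. *)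

theory Defs
  imports
    "HOL-Algebra.QuotRing"
    "HOL-Analysis.Function_Topology"
    "Graph_Theory.Graph_Theory"
    "Jordan_Normal_Form.VS_Connect"
begin

hide_const (open) Multiset.mult Polynomial.smult Modules.module

section \<open>Bound quivers and their algebras\<close>

text \<open>
  A path of the quiver \<open>Q\<close> is a pair \<open>(u, p)\<close> of a start vertex and a walk \<open>p\<close>, listed in the order
  in which the arrows are traversed.  Products are composed like functions: \<open>x \<otimes> y\<close> is \<open>y\<close> followed
  by \<open>x\<close>.  With this convention left modules are covariant representations of \<open>Q\<close>.
\<close>

type_synonym ('v, 'a) path = "'v \<times> 'a list"

definition paths :: "('v, 'a) pre_digraph \<Rightarrow> ('v, 'a) path set" where
  "paths Q = {(u, p). \<exists>v. pre_digraph.awalk Q u p v}"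

definition path_algebra :: "('v, 'a) pre_digraph \<Rightarrow> (('v, 'a) path \<Rightarrow> 'k::field) ring" where
  "path_algebra Q =
    \<lparr>carrier = {x. finite {w. x w \<noteq> 0} \<and> {w. x w \<noteq> 0} \<subseteq> paths Q},
     mult = (\<lambda>x y (u, p). \<Sum>i\<le>length p.
       x (last (pre_digraph.awalk_verts Q u (take i p)), drop i p) * y (u, take i p)),
     one = (\<lambda>(u, p). if u \<in> verts Q \<and> p = [] then 1 else 0),
     zero = (\<lambda>_. 0),
     add = (\<lambda>x y w. x w + y w)\<rparr>"

lemma (in pre_digraph) last_awalk_verts_simps:
  "last (awalk_verts u []) = u"
  "last (awalk_verts u (e # p)) = last (awalk_verts (head G e) p)"
  by simp_all

lemma (in pre_digraph) last_awalk_verts_append: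
  "last (awalk_verts u (p @ q)) = last (awalk_verts (last (awalk_verts u p)) q)"
  by (induction p arbitrary: u) (simp_all add: last_awalk_verts_simps)

lemma path_algebra_mult_apply:
  "(x \<otimes>\<^bsub>path_algebra Q\<^esub> y) (u, p) = (\<Sum>i\<le>length p.
    x (last (pre_digraph.awalk_verts Q u (take i p)), drop i p) * y (u, take i p))"
  by (simp add: path_algebra_def)

lemma path_algebra_assoc:
  "(x \<otimes>\<^bsub>path_algebra Q\<^esub> y) \<otimes>\<^bsub>path_algebra Q\<^esub> z = x \<otimes>\<^bsub>path_algebra Q\<^esub> (y \<otimes>\<^bsub>path_algebra Q\<^esub> z)"
proof (rule ext, clarify)
  fix u p
  let ?t = "\<lambda>u p. last (pre_digraph.awalk_verts Q u p)"
  define F where "F i k = x (?t u (take k p), drop k p) *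
    (y (?t u (take i p), drop i (take k p)) * z (u, take i p))" for i k
  have "((x \<otimes>\<^bsub>path_algebra Q\<^esub> y) \<otimes>\<^bsub>path_algebra Q\<^esub> z) (u, p) =
    (\<Sum>i\<le>length p. \<Sum>j\<le>length p - i. F i (i + j))"
    unfolding path_algebra_mult_apply sum_distrib_right F_def
    by (intro sum.cong refl)
       (auto simp: take_add pre_digraph.last_awalk_verts_append drop_take mult.assoc add.commute)
  also have "\<dots> = (\<Sum>(i, j)\<in>(SIGMA i:{..length p}. {..length p - i}). F i (i + j))"
    by (simp add: sum.Sigma)
  also have "\<dots> = (\<Sum>(k, i)\<in>(SIGMA k:{..length p}. {..k}). F i k)"
    by (rule sum.reindex_bij_witness[of _ "\<lambda>(k, i). (i, k - i)" "\<lambda>(i, j). (i + j, i)"]) auto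
  also have "\<dots> = (\<Sum>k\<le>length p. \<Sum>i\<le>k. F i k)"
    by (simp add: sum.Sigma)
  also have "\<dots> = (x \<otimes>\<^bsub>path_algebra Q\<^esub> (y \<otimes>\<^bsub>path_algebra Q\<^esub> z)) (u, p)"
    unfolding path_algebra_mult_apply sum_distrib_left F_def
    by (intro sum.cong refl) (auto simp: min_def split: if_splits)
  finally show "((x \<otimes>\<^bsub>path_algebra Q\<^esub> y) \<otimes>\<^bsub>path_algebra Q\<^esub> z) (u, p) =
    (x \<otimes>\<^bsub>path_algebra Q\<^esub> (y \<otimes>\<^bsub>path_algebra Q\<^esub> z)) (u, p)" .
qed

lemma path_algebra_carrier:
  "x \<in> carrier (path_algebra Q) \<longleftrightarrow> finite {w. x w \<noteq> 0} \<and> {w. x w \<noteq> 0} \<subseteq> paths Q"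
  by (simp add: path_algebra_def)

lemma (in wf_digraph) path_algebra_mult_closed:
  assumes x: "x \<in> carrier (path_algebra G)" and y: "y \<in> carrier (path_algebra G)"
  shows "x \<otimes>\<^bsub>path_algebra G\<^esub> y \<in> carrier (path_algebra G)"
proof -
  let ?xy = "x \<otimes>\<^bsub>path_algebra G\<^esub> y"
  have *: "w \<in> (\<lambda>(w', u, p). (u, p @ snd w')) ` ({w. x w \<noteq> 0} \<times> {w. y w \<noteq> 0}) \<and> w \<in> paths G"
    if nz: "?xy w \<noteq> 0" for w
  proof -
    obtain u p where w: "w = (u, p)" by (cases w)
    from nz obtain i where i: "x (last (awalk_verts u (take i p)), drop i p) * y (u, take i p) \<noteq> 0"
      unfolding w path_algebra_mult_apply by (meson sum.neutral)
    then have nx: "x (last (awalk_verts u (take i p)), drop i p) \<noteq> 0" and ny: "y (u, take i p) \<noteq> 0"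
      by auto
    from nx x have "(last (awalk_verts u (take i p)), drop i p) \<in> paths G"
      by (auto simp: path_algebra_carrier)
    then obtain v where v: "awalk (last (awalk_verts u (take i p))) (drop i p) v"
      by (auto simp: paths_def)
    from ny y have "(u, take i p) \<in> paths G" by (auto simp: path_algebra_carrier)
    then obtain v' where v': "awalk u (take i p) v'" by (auto simp: paths_def)
    then have "last (awalk_verts u (take i p)) = v'" by (meson awlast_if_cas awalk_def)
    with v v' have "awalk u (take i p @ drop i p) v" by (metis awalk_appendI)
    then have "w \<in> paths G" by (auto simp: w paths_def)
    moreover have "w \<in> (\<lambda>(w', u, p). (u, p @ snd w')) ` ({w. x w \<noteq> 0} \<times> {w. y w \<noteq> 0})"
      using nx ny by (force simp: w image_iff)
    ultimately show ?thesis by blast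
  qed
  have "finite ((\<lambda>(w', u, p). (u, p @ snd w')) ` ({w. x w \<noteq> 0} \<times> {w. y w \<noteq> 0}))"
    using x y by (auto simp: path_algebra_carrier)
  then have "finite {w. ?xy w \<noteq> 0}" by (rule finite_subset[rotated]) (use * in blast)
  with * show ?thesis by (auto simp: path_algebra_carrier)
qed

lemma (in fin_digraph) ring_path_algebra:
  "ring (path_algebra G :: (('a, 'b) path \<Rightarrow> 'k::field) ring)" (is "ring ?R")
proof -
  have fin_plus: "finite {w. x w + y w \<noteq> 0}" if "finite {w. x w \<noteq> 0}" "finite {w. y w \<noteq> 0}"
    for x y :: "('a, 'b) path \<Rightarrow> 'k"
    by (rule finite_subset[OF _ finite_UnI[OF that]]) auto
  have abelian: "abelian_group ?R"
  proof (rule abelian_groupI)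
    fix x y assume *: "x \<in> carrier ?R" "y \<in> carrier ?R"
    then have "{w. x w + y w \<noteq> 0} \<subseteq> paths G" unfolding path_algebra_carrier by force
    with * show "x \<oplus>\<^bsub>?R\<^esub> y \<in> carrier ?R"
      by (auto simp: path_algebra_def fin_plus)
  next
    fix x assume "x \<in> carrier ?R"
    then have "(\<lambda>w. - x w) \<in> carrier ?R" "(\<lambda>w. - x w) \<oplus>\<^bsub>?R\<^esub> x = \<zero>\<^bsub>?R\<^esub>"
      by (auto simp: path_algebra_def)
    then show "\<exists>y\<in>carrier ?R. y \<oplus>\<^bsub>?R\<^esub> x = \<zero>\<^bsub>?R\<^esub>" by blast
  qed (auto simp: path_algebra_def add_ac)
  have supp_one: "{w. \<one>\<^bsub>?R\<^esub> w \<noteq> 0} = (\<lambda>u. (u, [])) ` verts G"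
    by (auto simp: path_algebra_def split: if_splits)
  have one: "\<one>\<^bsub>?R\<^esub> \<in> carrier ?R"
    unfolding path_algebra_carrier supp_one
    by (auto simp: paths_def awalk_def)
  have one_l: "\<one>\<^bsub>?R\<^esub> \<otimes>\<^bsub>?R\<^esub> x = x" and one_r: "x \<otimes>\<^bsub>?R\<^esub> \<one>\<^bsub>?R\<^esub> = x"
    if x: "x \<in> carrier ?R" for x
  proof -
    have "(\<one>\<^bsub>?R\<^esub> \<otimes>\<^bsub>?R\<^esub> x) (u, p) = x (u, p) \<and> (x \<otimes>\<^bsub>?R\<^esub> \<one>\<^bsub>?R\<^esub>) (u, p) = x (u, p)" for u p
    proof -
      have path: "u \<in> verts G \<and> last (awalk_verts u p) \<in> verts G" if "x (u, p) \<noteq> 0"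
      proof -
        from that x obtain v where "awalk u p v" by (auto simp: path_algebra_carrier paths_def)
        then show ?thesis by (metis awalk_def awalk_last_in_verts awlast_if_cas)
      qed
      have "(\<one>\<^bsub>?R\<^esub> \<otimes>\<^bsub>?R\<^esub> x) (u, p) =
        (\<Sum>i\<le>length p. if i = length p then x (u, p) else 0)"
        unfolding path_algebra_mult_apply
        by (rule sum.cong) (use path in \<open>auto simp: path_algebra_def\<close>)
      moreover have "(x \<otimes>\<^bsub>?R\<^esub> \<one>\<^bsub>?R\<^esub>) (u, p) = (\<Sum>i\<le>length p. if i = 0 then x (u, p) else 0)"
        unfolding path_algebra_mult_apply
        by (rule sum.cong) (use path in \<open>auto simp: path_algebra_def\<close>)
      ultimately show ?thesis by simp
    qed
    then show "\<one>\<^bsub>?R\<^esub> \<otimes>\<^bsub>?R\<^esub> x = x" "x \<otimes>\<^bsub>?R\<^esub> \<one>\<^bsub>?R\<^esub> = x" by auto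
  qed
  have monoid: "monoid ?R"
    by (rule monoidI)
       (simp_all add: path_algebra_mult_closed one one_l one_r path_algebra_assoc)
  show ?thesis
    by (rule ringI[OF abelian monoid])
       (auto simp: path_algebra_def fun_eq_iff sum.distrib distrib_left distrib_right)
qed

text \<open>The \<open>l\<close>-th power of the arrow ideal is spanned by the paths of length at least \<open>l\<close>.\<close>

definition arrow_ideal_power :: "('v, 'a) pre_digraph \<Rightarrow> nat \<Rightarrow> (('v, 'a) path \<Rightarrow> 'k::field) set" where
  "arrow_ideal_power Q l =
    {x \<in> carrier (path_algebra Q). \<forall>u p. x (u, p) \<noteq> 0 \<longrightarrow> l \<le> length p}"

locale bound_quiver = fin_digraph Q
  for Q :: "('v, 'a) pre_digraph" +
  fixes I :: "(('v, 'a) path \<Rightarrow> 'k::alg_closed_field) set"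
  assumes connected: "Digraph_Component.connected Q"
    and ideal: "ideal I (path_algebra Q)"
    and admissible: "\<exists>m\<ge>2. arrow_ideal_power Q m \<subseteq> I \<and> I \<subseteq> arrow_ideal_power Q 2"


section \<open>Quotient modules\<close>

text \<open>
  The record type of modules of \<open>HOL-Algebra\<close> is used over arbitrary rings.  The ring multiplication
  and unit that it contains play no role.
\<close>

definition quot_module :: "('r, 'm) module \<Rightarrow> 'm set \<Rightarrow> ('r, 'm set) module" where
  "quot_module M N =
    \<lparr>carrier = a_rcosets\<^bsub>M\<^esub> N, mult = undefined, one = undefined, zero = N, add = set_add M,
     smult = (\<lambda>c X. \<Union>x\<in>X. N +>\<^bsub>M\<^esub> (c \<odot>\<^bsub>M\<^esub> x))\<rparr>"


section \<open>Zariski topology\<close>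

inductive_set polynomial_functions :: "('x \<Rightarrow> 'k::comm_ring_1) set \<Rightarrow> ('x \<Rightarrow> 'k) set"
  for F where
  coord: "f \<in> F \<Longrightarrow> f \<in> polynomial_functions F"
| const: "(\<lambda>_. c) \<in> polynomial_functions F"
| add: "f \<in> polynomial_functions F \<Longrightarrow> h \<in> polynomial_functions F \<Longrightarrow>
    (\<lambda>x. f x + h x) \<in> polynomial_functions F"
| mult: "f \<in> polynomial_functions F \<Longrightarrow> h \<in> polynomial_functions F \<Longrightarrow>
    (\<lambda>x. f x * h x) \<in> polynomial_functions F"

text \<open>
  The Zariski topology on the point set \<open>S\<close> with coordinate functions \<open>F\<close>; its basis consists of the
  principal open sets.
\<close>

definition zariski :: "'x set \<Rightarrow> ('x \<Rightarrow> 'k::field) set \<Rightarrow> 'x topology" where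
  "zariski S F = topology_generated_by {{x \<in> S. f x \<noteq> 0} | f. f \<in> polynomial_functions F}"

text \<open>Regular functions on an open subset \<open>U\<close>: locally a quotient of polynomial functions.\<close>

definition regular_on :: "'x set \<Rightarrow> ('x \<Rightarrow> 'k::field) set \<Rightarrow> 'x set \<Rightarrow> ('x \<Rightarrow> 'k) \<Rightarrow> bool" where
  "regular_on S F U q \<longleftrightarrow>
    (\<forall>x\<in>U. \<exists>W f h. openin (zariski S F) W \<and> x \<in> W \<and> W \<subseteq> U \<and>
      f \<in> polynomial_functions F \<and> h \<in> polynomial_functions F \<and>
      (\<forall>y\<in>W. h y \<noteq> 0 \<and> q y = f y / h y))"

definition irreducible_in :: "'x topology \<Rightarrow> 'x set \<Rightarrow> bool" where
  "irreducible_in X S \<longleftrightarrow> S \<subseteq> topspace X \<and> S \<noteq> {} \<and>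
    (\<forall>A B. closedin X A \<and> closedin X B \<and> S \<subseteq> A \<union> B \<longrightarrow> S \<subseteq> A \<or> S \<subseteq> B)"

definition irreducible_component_in :: "'x topology \<Rightarrow> 'x set \<Rightarrow> bool" where
  "irreducible_component_in X S \<longleftrightarrow> irreducible_in X S \<and>
    (\<forall>T. irreducible_in X T \<and> S \<subseteq> T \<longrightarrow> T = S)"

text \<open>The coordinate functions of a finite-dimensional vector space \<open>V\<close> are its linear forms.\<close>

definition linear_forms :: "('k::field, 'm) module \<Rightarrow> ('m \<Rightarrow> 'k) set" where
  "linear_forms V = module_hom class_ring V
    \<lparr>carrier = UNIV, mult = (*), one = 1, zero = 0, add = (+), smult = (*)\<rparr>"


section \<open>Complexes\<close>

record ('r, 'm) cochain_complex =
  obj :: "int \<Rightarrow> ('r, 'm) module"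
  diff :: "int \<Rightarrow> 'm \<Rightarrow> 'm"

definition shift :: "('r, 'm) cochain_complex \<Rightarrow> ('r, 'm) cochain_complex" where
  "shift X =
    \<lparr>obj = (\<lambda>i. obj X (i + 1)),
     diff = (\<lambda>i. \<lambda>x\<in>carrier (obj X (i + 1)). \<ominus>\<^bsub>obj X (i + 2)\<^esub> diff X (i + 1) x)\<rparr>"

type_synonym ('v, 'a, 'k) residue = "(('v, 'a) path \<Rightarrow> 'k) set"
type_synonym ('v, 'a, 'k) proj_element = "'v \<times> nat \<Rightarrow> ('v, 'a, 'k) residue"

context
  fixes Q :: "('v, 'a) pre_digraph"
    and I :: "(('v, 'a) path \<Rightarrow> 'k::alg_closed_field) set"
begin

section \<open>Modules over the algebra of a bound quiver\<close>

definition Lambda :: "('v, 'a, 'k) residue ring" where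
  "Lambda = path_algebra Q Quot I"

definition scalar :: "'k \<Rightarrow> ('v, 'a, 'k) residue" where
  "scalar c = I +>\<^bsub>path_algebra Q\<^esub> (\<lambda>w. c * \<one>\<^bsub>path_algebra Q\<^esub> w)"

definition vertex_idempotent :: "'v \<Rightarrow> ('v, 'a, 'k) residue" where
  "vertex_idempotent v = I +>\<^bsub>path_algebra Q\<^esub> (\<lambda>w. if w = (v, []) then 1 else 0)"

definition underlying_space ::
  "(('v, 'a, 'k) residue, 'm) module \<Rightarrow> ('k, 'm) module" where
  "underlying_space M =
    \<lparr>carrier = carrier M, mult = mult M, one = one M, zero = zero M, add = add M,
     smult = (\<lambda>c x. scalar c \<odot>\<^bsub>M\<^esub> x)\<rparr>"

definition dimension_vector :: "(('v, 'a, 'k) residue, 'm) module \<Rightarrow> 'v \<Rightarrow> nat" where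
  "dimension_vector M v = vectorspace.dim class_ring
    ((underlying_space M)\<lparr>carrier := (\<lambda>x. vertex_idempotent v \<odot>\<^bsub>M\<^esub> x) ` carrier M\<rparr>)"

definition hom_space ::
  "(('v, 'a, 'k) residue, 'm) module \<Rightarrow> (('v, 'a, 'k) residue, 'n) module \<Rightarrow>
    ('k, 'm \<Rightarrow> 'n) module" where
  "hom_space M N =
    \<lparr>carrier = module_hom Lambda M N \<inter> extensional (carrier M),
     mult = undefined, one = undefined,
     zero = (\<lambda>x\<in>carrier M. \<zero>\<^bsub>N\<^esub>),
     add = (\<lambda>f h. \<lambda>x\<in>carrier M. f x \<oplus>\<^bsub>N\<^esub> h x),
     smult = (\<lambda>c f. \<lambda>x\<in>carrier M. scalar c \<odot>\<^bsub>N\<^esub> f x)\<rparr>"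

definition hom_dim ::
  "(('v, 'a, 'k) residue, 'm) module \<Rightarrow> (('v, 'a, 'k) residue, 'n) module \<Rightarrow> nat" where
  "hom_dim M N = vectorspace.dim class_ring (hom_space M N)"

definition module_iso ::
  "(('v, 'a, 'k) residue, 'm) module \<Rightarrow> (('v, 'a, 'k) residue, 'n) module \<Rightarrow> bool" where
  "module_iso M N \<longleftrightarrow> (\<exists>f\<in>module_hom Lambda M N. bij_betw f (carrier M) (carrier N))"

text \<open>
  \<open>proj m\<close> is the direct sum over all vertices \<open>v\<close> of \<open>m v\<close> copies of the left ideal \<open>\<Lambda> e\<^sub>v\<close>, which is
  the projective cover of the simple module at \<open>v\<close>.
\<close>

definition proj ::
  "('v \<Rightarrow> nat) \<Rightarrow> (('v, 'a, 'k) residue, ('v, 'a, 'k) proj_element) module" where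
  "proj m = (let J = (SIGMA v:verts Q. {..<m v}) in
    \<lparr>carrier = (\<Pi>\<^sub>E (v, i)\<in>J. (\<lambda>x. x \<otimes>\<^bsub>Lambda\<^esub> vertex_idempotent v) ` carrier Lambda),
     mult = undefined, one = undefined,
     zero = (\<lambda>s\<in>J. \<zero>\<^bsub>Lambda\<^esub>),
     add = (\<lambda>x y. \<lambda>s\<in>J. x s \<oplus>\<^bsub>Lambda\<^esub> y s),
     smult = (\<lambda>r x. \<lambda>s\<in>J. r \<otimes>\<^bsub>Lambda\<^esub> x s)\<rparr>)"


section \<open>Homotopy category\<close>

definition chain_maps ::
  "(('v, 'a, 'k) residue, 'm) cochain_complex \<Rightarrow> (('v, 'a, 'k) residue, 'm) cochain_complex \<Rightarrow>
    ('k, int \<Rightarrow> 'm \<Rightarrow> 'm) module" where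
  "chain_maps X Y =
    \<lparr>carrier = {f. (\<forall>i. f i \<in> carrier (hom_space (obj X i) (obj Y i))) \<and>
        (\<forall>i. \<forall>x\<in>carrier (obj X i). f (i + 1) (diff X i x) = diff Y i (f i x))},
     mult = undefined, one = undefined,
     zero = (\<lambda>i. \<zero>\<^bsub>hom_space (obj X i) (obj Y i)\<^esub>),
     add = (\<lambda>f h i. f i \<oplus>\<^bsub>hom_space (obj X i) (obj Y i)\<^esub> h i),
     smult = (\<lambda>c f i. c \<odot>\<^bsub>hom_space (obj X i) (obj Y i)\<^esub> f i)\<rparr>"

definition null_homotopic ::
  "(('v, 'a, 'k) residue, 'm) cochain_complex \<Rightarrow> (('v, 'a, 'k) residue, 'm) cochain_complex \<Rightarrow>
    (int \<Rightarrow> 'm \<Rightarrow> 'm) set" where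
  "null_homotopic X Y = {f \<in> carrier (chain_maps X Y).
    \<exists>s. (\<forall>i. s i \<in> carrier (hom_space (obj X i) (obj Y (i - 1)))) \<and>
        (\<forall>i. \<forall>x\<in>carrier (obj X i).
          f i x = diff Y (i - 1) (s i x) \<oplus>\<^bsub>obj Y i\<^esub> s (i + 1) (diff X i x))}"

definition homotopy_hom_dim ::
  "(('v, 'a, 'k) residue, 'm) cochain_complex \<Rightarrow> (('v, 'a, 'k) residue, 'm) cochain_complex \<Rightarrow>
    nat" where
  "homotopy_hom_dim X Y =
    vectorspace.dim class_ring (quot_module (chain_maps X Y) (null_homotopic X Y))"


section \<open>g-vectors\<close>

definition gvectors :: "('v \<Rightarrow> int) set" where
  "gvectors = {g. \<forall>v. v \<notin> verts Q \<longrightarrow> g v = 0}"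

definition pos_mult :: "('v \<Rightarrow> int) \<Rightarrow> 'v \<Rightarrow> nat" where
  "pos_mult g v = nat (g v)"

definition neg_mult :: "('v \<Rightarrow> int) \<Rightarrow> 'v \<Rightarrow> nat" where
  "neg_mult g v = nat (- g v)"

definition presentation_space ::
  "('v \<Rightarrow> int) \<Rightarrow>
    ('k, ('v, 'a, 'k) proj_element \<Rightarrow> ('v, 'a, 'k) proj_element) module" where
  "presentation_space g = hom_space (proj (neg_mult g)) (proj (pos_mult g))"

definition two_term ::
  "('v \<Rightarrow> int) \<Rightarrow> (('v, 'a, 'k) proj_element \<Rightarrow> ('v, 'a, 'k) proj_element) \<Rightarrow>
    (('v, 'a, 'k) residue, ('v, 'a, 'k) proj_element) cochain_complex" where
  "two_term g a =
    \<lparr>obj = (\<lambda>i. if i = -1 then proj (neg_mult g) else if i = 0 then proj (pos_mult g)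
       else proj (\<lambda>_. 0)),
     diff = (\<lambda>i. if i = -1 then a
       else if i = 0 then (\<lambda>x\<in>carrier (proj (pos_mult g)). \<zero>\<^bsub>proj (\<lambda>_. 0)\<^esub>)
       else if i = -2 then (\<lambda>x\<in>carrier (proj (\<lambda>_. 0)). \<zero>\<^bsub>proj (neg_mult g)\<^esub>)
       else (\<lambda>x\<in>carrier (proj (\<lambda>_. 0)). \<zero>\<^bsub>proj (\<lambda>_. 0)\<^esub>))\<rparr>"

definition E_pair ::
  "('v \<Rightarrow> int) \<Rightarrow> (('v, 'a, 'k) proj_element \<Rightarrow> ('v, 'a, 'k) proj_element) \<Rightarrow>
    ('v \<Rightarrow> int) \<Rightarrow> (('v, 'a, 'k) proj_element \<Rightarrow> ('v, 'a, 'k) proj_element) \<Rightarrow> nat" where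
  "E_pair g a h b = homotopy_hom_dim (two_term g a) (shift (two_term h b))"

definition E_inv :: "('v \<Rightarrow> int) \<Rightarrow> ('v \<Rightarrow> int) \<Rightarrow> nat" where
  "E_inv g h = (LEAST n. \<exists>a\<in>carrier (presentation_space g). \<exists>b\<in>carrier (presentation_space h).
    n = E_pair g a h b)"

definition direct_summand :: "('v \<Rightarrow> int) \<Rightarrow> ('v \<Rightarrow> int) \<Rightarrow> bool" where
  "direct_summand h g \<longleftrightarrow> h \<in> gvectors \<and>
    (\<exists>h'\<in>gvectors. (\<forall>v. g v = h v + h' v) \<and> E_inv h h' = 0 \<and> E_inv h' h = 0)"

definition negative :: "('v \<Rightarrow> int) \<Rightarrow> bool" where
  "negative g \<longleftrightarrow> (\<forall>v. pos_mult g v = 0)"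

definition no_negative_summand :: "('v \<Rightarrow> int) \<Rightarrow> bool" where
  "no_negative_summand g \<longleftrightarrow> \<not> (\<exists>h. direct_summand h g \<and> h \<noteq> (\<lambda>_. 0) \<and> negative h)"

definition tame :: "('v \<Rightarrow> int) \<Rightarrow> bool" where
  "tame g \<longleftrightarrow> E_inv g g = 0"

definition wild :: "('v \<Rightarrow> int) \<Rightarrow> bool" where
  "wild g \<longleftrightarrow> \<not> tame g"

definition pairing :: "('v \<Rightarrow> int) \<Rightarrow> ('v \<Rightarrow> nat) \<Rightarrow> int" where
  "pairing g d = (\<Sum>v\<in>verts Q. g v * int (d v))"


section \<open>Representation varieties\<close>

primrec path_matrix :: "('v \<Rightarrow> nat) \<Rightarrow> ('a \<Rightarrow> 'k mat) \<Rightarrow> 'v \<Rightarrow> 'a list \<Rightarrow> 'k mat" where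
  "path_matrix d M u [] = 1\<^sub>m (d u)"
| "path_matrix d M u (\<alpha> # p) = path_matrix d M (head Q \<alpha>) p * M \<alpha>"

text \<open>The block of the action of \<open>x\<close> that maps the space at \<open>u\<close> to the space at \<open>v\<close>.\<close>

definition element_matrix ::
  "('v \<Rightarrow> nat) \<Rightarrow> ('a \<Rightarrow> 'k mat) \<Rightarrow> (('v, 'a) path \<Rightarrow> 'k) \<Rightarrow> 'v \<Rightarrow> 'v \<Rightarrow> 'k mat" where
  "element_matrix d M x u v = mat (d v) (d u) (\<lambda>ij.
    \<Sum>p | pre_digraph.awalk Q u p v \<and> x (u, p) \<noteq> 0. x (u, p) * path_matrix d M u p $$ ij)"

definition rep_variety :: "('v \<Rightarrow> nat) \<Rightarrow> ('a \<Rightarrow> 'k mat) set" where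
  "rep_variety d = {M \<in> (\<Pi>\<^sub>E \<alpha>\<in>arcs Q. carrier_mat (d (head Q \<alpha>)) (d (tail Q \<alpha>))).
    \<forall>x\<in>I. \<forall>u\<in>verts Q. \<forall>v\<in>verts Q. element_matrix d M x u v = 0\<^sub>m (d v) (d u)}"

definition rep_coordinates :: "('v \<Rightarrow> nat) \<Rightarrow> (('a \<Rightarrow> 'k mat) \<Rightarrow> 'k) set" where
  "rep_coordinates d = {\<lambda>M. M \<alpha> $$ (i, j) | \<alpha> i j.
    \<alpha> \<in> arcs Q \<and> i < d (head Q \<alpha>) \<and> j < d (tail Q \<alpha>)}"

definition rep_topology :: "('v \<Rightarrow> nat) \<Rightarrow> ('a \<Rightarrow> 'k mat) topology" where
  "rep_topology d = zariski (rep_variety d) (rep_coordinates d)"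

text \<open>
  The orbit consists of the \<open>N\<close> with \<open>N \<alpha> = h (head \<alpha>) * M \<alpha> * inverse (h (tail \<alpha>))\<close> for some \<open>h\<close> in
  the general linear group of \<open>d\<close>.
\<close>

definition orbit :: "('v \<Rightarrow> nat) \<Rightarrow> ('a \<Rightarrow> 'k mat) \<Rightarrow> ('a \<Rightarrow> 'k mat) set" where
  "orbit d M = {N \<in> rep_variety d.
    \<exists>h. (\<forall>v\<in>verts Q. h v \<in> carrier_mat (d v) (d v) \<and> invertible_mat (h v)) \<and>
        (\<forall>\<alpha>\<in>arcs Q. N \<alpha> * h (tail Q \<alpha>) = h (head Q \<alpha>) * M \<alpha>)}"

definition element_action ::
  "('v \<Rightarrow> nat) \<Rightarrow> ('a \<Rightarrow> 'k mat) \<Rightarrow> (('v, 'a) path \<Rightarrow> 'k) \<Rightarrow> ('v \<Rightarrow> 'k vec) \<Rightarrow> 'v \<Rightarrow> 'k vec" where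
  "element_action d M x m = (\<lambda>v\<in>verts Q. vec (d v) (\<lambda>i.
    \<Sum>u\<in>verts Q. vec_index (element_matrix d M x u v *\<^sub>v m u) i))"

text \<open>
  The module of a point of the representation variety.  A coset in \<open>\<Lambda>\<close> acts through any of its
  representatives; since \<open>I\<close> acts by zero the set under \<^const>\<open>the_elem\<close> is a singleton.
\<close>

definition rep_module ::
  "('v \<Rightarrow> nat) \<Rightarrow> ('a \<Rightarrow> 'k mat) \<Rightarrow> (('v, 'a, 'k) residue, 'v \<Rightarrow> 'k vec) module" where
  "rep_module d M =
    \<lparr>carrier = (\<Pi>\<^sub>E v\<in>verts Q. carrier_vec (d v)),
     mult = undefined, one = undefined,
     zero = (\<lambda>v\<in>verts Q. 0\<^sub>v (d v)),
     add = (\<lambda>x y. \<lambda>v\<in>verts Q. x v + y v),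
     smult = (\<lambda>r m. the_elem ((\<lambda>x. element_action d M x m) ` r))\<rparr>"

text \<open>\<open>X\<close> and \<open>Y\<close> consist of representations of dimension vector \<open>d\<close> and \<open>d'\<close>, respectively.\<close>

definition min_hom ::
  "('v \<Rightarrow> nat) \<Rightarrow> ('a \<Rightarrow> 'k mat) set \<Rightarrow> ('v \<Rightarrow> nat) \<Rightarrow> ('a \<Rightarrow> 'k mat) set \<Rightarrow> nat" where
  "min_hom d X d' Y = (LEAST n. \<exists>M\<in>X. \<exists>N\<in>Y. n = hom_dim (rep_module d M) (rep_module d' N))"


section \<open>Generic cokernels\<close>

definition cokernel ::
  "('v \<Rightarrow> int) \<Rightarrow> (('v, 'a, 'k) proj_element \<Rightarrow> ('v, 'a, 'k) proj_element) \<Rightarrow>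
    (('v, 'a, 'k) residue, ('v, 'a, 'k) proj_element set) module" where
  "cokernel g a = quot_module (proj (pos_mult g)) (a ` carrier (proj (neg_mult g)))"

definition presentation_topology ::
  "('v \<Rightarrow> int) \<Rightarrow> (('v, 'a, 'k) proj_element \<Rightarrow> ('v, 'a, 'k) proj_element) topology" where
  "presentation_topology g =
    zariski (carrier (presentation_space g)) (linear_forms (presentation_space g))"

definition generic_closure ::
  "('v \<Rightarrow> nat) \<Rightarrow> (('v, 'a, 'k) proj_element \<Rightarrow> ('v, 'a, 'k) proj_element) set \<Rightarrow>
    ((('v, 'a, 'k) proj_element \<Rightarrow> ('v, 'a, 'k) proj_element) \<Rightarrow> 'a \<Rightarrow> 'k mat) \<Rightarrow> ('a \<Rightarrow> 'k mat) set" where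
  "generic_closure d U \<phi> = rep_topology d closure_of (\<Union>a\<in>U. orbit d (\<phi> a))"

text \<open>
  The data provided by Plamondon's theorem for the g-vector \<open>g\<close>: the dimension vector \<open>d\<close>, the nonempty open
  set \<open>U\<close>, and the cokernel as a morphism of varieties, that is, a morphism \<open>\<phi>\<close> from \<open>U\<close> to the
  representation variety such that the point \<open>\<phi> a\<close> is isomorphic to the cokernel of \<open>a\<close>.
\<close>

definition generic_cokernel ::
  "('v \<Rightarrow> int) \<Rightarrow> ('v \<Rightarrow> nat) \<Rightarrow> (('v, 'a, 'k) proj_element \<Rightarrow> ('v, 'a, 'k) proj_element) set \<Rightarrow>
    ((('v, 'a, 'k) proj_element \<Rightarrow> ('v, 'a, 'k) proj_element) \<Rightarrow> 'a \<Rightarrow> 'k mat) \<Rightarrow> bool" where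
  "generic_cokernel g d U \<phi> \<longleftrightarrow>
    openin (presentation_topology g) U \<and> U \<noteq> {} \<and>
    (\<forall>a\<in>U. \<forall>v\<in>verts Q. dimension_vector (cokernel g a) v = d v) \<and>
    (\<forall>a\<in>U. \<phi> a \<in> rep_variety d \<and> module_iso (rep_module d (\<phi> a)) (cokernel g a)) \<and>
    (\<forall>c\<in>rep_coordinates d. regular_on (carrier (presentation_space g))
      (linear_forms (presentation_space g)) U (\<lambda>a. c (\<phi> a))) \<and>
    irreducible_component_in (rep_topology d) (generic_closure d U \<phi>)"

end

end

theory Submission
  imports Defs "HOL-Library.Function_Algebras"
begin

text \<open>
  Let a and b be maps between projectives P1 and P0 belonging to g, with cokernels X and Y of
  dimension vector d. Applying Hom(-, Y) to the presentation a of X gives an exact sequence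
  0, Hom(X, Y), Hom(P0, Y), Hom(P1, Y), in which the last two spaces have dimensions computed from d
  alone and the last map has a cokernel of dimension e(a, b), because homotopy classes of maps
  from a to the shift of b are maps from P1 to P0 modulo those of the form b s + t a.
  Therefore hom(X, Y) - e(a, b) is the pairing of g with d.

  The ranks of the linear maps involved are lower semicontinuous in the Zariski topology, so e and
  hom are upper semicontinuous in each argument. Since the space of presentations is
  irreducible, the minimum of e is attained on the open set U; since passing to a closure
  does not lower the minimum of hom, the minimum of hom on the generic component is e(g, g) plus the
  pairing of g with d. Wildness of g says that e(g, g) is positive.
\<close>


section \<open>Linear algebra\<close>

text \<open>The obstacle is that semicontinuity of a rank speaks about subspaces of one fixed space,
  whereas Hom(P0, Y) and Hom(P1, Y) move with Y. So each of the two numbers is expressed in a space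
  of its own that does not move: e(a, b) is the codimension of the maps b s + t a in Hom(P1, P0),
  and hom(M, N) is a number of matrix entries minus the rank of the map sending H to N H - H M,
  whose target depends on the dimension vectors alone. The exact sequence serves only to compare
  both numbers at given points. Ranks are compared without a global matrix. It suffices that every
  vector of the subspace at one point extends to a polynomial family of vectors in the subspaces at
  all points; such families arise by keeping s and t, or H, fixed while the presentations or
  representations vary. Both minima run over independent pairs. Better points are therefore found
  for one argument at a time, which avoids a topology on a product at the price of two successive
  uses of semicontinuity.\<close>

abbreviation vdim :: "('k::field, 'm) module \<Rightarrow> nat" where
  "vdim V \<equiv> vectorspace.dim class_ring V"

definition fdvs :: "('k::field, 'm) module \<Rightarrow> bool" where
  "fdvs V \<longleftrightarrow> vectorspace class_ring V \<and> vectorspace.fin_dim class_ring V"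

text \<open>What a subset has to satisfy in order to inherit the structure of a surrounding vector
  space; the axioms are then pulled back along the inclusion by
  \<open>vectorspace_inj\<close>.\<close>

definition closed_ops :: "('k::field, 'm) module \<Rightarrow> bool" where
  "closed_ops V \<longleftrightarrow> \<zero>\<^bsub>V\<^esub> \<in> carrier V \<and>
    (\<forall>x\<in>carrier V. \<forall>y\<in>carrier V. x \<oplus>\<^bsub>V\<^esub> y \<in> carrier V) \<and>
    (\<forall>c. \<forall>x\<in>carrier V. c \<odot>\<^bsub>V\<^esub> x \<in> carrier V)"

text \<open>Neither side is assumed to be a vector space, so that a map of this kind can be used to
  prove that one of them is. Hence the separate clause on zero, which follows from additivity only
  in the presence of a group.\<close>

definition lin :: "('k::field, 'm) module \<Rightarrow> ('k, 'n) module \<Rightarrow> ('m \<Rightarrow> 'n) \<Rightarrow> bool" where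
  "lin V W f \<longleftrightarrow> f \<in> carrier V \<rightarrow> carrier W \<and> f \<zero>\<^bsub>V\<^esub> = \<zero>\<^bsub>W\<^esub> \<and>
    (\<forall>x\<in>carrier V. \<forall>y\<in>carrier V. f (x \<oplus>\<^bsub>V\<^esub> y) = f x \<oplus>\<^bsub>W\<^esub> f y) \<and>
    (\<forall>c. \<forall>x\<in>carrier V. f (c \<odot>\<^bsub>V\<^esub> x) = c \<odot>\<^bsub>W\<^esub> f x)"

lemma closed_opsD:
  assumes "closed_ops V"
  shows "\<zero>\<^bsub>V\<^esub> \<in> carrier V"
    and "x \<in> carrier V \<Longrightarrow> y \<in> carrier V \<Longrightarrow> x \<oplus>\<^bsub>V\<^esub> y \<in> carrier V"
    and "x \<in> carrier V \<Longrightarrow> c \<odot>\<^bsub>V\<^esub> x \<in> carrier V"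
  using assms by (auto simp: closed_ops_def)

lemma linD:
  assumes "lin V W f"
  shows "x \<in> carrier V \<Longrightarrow> f x \<in> carrier W"
    and "f \<zero>\<^bsub>V\<^esub> = \<zero>\<^bsub>W\<^esub>"
    and "x \<in> carrier V \<Longrightarrow> y \<in> carrier V \<Longrightarrow> f (x \<oplus>\<^bsub>V\<^esub> y) = f x \<oplus>\<^bsub>W\<^esub> f y"
    and "x \<in> carrier V \<Longrightarrow> f (c \<odot>\<^bsub>V\<^esub> x) = c \<odot>\<^bsub>W\<^esub> f x"
  using assms by (auto simp: lin_def)

lemma linI:
  assumes "\<And>x. x \<in> carrier V \<Longrightarrow> f x \<in> carrier W"
    and "f \<zero>\<^bsub>V\<^esub> = \<zero>\<^bsub>W\<^esub>"
    and "\<And>x y. x \<in> carrier V \<Longrightarrow> y \<in> carrier V \<Longrightarrow> f (x \<oplus>\<^bsub>V\<^esub> y) = f x \<oplus>\<^bsub>W\<^esub> f y"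
    and "\<And>c x. x \<in> carrier V \<Longrightarrow> f (c \<odot>\<^bsub>V\<^esub> x) = c \<odot>\<^bsub>W\<^esub> f x"
  shows "lin V W f"
  using assms by (auto simp: lin_def)

lemma vectorspace_class_ring_iff:
  "vectorspace class_ring (V :: ('k::field, 'm) module) \<longleftrightarrow> Module.module class_ring V"
  using class_field by (auto simp: vectorspace_def)

text \<open>The assumption on -1 stands in for the existence of additive inverses.\<close>

lemma vectorspaceI:
  fixes V :: "('k::field, 'm) module"
  assumes "closed_ops V"
    and "\<And>x y z. x \<in> carrier V \<Longrightarrow> y \<in> carrier V \<Longrightarrow> z \<in> carrier V \<Longrightarrow>
      (x \<oplus>\<^bsub>V\<^esub> y) \<oplus>\<^bsub>V\<^esub> z = x \<oplus>\<^bsub>V\<^esub> (y \<oplus>\<^bsub>V\<^esub> z)"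
    and "\<And>x y. x \<in> carrier V \<Longrightarrow> y \<in> carrier V \<Longrightarrow> x \<oplus>\<^bsub>V\<^esub> y = y \<oplus>\<^bsub>V\<^esub> x"
    and "\<And>x. x \<in> carrier V \<Longrightarrow> \<zero>\<^bsub>V\<^esub> \<oplus>\<^bsub>V\<^esub> x = x"
    and "\<And>x. x \<in> carrier V \<Longrightarrow> (-1) \<odot>\<^bsub>V\<^esub> x \<oplus>\<^bsub>V\<^esub> x = \<zero>\<^bsub>V\<^esub>"
    and "\<And>a b x. x \<in> carrier V \<Longrightarrow> (a + b) \<odot>\<^bsub>V\<^esub> x = a \<odot>\<^bsub>V\<^esub> x \<oplus>\<^bsub>V\<^esub> b \<odot>\<^bsub>V\<^esub> x"
    and "\<And>a x y. x \<in> carrier V \<Longrightarrow> y \<in> carrier V \<Longrightarrow>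
      a \<odot>\<^bsub>V\<^esub> (x \<oplus>\<^bsub>V\<^esub> y) = a \<odot>\<^bsub>V\<^esub> x \<oplus>\<^bsub>V\<^esub> a \<odot>\<^bsub>V\<^esub> y"
    and "\<And>a b x. x \<in> carrier V \<Longrightarrow> (a * b) \<odot>\<^bsub>V\<^esub> x = a \<odot>\<^bsub>V\<^esub> (b \<odot>\<^bsub>V\<^esub> x)"
    and "\<And>x. x \<in> carrier V \<Longrightarrow> 1 \<odot>\<^bsub>V\<^esub> x = x"
  shows "vectorspace class_ring V"
  unfolding vectorspace_class_ring_iff
proof (rule module.intro)
  show "cring (class_ring :: 'k ring)" by (rule class_cring.cring_axioms)
  show "abelian_group V"
    by (rule abelian_groupI) (use assms closed_opsD[OF assms(1)] in \<open>auto intro!: bexI[of _ "(-1) \<odot>\<^bsub>V\<^esub> _"]\<close>)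
  show "module_axioms class_ring V"
    by (rule module_axioms.intro) (use assms closed_opsD[OF assms(1)] in auto)
qed

lemma vectorspaceD:
  fixes V :: "('k::field, 'm) module"
  assumes "vectorspace class_ring V"
  shows "closed_ops V"
    and "x \<in> carrier V \<Longrightarrow> y \<in> carrier V \<Longrightarrow> z \<in> carrier V \<Longrightarrow>
      (x \<oplus>\<^bsub>V\<^esub> y) \<oplus>\<^bsub>V\<^esub> z = x \<oplus>\<^bsub>V\<^esub> (y \<oplus>\<^bsub>V\<^esub> z)"
    and "x \<in> carrier V \<Longrightarrow> y \<in> carrier V \<Longrightarrow> x \<oplus>\<^bsub>V\<^esub> y = y \<oplus>\<^bsub>V\<^esub> x"
    and "x \<in> carrier V \<Longrightarrow> \<zero>\<^bsub>V\<^esub> \<oplus>\<^bsub>V\<^esub> x = x"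
    and "x \<in> carrier V \<Longrightarrow> x \<oplus>\<^bsub>V\<^esub> \<zero>\<^bsub>V\<^esub> = x"
    and "x \<in> carrier V \<Longrightarrow> (-1) \<odot>\<^bsub>V\<^esub> x \<oplus>\<^bsub>V\<^esub> x = \<zero>\<^bsub>V\<^esub>"
    and "x \<in> carrier V \<Longrightarrow> (a + b) \<odot>\<^bsub>V\<^esub> x = a \<odot>\<^bsub>V\<^esub> x \<oplus>\<^bsub>V\<^esub> b \<odot>\<^bsub>V\<^esub> x"
    and "x \<in> carrier V \<Longrightarrow> y \<in> carrier V \<Longrightarrow>
      a \<odot>\<^bsub>V\<^esub> (x \<oplus>\<^bsub>V\<^esub> y) = a \<odot>\<^bsub>V\<^esub> x \<oplus>\<^bsub>V\<^esub> a \<odot>\<^bsub>V\<^esub> y"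
    and "x \<in> carrier V \<Longrightarrow> (a * b) \<odot>\<^bsub>V\<^esub> x = a \<odot>\<^bsub>V\<^esub> (b \<odot>\<^bsub>V\<^esub> x)"
    and "x \<in> carrier V \<Longrightarrow> 1 \<odot>\<^bsub>V\<^esub> x = x"
    and "x \<in> carrier V \<Longrightarrow> 0 \<odot>\<^bsub>V\<^esub> x = \<zero>\<^bsub>V\<^esub>"
    and "a \<odot>\<^bsub>V\<^esub> \<zero>\<^bsub>V\<^esub> = \<zero>\<^bsub>V\<^esub>"
proof -
  interpret V: vectorspace "class_ring :: 'k ring" V by fact
  show "closed_ops V"
    using V.M.add.m_closed V.M.zero_closed V.smult_closed by (auto simp: closed_ops_def)
  show "0 \<odot>\<^bsub>V\<^esub> x = \<zero>\<^bsub>V\<^esub>" if "x \<in> carrier V"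
    using V.smult_l_null[OF that] by simp
  show "a \<odot>\<^bsub>V\<^esub> \<zero>\<^bsub>V\<^esub> = \<zero>\<^bsub>V\<^esub>"
    using V.smult_r_null[of a] by simp
  show "(-1) \<odot>\<^bsub>V\<^esub> x \<oplus>\<^bsub>V\<^esub> x = \<zero>\<^bsub>V\<^esub>" if x: "x \<in> carrier V"
    using V.smult_l_distr[of "-1" 1 x] V.smult_l_null[OF x] V.smult_one[OF x] x by simp
  show "x \<in> carrier V \<Longrightarrow> y \<in> carrier V \<Longrightarrow> z \<in> carrier V \<Longrightarrow>
      (x \<oplus>\<^bsub>V\<^esub> y) \<oplus>\<^bsub>V\<^esub> z = x \<oplus>\<^bsub>V\<^esub> (y \<oplus>\<^bsub>V\<^esub> z)"
    "x \<in> carrier V \<Longrightarrow> y \<in> carrier V \<Longrightarrow> x \<oplus>\<^bsub>V\<^esub> y = y \<oplus>\<^bsub>V\<^esub> x"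
    by (rule V.M.a_assoc, assumption+) (rule V.M.a_comm)
  show "x \<in> carrier V \<Longrightarrow> (a + b) \<odot>\<^bsub>V\<^esub> x = a \<odot>\<^bsub>V\<^esub> x \<oplus>\<^bsub>V\<^esub> b \<odot>\<^bsub>V\<^esub> x"
    using V.smult_l_distr[of a b x] by simp
  show "x \<in> carrier V \<Longrightarrow> y \<in> carrier V \<Longrightarrow>
      a \<odot>\<^bsub>V\<^esub> (x \<oplus>\<^bsub>V\<^esub> y) = a \<odot>\<^bsub>V\<^esub> x \<oplus>\<^bsub>V\<^esub> a \<odot>\<^bsub>V\<^esub> y"
    using V.smult_r_distr[of a x y] by simp
  show "x \<in> carrier V \<Longrightarrow> (a * b) \<odot>\<^bsub>V\<^esub> x = a \<odot>\<^bsub>V\<^esub> (b \<odot>\<^bsub>V\<^esub> x)"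
    using V.smult_assoc1[of a b x] by simp
  show "x \<in> carrier V \<Longrightarrow> 1 \<odot>\<^bsub>V\<^esub> x = x"
    using V.smult_one[of x] by simp
  show "x \<in> carrier V \<Longrightarrow> \<zero>\<^bsub>V\<^esub> \<oplus>\<^bsub>V\<^esub> x = x" "x \<in> carrier V \<Longrightarrow> x \<oplus>\<^bsub>V\<^esub> \<zero>\<^bsub>V\<^esub> = x"
    by simp_all
qed

text \<open>The axioms are equations, so they may be tested after applying the injective map;
  staying inside V is the task of \<open>closed_ops\<close>.\<close>

lemma vectorspace_inj:
  fixes V :: "('k::field, 'm) module" and W :: "('k, 'n) module"
  assumes W: "vectorspace class_ring W" and V: "closed_ops V" and f: "lin V W f"
    and inj: "inj_on f (carrier V)"
  shows "vectorspace class_ring V"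
proof -
  note V' = closed_opsD[OF V] and W' = vectorspaceD[OF W] and f' = linD[OF f]
  note * = inj_onD[OF inj]
  show ?thesis
    by (rule vectorspaceI[OF V]; rule *) (simp_all add: V' f' W')
qed

text \<open>Every element of V has the form \<open>f x\<close>, and each axiom for such elements is
  the image under \<open>f\<close> of the axiom in W.\<close>

lemma vectorspace_surj:
  fixes V :: "('k::field, 'm) module" and W :: "('k, 'n) module"
  assumes W: "vectorspace class_ring W" and f: "lin W V f"
    and surj: "f ` carrier W = carrier V"
  shows "vectorspace class_ring V"
proof -
  note W' = vectorspaceD[OF W] and C = closed_opsD[OF vectorspaceD(1)[OF W]] and f' = linD[OF f]
  have sym: "f x \<oplus>\<^bsub>V\<^esub> f y = f (x \<oplus>\<^bsub>W\<^esub> y)" "c \<odot>\<^bsub>V\<^esub> f x = f (c \<odot>\<^bsub>W\<^esub> x)" "\<zero>\<^bsub>V\<^esub> = f \<zero>\<^bsub>W\<^esub>"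
    if "x \<in> carrier W" "y \<in> carrier W" for x y c
    using that f' by auto
  have "closed_ops V"
    unfolding closed_ops_def surj[symmetric] using C f' by (auto simp: sym image_iff)
  then show ?thesis
    by (rule vectorspaceI; unfold surj[symmetric]; elim imageE; hypsubst)
       (simp add: sym C W'(2,4-) | metis W'(3))+
qed

lemma linear_mapI:
  fixes V :: "('k::field, 'm) module" and W :: "('k, 'n) module"
  assumes "vectorspace class_ring V" "vectorspace class_ring W" "lin V W f"
  shows "linear_map class_ring V W f"
  using assms unfolding linear_map_def mod_hom_def mod_hom_axioms_def module_hom_def lin_def
  by (auto simp: vectorspace_class_ring_iff)

lemma lin_kernel:
  assumes "closed_ops V" "lin V W f" "vectorspace class_ring W"
  shows "closed_ops (V\<lparr>carrier := {x \<in> carrier V. f x = \<zero>\<^bsub>W\<^esub>}\<rparr>)"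
  using assms vectorspaceD[OF assms(3)] closed_opsD[OF vectorspaceD(1)[OF assms(3)]]
  by (auto simp: closed_ops_def lin_def)

text \<open>Rank-nullity for surjections. The image of an arbitrary map is later inserted as the
  target with its carrier cut down.\<close>

lemma fdvs_surj:
  fixes V :: "('k::field, 'm) module" and W :: "('k, 'n) module"
  assumes V: "fdvs V" and f: "lin V W f" and surj: "f ` carrier V = carrier W"
  shows "fdvs W" "vdim V = vdim W + vdim (V\<lparr>carrier := {x \<in> carrier V. f x = \<zero>\<^bsub>W\<^esub>}\<rparr>)"
proof -
  have V': "vectorspace class_ring V" "vectorspace.fin_dim class_ring V"
    using V by (auto simp: fdvs_def)
  have W: "vectorspace class_ring W" using vectorspace_surj[OF V'(1) f surj] .
  interpret linear_map class_ring V W f by (rule linear_mapI[OF V'(1) W f])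
  show "fdvs W" unfolding fdvs_def using W rank_nullity_main(2)[OF V'(2) surj] by simp
  have "W\<lparr>carrier := im\<rparr> = W" using surj by (simp add: im_def)
  then show "vdim V = vdim W + vdim (V\<lparr>carrier := {x \<in> carrier V. f x = \<zero>\<^bsub>W\<^esub>}\<rparr>)"
    using rank_nullity_main(1)[OF V'(2)] by (simp add: ker_def)
qed

text \<open>An injective linear map keeps independent sets independent, so no independent set in V
  has more than \<open>vdim W\<close> elements. This bound yields a maximal independent set, which
  is a finite basis.\<close>

lemma fdvs_inj:
  fixes V :: "('k::field, 'm) module" and W :: "('k, 'n) module"
  assumes W: "fdvs W" and V: "closed_ops V" and f: "lin V W f" and inj: "inj_on f (carrier V)"
  shows "fdvs V" "vdim V \<le> vdim W"
proof -
  have W': "vectorspace class_ring W" "vectorspace.fin_dim class_ring W"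
    using W by (auto simp: fdvs_def)
  have V: "vectorspace class_ring V" using vectorspace_inj[OF W'(1) V f inj] .
  interpret linear_map class_ring V W f by (rule linear_mapI[OF V W'(1) f])
  have *: "finite A \<and> card A \<le> vdim W" if A: "A \<subseteq> carrier V" "V.module.lin_indpt A" for A
  proof -
    have injA: "inj_on f A" using inj A(1) by (meson inj_on_subset)
    have "W.module.lin_indpt (f ` A)"
    proof
      assume "W.module.lin_dep (f ` A)"
      then obtain B a w where B: "finite B" "B \<subseteq> f ` A" "W.module.lincomb a B = \<zero>\<^bsub>W\<^esub>" "w \<in> B" "a w \<noteq> 0"
        unfolding W.module.lin_dep_def by auto
      then obtain C where C: "C \<subseteq> A" "B = f ` C" by (meson subset_imageE)
      have fC: "finite C" using B(1) C injA by (meson finite_image_iff inj_on_subset)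
      have "f (V.module.lincomb (a \<circ> f) C) = W.module.lincomb a B"
        using lincomb_linear_image[OF inj, of C a] fC C A(1) by auto
      then have "f (V.module.lincomb (a \<circ> f) C) = f \<zero>\<^bsub>V\<^esub>" using B(3) by simp
      then have "V.module.lincomb (a \<circ> f) C = \<zero>\<^bsub>V\<^esub>"
        by (rule inj_onD[OF inj]) (use C(1) A(1) in \<open>auto intro!: V.module.lincomb_closed\<close>)
      then have "V.module.lin_dep A" unfolding V.module.lin_dep_def
        using B(4,5) C fC by (auto intro!: exI[of _ C] exI[of _ "a \<circ> f"])
      then show False using A(2) by simp
    qed
    moreover have "f ` A \<subseteq> carrier W" using A(1) f by (auto simp: lin_def)
    ultimately have "finite (f ` A)" "card (f ` A) \<le> vdim W"
      using W.li_le_dim[OF W'(2)] by auto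
    then show ?thesis using injA by (simp add: card_image finite_image_iff)
  qed
  have "V.module.lin_indpt {}" by (simp add: V.module.lin_dep_def)
  then obtain A where A: "finite A" "maximal A (\<lambda>S. S \<subseteq> carrier V \<and> V.module.lin_indpt S)"
    using maximal_exists[of "\<lambda>S. S \<subseteq> carrier V \<and> V.module.lin_indpt S" "vdim W" "{}"] * by auto
  then have b: "V.basis A" using V.max_li_is_basis by auto
  then have "V.fin_dim" unfolding V.fin_dim_def V.basis_def using A(1) by auto
  then show "fdvs V" using V by (simp add: fdvs_def)
  show "vdim V \<le> vdim W"
    using V.dim_basis[OF A(1) b] * b by (auto simp: V.basis_def)
qed

lemma vdim_bij:
  fixes V :: "('k::field, 'm) module" and W :: "('k, 'n) module"
  assumes V: "fdvs V" and f: "lin V W f" and bij: "bij_betw f (carrier V) (carrier W)"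
  shows "vdim W = vdim V"
proof -
  have surj: "f ` carrier V = carrier W" and inj: "inj_on f (carrier V)"
    using bij by (auto simp: bij_betw_def)
  have W: "fdvs W" by (rule fdvs_surj(1)[OF V f surj])
  interpret linear_map class_ring V W f
    by (rule linear_mapI) (use V W f in \<open>auto simp: fdvs_def\<close>)
  show ?thesis using dim_eq[OF _ inj surj] V by (auto simp: fdvs_def)
qed

lemma fdvs_subset:
  fixes V :: "('k::field, 'm) module"
  assumes "fdvs V" "closed_ops (V\<lparr>carrier := B\<rparr>)" "B \<subseteq> carrier V"
  shows "fdvs (V\<lparr>carrier := B\<rparr>)" "vdim (V\<lparr>carrier := B\<rparr>) \<le> vdim V"
  by (rule fdvs_inj[OF assms(1,2), of id]; use assms(3) in \<open>auto simp: lin_def\<close>)+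

section \<open>Coordinate spaces over arbitrary index sets\<close>

text \<open>Total functions vanishing off \<open>E\<close> take the place of vectors: any set can
  index coordinates, for instance triples of an arrow, a row and a column, and equality of elements
  is equality of functions.\<close>

definition coord_space :: "'e set \<Rightarrow> ('k::field, 'e \<Rightarrow> 'k) module" where
  "coord_space E = \<lparr>carrier = {f. \<forall>i. i \<notin> E \<longrightarrow> f i = 0}, mult = undefined, one = undefined,
    zero = (\<lambda>_. 0), add = (\<lambda>f h i. f i + h i), smult = (\<lambda>c f i. c * f i)\<rparr>"

lemma coord_space_simps:
  "f \<in> carrier (coord_space E) \<longleftrightarrow> (\<forall>i. i \<notin> E \<longrightarrow> f i = 0)"
  "\<zero>\<^bsub>coord_space E\<^esub> = (\<lambda>_. 0)"
  "f \<oplus>\<^bsub>coord_space E\<^esub> h = (\<lambda>i. f i + h i)"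
  "c \<odot>\<^bsub>coord_space E\<^esub> f = (\<lambda>i. c * f i)"
  by (simp_all add: coord_space_def)

lemma closed_ops_coord_space: "closed_ops (coord_space E)"
  by (auto simp: closed_ops_def coord_space_simps)

lemma vectorspace_coord_space: "vectorspace class_ring (coord_space E)"
  by (rule vectorspaceI[OF closed_ops_coord_space]) (auto simp: coord_space_simps algebra_simps)

text \<open>An enumeration of \<open>E\<close> identifies the space with the vectors of length
  \<open>card E\<close>.\<close>

lemma vdim_coord_space:
  assumes "finite E"
  shows "fdvs (coord_space E :: ('k::field, 'e \<Rightarrow> 'k) module)"
    and "vdim (coord_space E :: ('k::field, 'e \<Rightarrow> 'k) module) = card E"
proof -
  let ?C = "coord_space E :: ('k, 'e \<Rightarrow> 'k) module"
  obtain h where h: "bij_betw h E {0..<card E}" using ex_bij_betw_finite_nat[OF assms] by blast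
  interpret V: vec_space "TYPE('k)" "card E" .
  have V: "fdvs (module_vec TYPE('k) (card E))"
    using V.fin_dim vec_vs by (simp add: fdvs_def)
  define f where "f v i = (if i \<in> E then v $ h i else 0)" for v :: "'k vec" and i
  have hE: "h i < card E" if "i \<in> E" for i using h that by (auto simp: bij_betw_def)
  have f: "lin (module_vec TYPE('k) (card E)) ?C f"
    by (rule linI) (auto simp: f_def[abs_def] coord_space_simps module_vec_simps fun_eq_iff hE)
  have bij: "bij_betw f (carrier (module_vec TYPE('k) (card E))) (carrier ?C)"
  proof (rule bij_betwI[where g = "\<lambda>c. vec (card E) (\<lambda>j. c (the_inv_into E h j))"])
    show "f \<in> carrier (module_vec TYPE('k) (card E)) \<rightarrow> carrier ?C" using f by (auto simp: lin_def)
    have hh: "h (the_inv_into E h i) = i" if "i < card E" for i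
      using f_the_inv_into_f_bij_betw[OF h] that by auto
    have hh2: "the_inv_into E h i \<in> E" if "i < card E" for i
      using bij_betw_the_inv_into[OF h] that by (auto simp: bij_betw_def)
    show "vec (card E) (\<lambda>j. f x (the_inv_into E h j)) = x"
      if "x \<in> carrier (module_vec TYPE('k) (card E))" for x
      using that hh hh2 by (intro eq_vecI) (auto simp: f_def module_vec_simps)
    have "the_inv_into E h (h i) = i" if "i \<in> E" for i
      using h that by (simp add: bij_betw_def the_inv_into_f_f)
    then show "f (vec (card E) (\<lambda>j. y (the_inv_into E h j))) = y" if "y \<in> carrier ?C" for y
      using that hE by (auto simp: f_def coord_space_simps fun_eq_iff)
  qed (auto simp: module_vec_simps)
  show "fdvs ?C" using fdvs_surj(1)[OF V f] bij by (auto simp: bij_betw_def)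
  show "vdim ?C = card E" using vdim_bij[OF V f bij] V.dim_is_n by simp
qed

lemma lin_comp: "lin U V f \<Longrightarrow> lin V W h \<Longrightarrow> lin U W (\<lambda>x. h (f x))"
  by (auto simp: lin_def Pi_iff)

lemma lin_inv_into:
  assumes "closed_ops V" "lin V W f" "bij_betw f (carrier V) (carrier W)"
  shows "lin W V (inv_into (carrier V) f)"
proof (rule linI)
  note V = closed_opsD[OF assms(1)] and f = linD[OF assms(2)]
  have inj: "inj_on f (carrier V)" and surj: "f ` carrier V = carrier W"
    using assms(3) by (auto simp: bij_betw_def)
  note i = inv_into_f_f[OF inj]
  show "inv_into (carrier V) f \<zero>\<^bsub>W\<^esub> = \<zero>\<^bsub>V\<^esub>" using i[OF V(1)] f(2) by simp
  show "inv_into (carrier V) f x \<in> carrier V" if "x \<in> carrier W" for x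
    using that unfolding surj[symmetric] by (rule inv_into_into)
  show "inv_into (carrier V) f (x \<oplus>\<^bsub>W\<^esub> y) = inv_into (carrier V) f x \<oplus>\<^bsub>V\<^esub> inv_into (carrier V) f y"
    if "x \<in> carrier W" "y \<in> carrier W" for x y
    using that unfolding surj[symmetric] by (elim imageE, hypsubst, subst f(3)[symmetric]) (auto simp: i V)
  show "inv_into (carrier V) f (c \<odot>\<^bsub>W\<^esub> x) = c \<odot>\<^bsub>V\<^esub> inv_into (carrier V) f x"
    if "x \<in> carrier W" for c x
    using that unfolding surj[symmetric] by (elim imageE, hypsubst, subst f(4)[symmetric]) (auto simp: i V)
qed

lemma lin_coord_reindex:
  assumes h: "bij_betw h E D"
  shows "\<exists>f. lin (coord_space D) (coord_space E) f \<and>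
    bij_betw f (carrier (coord_space D)) (carrier (coord_space E))"
proof (intro exI conjI)
  let ?f = "\<lambda>c i. if i \<in> E then c (h i) else 0"
  have hE: "h i \<in> D" if "i \<in> E" for i using h that by (auto simp: bij_betw_def)
  show "lin (coord_space D) (coord_space E) ?f"
    by (rule linI) (auto simp: coord_space_simps fun_eq_iff hE)
  have hh: "h (the_inv_into E h i) = i" if "i \<in> D" for i
    using f_the_inv_into_f_bij_betw[OF h] that by auto
  have hh2: "the_inv_into E h i \<in> E" if "i \<in> D" for i
    using bij_betw_the_inv_into[OF h] that by (auto simp: bij_betw_def)
  have "the_inv_into E h (h i) = i" if "i \<in> E" for i
    using h that by (simp add: bij_betw_def the_inv_into_f_f)
  then show "bij_betw ?f (carrier (coord_space D)) (carrier (coord_space E))"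
    using hE hh hh2 by (intro bij_betwI[where g = "\<lambda>c i. if i \<in> D then c (the_inv_into E h i) else 0"])
      (auto simp: coord_space_simps fun_eq_iff)
qed

text \<open>Taking linear combinations of a finite basis is the required isomorphism, and an
  enumeration of that basis makes an initial segment of the naturals the index set, so that later
  arguments mention no basis.\<close>

lemma fdvs_coordinates:
  fixes V :: "('k::field, 'm) module"
  assumes V: "fdvs V"
  shows "\<exists>f. lin (coord_space {..<vdim V}) V f \<and> bij_betw f (carrier (coord_space {..<vdim V})) (carrier V)"
proof -
  interpret V: vectorspace class_ring V using V by (simp add: fdvs_def)
  obtain B where B: "finite B" "V.basis B" using V.finite_basis_exists V by (auto simp: fdvs_def)
  have BV: "B \<subseteq> carrier V" using B(2) by (simp add: V.basis_def)
  let ?l = "\<lambda>c. V.module.lincomb c B"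
  \<comment> \<open>A linear combination ignores the coefficients off \<open>B\<close>, so
    additivity is taken from functions restricted to \<open>B\<close> and carried over.\<close>
  have add: "?l (\<lambda>i. a i + b i) = ?l a \<oplus>\<^bsub>V\<^esub> ?l b" for a b
  proof -
    interpret mod_hom class_ring "LinearCombinations.ring.func_space class_ring B" V ?l
      by (rule V.lincomb_is_mod_hom[OF B(1) BV])
    have "?l (restrict a B \<oplus>\<^bsub>LinearCombinations.ring.func_space class_ring B\<^esub> restrict b B) = ?l (restrict a B) \<oplus>\<^bsub>V\<^esub> ?l (restrict b B)"
      by (rule f_add) (auto simp: class_ring.func_space_def)
    moreover have "?l (restrict a B \<oplus>\<^bsub>LinearCombinations.ring.func_space class_ring B\<^esub> restrict b B) = ?l (\<lambda>i. a i + b i)"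
      by (rule V.lincomb_cong) (use BV in \<open>auto simp: class_ring.func_space_def\<close>)
    moreover have "?l (restrict a B) = ?l a" "?l (restrict b B) = ?l b"
      by (rule V.lincomb_cong; use BV in auto)+
    ultimately show ?thesis by simp
  qed
  have l: "lin (coord_space B) V ?l"
  proof (rule linI)
    show "?l \<zero>\<^bsub>coord_space B\<^esub> = \<zero>\<^bsub>V\<^esub>"
      by (rule V.lincomb_zero) (use BV in \<open>auto simp: coord_space_simps\<close>)
    show "?l (c \<odot>\<^bsub>coord_space B\<^esub> x) = c \<odot>\<^bsub>V\<^esub> ?l x" for c x
      using V.lincomb_smult[of B x c] BV by (auto simp: coord_space_simps)
  qed (use BV in \<open>auto simp: add coord_space_simps intro!: V.lincomb_closed\<close>)
  have bij: "bij_betw ?l (carrier (coord_space B)) (carrier V)"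
  proof -
    have *: "\<forall>v. v \<in> carrier V \<longrightarrow> (\<exists>!a. a \<in> B \<rightarrow>\<^sub>E UNIV \<and> ?l a = v)"
      using V.basis_criterion[OF B(1) BV] B(2) by simp
    have r: "?l (restrict a B) = ?l a" for a by (rule V.lincomb_cong) (use BV in auto)
    have "inj_on ?l (carrier (coord_space B))"
    proof (rule inj_onI)
      fix x y assume xy: "x \<in> carrier (coord_space B)" "y \<in> carrier (coord_space B)" "?l x = ?l y"
      have "restrict x B = restrict y B"
        using * l xy(1,3) r by (metis (no_types, lifting) PiE_UNIV_domain UNIV_I linD(1) restrict_PiE_iff)
      then show "x = y" using xy(1,2) by (auto simp: coord_space_simps fun_eq_iff restrict_def) metis
    qed
    moreover have "v \<in> ?l ` carrier (coord_space B)" if v: "v \<in> carrier V" for v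
    proof -
      obtain a where a: "?l a = v" using * v by blast
      have "?l (\<lambda>i. if i \<in> B then a i else 0) = ?l a" by (rule V.lincomb_cong) (use BV in auto)
      then show ?thesis using a by (intro image_eqI[of _ _ "\<lambda>i. if i \<in> B then a i else 0"]) (auto simp: coord_space_simps)
    qed
    ultimately show ?thesis using l by (auto simp: bij_betw_def lin_def)
  qed
  have "vdim V = card B" using V.dim_basis[OF B] .
  then have "\<exists>h. bij_betw h B {..<vdim V}"
    using ex_bij_betw_finite_nat[OF B(1)] by (simp add: lessThan_atLeast0)
  then obtain f where f: "lin (coord_space {..<vdim V} :: ('k, nat \<Rightarrow> 'k) module) (coord_space B) f"
    "bij_betw f (carrier (coord_space {..<vdim V})) (carrier (coord_space B))"
    using lin_coord_reindex by blast
  show ?thesis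
    using lin_comp[OF f(1) l] bij_betw_trans[OF f(2) bij] by (auto simp: comp_def)
qed

text \<open>Cutting functions off outside \<open>D\<close> extends \<open>f\<close> to a linear map
  on all functions, which form a vector space as a type. There an injective map on a subspace has a
  linear left inverse with values in that subspace.\<close>

lemma coord_left_inverse:
  fixes f :: "('d \<Rightarrow> 'k::field) \<Rightarrow> 'e \<Rightarrow> 'k"
  assumes f: "lin (coord_space D) (coord_space E) f" and inj: "inj_on f (carrier (coord_space D))"
  shows "\<exists>g. lin (coord_space E) (coord_space D) g \<and> (\<forall>x\<in>carrier (coord_space D). g (f x) = x)"
proof -
  interpret vector_space_pair "\<lambda>(c::'k) (x::'d \<Rightarrow> 'k) i. c * x i" "\<lambda>(c::'k) (x::'e \<Rightarrow> 'k) i. c * x i"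
    by unfold_locales (auto simp: fun_eq_iff algebra_simps)
  define r where "r x i = (if i \<in> D then x i else 0)" for x :: "'d \<Rightarrow> 'k" and i
  have r: "lin (coord_space UNIV) (coord_space D) r"
    by (rule linI) (auto simp: r_def[abs_def] coord_space_simps)
  have rid: "r x = x" if "x \<in> carrier (coord_space D)" for x
    using that by (auto simp: r_def coord_space_simps)
  have l: "Vector_Spaces.linear (\<lambda>c x i. c * x i) (\<lambda>c x i. c * x i) (\<lambda>x. f (r x))"
    using linD[OF lin_comp[OF r f]]
    by unfold_locales (simp_all add: coord_space_simps plus_fun_def)
  have "vs1.subspace (carrier (coord_space D))"
    by (auto simp: vs1.subspace_def coord_space_simps)
  moreover have "inj_on (\<lambda>x. f (r x)) (carrier (coord_space D))"
    using inj by (auto simp: inj_on_def rid)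
  ultimately obtain g where g: "g ` UNIV \<subseteq> carrier (coord_space D)"
    "Vector_Spaces.linear (\<lambda>c x i. c * x i) (\<lambda>c x i. c * x i) g"
    "\<forall>x\<in>carrier (coord_space D). g (f (r x)) = x"
    using linear_exists_left_inverse_on[OF l] by blast
  interpret g: Vector_Spaces.linear "\<lambda>c x i. c * x i" "\<lambda>c x i. c * x i" g by (fact g(2))
  have "lin (coord_space E) (coord_space D) g"
    using subsetD[OF g(1) rangeI] g.add g.scale g.zero by (intro linI) (auto simp: coord_space_simps plus_fun_def zero_fun_def)
  then show ?thesis using g(3) by (auto simp: rid)
qed

section \<open>Powers of a vector space\<close>

text \<open>The target of evaluation maps: a homomorphism is recorded by its values, either at all
  elements of its source or at generators only.\<close>

definition power_space :: "'s set \<Rightarrow> ('k::field, 'm) module \<Rightarrow> ('k, 's \<Rightarrow> 'm) module" where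
  "power_space S V = \<lparr>carrier = (S \<rightarrow>\<^sub>E carrier V), mult = undefined, one = undefined,
    zero = (\<lambda>s\<in>S. \<zero>\<^bsub>V\<^esub>), add = (\<lambda>x y. \<lambda>s\<in>S. x s \<oplus>\<^bsub>V\<^esub> y s), smult = (\<lambda>c x. \<lambda>s\<in>S. c \<odot>\<^bsub>V\<^esub> x s)\<rparr>"

lemma fdvs_power_space:
  assumes S: "finite S" and V: "fdvs V"
  shows "fdvs (power_space S V)"
proof -
  let ?n = "vdim V"
  note V' = vectorspaceD(1)[of V] and C = closed_opsD[OF vectorspaceD(1)[of V]]
  have vs: "vectorspace class_ring V" using V by (simp add: fdvs_def)
  note C = closed_opsD[OF vectorspaceD(1)[OF vs]]
  obtain f where f: "lin (coord_space {..<?n}) V f"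
    "bij_betw f (carrier (coord_space {..<?n})) (carrier V)" using fdvs_coordinates[OF V] by blast
  define h where "h = inv_into (carrier (coord_space {..<?n})) f"
  have h: "lin V (coord_space {..<?n}) h"
    unfolding h_def by (rule lin_inv_into[OF closed_ops_coord_space f])
  have hinj: "inj_on h (carrier V)"
    using bij_betw_inv_into[OF f(2)] by (simp add: h_def bij_betw_def)
  note h' = linD[OF h, unfolded coord_space_simps]
  show ?thesis
  proof (rule fdvs_inj(1)[OF vdim_coord_space(1)])
    show "finite (S \<times> {..<?n})" using S by simp
    show "closed_ops (power_space S V)"
      using C by (auto simp: closed_ops_def power_space_def PiE_iff)
    show "lin (power_space S V) (coord_space (S \<times> {..<?n})) (\<lambda>x (s, i). if s \<in> S then h (x s) i else 0)"
      by (rule linI) (auto simp: power_space_def coord_space_simps fun_eq_iff h'(2-) Pi_iff PiE_iff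
        dest!: h'(1))
    show "inj_on (\<lambda>x (s, i). if s \<in> S then h (x s) i else 0) (carrier (power_space S V))"
    proof (rule inj_onI)
      fix x y assume xy: "x \<in> carrier (power_space S V)" "y \<in> carrier (power_space S V)"
        and eq: "(\<lambda>(s, i). if s \<in> S then h (x s) i else 0) = (\<lambda>(s, i). if s \<in> S then h (y s) i else 0)"
      have "h (x s) = h (y s)" if "s \<in> S" for s
      proof
        show "h (x s) i = h (y s) i" for i using that fun_cong[OF eq, of "(s, i)"] by simp
      qed
      then show "x = y"
        using xy hinj by (intro PiE_ext[of x S "\<lambda>_. carrier V" y]) (auto simp: power_space_def inj_on_def PiE_iff)
    qed
  qed
qed


section \<open>Polynomial functions and semicontinuity of ranks\<close>

lemma polynomial_functions_sum:
  "(\<And>i. i \<in> A \<Longrightarrow> f i \<in> polynomial_functions F) \<Longrightarrow> (\<lambda>x. \<Sum>i\<in>A. f i x) \<in> polynomial_functions F"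
  by (induction A rule: infinite_finite_induct)
     (auto intro: polynomial_functions.const polynomial_functions.add)

lemma polynomial_functions_prod:
  "(\<And>i. i \<in> A \<Longrightarrow> f i \<in> polynomial_functions F) \<Longrightarrow> (\<lambda>x. \<Prod>i\<in>A. f i x) \<in> polynomial_functions F"
  by (induction A rule: infinite_finite_induct)
     (auto intro: polynomial_functions.const polynomial_functions.mult)

text \<open>The Leibniz formula writes the determinant as a polynomial in the entries.\<close>

lemma polynomial_functions_det:
  assumes "\<And>i j. i < n \<Longrightarrow> j < n \<Longrightarrow> (\<lambda>x. f x i j) \<in> polynomial_functions F"
  shows "(\<lambda>x. det (mat n n (\<lambda>(i, j). f x i j))) \<in> polynomial_functions F"
proof -
  have "(\<lambda>x. \<Sum>p | p permutes {0..<n}. signof p * (\<Prod>i = 0..<n. f x i (p i))) \<in> polynomial_functions F"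
    by (intro polynomial_functions_sum polynomial_functions.mult polynomial_functions.const
        polynomial_functions_prod assms) (auto dest: permutes_in_image)
  moreover have "det (mat n n (\<lambda>(i, j). f x i j)) =
    (\<Sum>p | p permutes {0..<n}. signof p * (\<Prod>i = 0..<n. f x i (p i)))" for x
    by (subst det_def'[of _ n]) (auto intro!: sum.cong prod.cong dest: permutes_in_image)
  ultimately show ?thesis by simp
qed

lemma linear_forms_iff:
  fixes V :: "('k::field, 'm) module"
  shows "l \<in> linear_forms V \<longleftrightarrow>
    (\<forall>x\<in>carrier V. \<forall>y\<in>carrier V. l (x \<oplus>\<^bsub>V\<^esub> y) = l x + l y) \<and>
    (\<forall>c. \<forall>x\<in>carrier V. l (c \<odot>\<^bsub>V\<^esub> x) = c * l x)"
  by (auto simp: linear_forms_def module_hom_def)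

text \<open>By \<open>sections\<close>, each vector of \<open>B x0\<close> moves polynomially with x
  inside the subspaces \<open>B x\<close>. Move a basis of \<open>B x0\<close> in this way and map
  it to coordinates of \<open>B x0\<close> by a fixed linear map on V: the result is a square matrix
  with polynomial entries that is the identity at \<open>x0\<close>, and \<open>p\<close> is its
  determinant. Where \<open>p\<close> does not vanish, \<open>B x\<close> is mapped onto a space of
  the dimension of \<open>B x0\<close>.\<close>

lemma rank_semicontinuous:
  fixes V :: "('k::field, 'm) module" and B :: "'x \<Rightarrow> 'm set"
  assumes V: "fdvs V" and B: "\<And>x. x \<in> X \<Longrightarrow> B x \<subseteq> carrier V \<and> closed_ops (V\<lparr>carrier := B x\<rparr>)"
    and x0: "x0 \<in> X"
    and sections: "\<And>v. v \<in> B x0 \<Longrightarrow> \<exists>\<sigma>. \<sigma> x0 = v \<and> (\<forall>x\<in>X. \<sigma> x \<in> B x) \<and>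
      (\<forall>l\<in>linear_forms V. \<exists>p\<in>polynomial_functions F. \<forall>x\<in>X. l (\<sigma> x) = p x)"
  shows "\<exists>p\<in>polynomial_functions F. p x0 \<noteq> 0 \<and>
    (\<forall>x\<in>X. p x \<noteq> 0 \<longrightarrow> vdim (V\<lparr>carrier := B x0\<rparr>) \<le> vdim (V\<lparr>carrier := B x\<rparr>))"
proof -
  let ?B = "\<lambda>x. V\<lparr>carrier := B x\<rparr>"
  let ?r = "vdim (?B x0)" and ?n = "vdim V"
  have fB: "fdvs (?B x)" if "x \<in> X" for x using fdvs_subset(1)[OF V] B that by blast
  obtain \<psi> where \<psi>: "lin (coord_space {..<?r}) (?B x0) \<psi>"
    "bij_betw \<psi> (carrier (coord_space {..<?r})) (B x0)" using fdvs_coordinates[OF fB[OF x0]] by auto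
  obtain \<chi> where \<chi>: "lin (coord_space {..<?n}) V \<chi>"
    "bij_betw \<chi> (carrier (coord_space {..<?n})) (carrier V)" using fdvs_coordinates[OF V] by blast
  define h where "h = inv_into (carrier (coord_space {..<?n})) \<chi>"
  have h: "lin V (coord_space {..<?n}) h"
    unfolding h_def by (rule lin_inv_into[OF closed_ops_coord_space \<chi>])
  have hinj: "inj_on h (carrier V)"
    using bij_betw_inv_into[OF \<chi>(2)] by (simp add: h_def bij_betw_def)
  have \<psi>V: "lin (coord_space {..<?r}) V \<psi>" using \<psi>(1) B[OF x0] by (auto simp: lin_def)
  have inj: "inj_on (\<lambda>c. h (\<psi> c)) (carrier (coord_space {..<?r}))"
    using \<psi>(2) linD(1)[OF \<psi>V] hinj unfolding bij_betw_def inj_on_def by auto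
  \<comment> \<open>In coordinates, \<open>g\<close> is a left inverse of the inclusion of
    \<open>B x0\<close>. Following \<open>h\<close> by \<open>g\<close> gives a linear map on all of
    V, which can also be applied to sections that have left \<open>B x0\<close>.\<close>
  obtain g where g: "lin (coord_space {..<?n}) (coord_space {..<?r}) g"
    "\<And>c. c \<in> carrier (coord_space {..<?r}) \<Longrightarrow> g (h (\<psi> c)) = c"
    using coord_left_inverse[OF lin_comp[OF \<psi>V h] inj] by blast
  have gh: "lin V (coord_space {..<?r}) (\<lambda>v. g (h v))" by (rule lin_comp[OF h g(1)])
  have form: "(\<lambda>v. g (h v) i) \<in> linear_forms V" for i
    using linD[OF gh] by (auto simp: linear_forms_iff coord_space_simps)
  define \<delta> where "\<delta> j = (\<lambda>i. if i = j then 1 else 0 :: 'k)" for j :: nat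
  have \<delta>: "\<delta> j \<in> carrier (coord_space {..<?r})" if "j < ?r" for j
    using that by (auto simp: \<delta>_def coord_space_simps)
  have "\<exists>\<sigma>. \<sigma> x0 = \<psi> (\<delta> j) \<and> (\<forall>x\<in>X. \<sigma> x \<in> B x) \<and>
      (\<forall>l\<in>linear_forms V. \<exists>p\<in>polynomial_functions F. \<forall>x\<in>X. l (\<sigma> x) = p x)" if "j < ?r" for j
    by (rule sections) (use linD(1)[OF \<psi>(1) \<delta>[OF that]] in simp)
  then have "\<forall>j. \<exists>\<sigma>. j < ?r \<longrightarrow> \<sigma> x0 = \<psi> (\<delta> j) \<and> (\<forall>x\<in>X. \<sigma> x \<in> B x) \<and>
      (\<forall>l\<in>linear_forms V. \<exists>p\<in>polynomial_functions F. \<forall>x\<in>X. l (\<sigma> x) = p x)" by blast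
  then obtain \<sigma> where "\<forall>j. j < ?r \<longrightarrow> \<sigma> j x0 = \<psi> (\<delta> j) \<and> (\<forall>x\<in>X. \<sigma> j x \<in> B x) \<and>
      (\<forall>l\<in>linear_forms V. \<exists>p\<in>polynomial_functions F. \<forall>x\<in>X. l (\<sigma> j x) = p x)"
    unfolding choice_iff by blast
  then have \<sigma>: "\<And>j. j < ?r \<Longrightarrow> \<sigma> j x0 = \<psi> (\<delta> j)"
    "\<And>j x. j < ?r \<Longrightarrow> x \<in> X \<Longrightarrow> \<sigma> j x \<in> B x"
    "\<And>j l. j < ?r \<Longrightarrow> l \<in> linear_forms V \<Longrightarrow>
      \<exists>p\<in>polynomial_functions F. \<forall>x\<in>X. l (\<sigma> j x) = p x" by auto
  have "\<exists>p\<in>polynomial_functions F. \<forall>x\<in>X. g (h (\<sigma> j x)) i = p x" if "j < ?r" for i j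
    using \<sigma>(3)[OF that form[of i]] by simp
  then have "\<forall>i j. \<exists>p. j < ?r \<longrightarrow> p \<in> polynomial_functions F \<and> (\<forall>x\<in>X. g (h (\<sigma> j x)) i = p x)"
    by blast
  then obtain P where "\<forall>i j. j < ?r \<longrightarrow> P i j \<in> polynomial_functions F \<and>
    (\<forall>x\<in>X. g (h (\<sigma> j x)) i = P i j x)" unfolding choice_iff by blast
  then have P: "\<And>i j. j < ?r \<Longrightarrow> P i j \<in> polynomial_functions F"
    "\<And>i j x. j < ?r \<Longrightarrow> x \<in> X \<Longrightarrow> g (h (\<sigma> j x)) i = P i j x" by auto
  \<comment> \<open>Column j holds the image of the section through the j-th basis vector of
    \<open>B x0\<close>.\<close>
  define A where "A x = mat ?r ?r (\<lambda>(i, j). P i j x)" for x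
  have p: "(\<lambda>x. det (A x)) \<in> polynomial_functions F"
    unfolding A_def by (rule polynomial_functions_det) (rule P)
  have "A x0 = 1\<^sub>m ?r"
    by (rule eq_matI) (auto simp: A_def P(2)[symmetric] x0 \<sigma>(1) g(2) \<delta>, auto simp: \<delta>_def)
  then have "det (A x0) \<noteq> 0" by simp
  moreover have "?r \<le> vdim (?B x)" if x: "x \<in> X" and d: "det (A x) \<noteq> 0" for x
  proof -
    have A: "A x \<in> carrier_mat ?r ?r" by (simp add: A_def)
    obtain C where C: "C \<in> carrier_mat ?r ?r" "A x * C = 1\<^sub>m ?r"
      using det_non_zero_imp_unit[OF A d, of "()"] by (auto simp: Units_def ring_mat_def)
    have l: "lin (?B x) (coord_space {..<?r}) (\<lambda>v. g (h v))" using gh B[OF x] by (auto simp: lin_def subset_iff)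
    note cB = closed_opsD[OF vectorspaceD(1), of "?B x"]
    have vsB: "vectorspace class_ring (?B x)" using fB[OF x] by (simp add: fdvs_def)
    \<comment> \<open>Stated for subsets J so that a combination is built by adding one section at a
      time, with every partial sum in \<open>B x\<close>.\<close>
    have comb: "\<exists>v\<in>B x. g (h v) = (\<lambda>i. \<Sum>j\<in>J. b j * P i j x)" if "finite J" "J \<subseteq> {..<?r}" for J b
      using that
    proof (induction J rule: finite_induct)
      case empty
      then show ?case using linD(2)[OF l] cB(1)[OF vsB] by (auto simp: coord_space_simps)
    next
      case (insert k J)
      then obtain v where v: "v \<in> B x" "g (h v) = (\<lambda>i. \<Sum>j\<in>J. b j * P i j x)" by auto
      have k: "k < ?r" using insert by auto
      have kB: "\<sigma> k x \<in> carrier (?B x)" using \<sigma>(2)[OF k x] by simp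
      have bkB: "b k \<odot>\<^bsub>?B x\<^esub> \<sigma> k x \<in> carrier (?B x)" by (rule cB(3)[OF vsB kB])
      have vB: "v \<in> carrier (?B x)" using v by simp
      have "g (h (b k \<odot>\<^bsub>?B x\<^esub> \<sigma> k x \<oplus>\<^bsub>?B x\<^esub> v)) = (\<lambda>i. \<Sum>j\<in>insert k J. b j * P i j x)"
        unfolding linD(3)[OF l bkB vB] linD(4)[OF l kB] using insert(1,2) v(2) P(2)[OF k x]
        by (simp add: coord_space_simps)
      then show ?case using cB(2)[OF vsB bkB vB] by auto
    qed
    have "c \<in> (\<lambda>v. g (h v)) ` carrier (?B x)" if c: "c \<in> carrier (coord_space {..<?r})" for c
    proof -
      \<comment> \<open>These coefficients solve the linear system with matrix \<open>A x\<close>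
        and right-hand side \<open>c\<close>, as \<open>C\<close> is its inverse.\<close>
      define b where "b j = (C *\<^sub>v vec ?r c) $ j" for j
      obtain v where v: "v \<in> B x" "g (h v) = (\<lambda>i. \<Sum>j<?r. b j * P i j x)" using comb[of "{..<?r}" b] by auto
      have "(\<Sum>j<?r. b j * P i j x) = c i" for i
      proof (cases "i < ?r")
        case True
        have "A x *\<^sub>v (C *\<^sub>v vec ?r c) = vec ?r c"
          using C A by (subst assoc_mult_mat_vec[symmetric, of _ ?r ?r _ ?r]) auto
        then have "(A x *\<^sub>v (C *\<^sub>v vec ?r c)) $ i = c i" using True by simp
        moreover have "(A x *\<^sub>v (C *\<^sub>v vec ?r c)) $ i = (\<Sum>j<?r. b j * P i j x)"
          using True C(1) by (simp add: A_def scalar_prod_def b_def lessThan_atLeast0 mult.commute)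
        ultimately show ?thesis by simp
      next
        case False
        have "g (h v) i = 0" "c i = 0" using linD(1)[OF l, of v] v(1) c False by (auto simp: coord_space_simps)
        then show ?thesis using fun_cong[OF v(2), of i] by simp
      qed
      then have "g (h v) = c" unfolding v(2) by (rule ext)
      then show ?thesis using v(1) by (intro image_eqI[of _ _ v]) simp_all
    qed
    then have "(\<lambda>v. g (h v)) ` carrier (?B x) = carrier (coord_space {..<?r})"
      using linD(1)[OF l] by (intro equalityI image_subsetI subsetI)
    note surj = this
    have "vdim (coord_space {..<?r} :: ('k, nat \<Rightarrow> 'k) module) = ?r"
      using vdim_coord_space(2)[OF finite_lessThan[of ?r]] by (simp only: card_lessThan)
    then show ?thesis by (subst fdvs_surj(2)[OF fB[OF x] l surj]) (simp only: le_add1)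
  qed
  ultimately show ?thesis by (intro bexI[OF _ p]) simp
qed

section \<open>Principal open sets\<close>

lemma openin_zariski_principal:
  "p \<in> polynomial_functions F \<Longrightarrow> openin (zariski S F) {x \<in> S. p x \<noteq> 0}"
  unfolding zariski_def by (rule topology_generated_by_Basis) blast

lemma topspace_zariski: "topspace (zariski S F) = S"
proof -
  have "openin (zariski S F) S"
    using openin_zariski_principal[OF polynomial_functions.const[of 1], where S = S] by simp
  moreover have "topspace (zariski S F) \<subseteq> S"
    unfolding zariski_def topology_generated_by_topspace by auto
  ultimately show ?thesis using openin_subset by blast
qed

text \<open>Multiplying the functions intersects their principal open sets, so these form a base of
  the topology and not merely a generating family.\<close>

lemma openin_zariski_neighbourhood:
  assumes "openin (zariski S F) U" "x \<in> U"
  shows "\<exists>p\<in>polynomial_functions F. p x \<noteq> 0 \<and> {y \<in> S. p y \<noteq> 0} \<subseteq> U"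
proof -
  have "generate_topology_on {{x \<in> S. f x \<noteq> 0} | f. f \<in> polynomial_functions F} U"
    using assms(1) by (simp add: zariski_def openin_topology_generated_by_iff)
  then show ?thesis using assms(2)
  proof (induction arbitrary: x)
    case (Int a b)
    obtain p where p: "p \<in> polynomial_functions F" "p x \<noteq> 0" "{y \<in> S. p y \<noteq> 0} \<subseteq> a"
      using Int.IH(1)[of x] Int.prems by blast
    obtain q where q: "q \<in> polynomial_functions F" "q x \<noteq> 0" "{y \<in> S. q y \<noteq> 0} \<subseteq> b"
      using Int.IH(2)[of x] Int.prems by blast
    show ?case
      by (rule bexI[OF _ polynomial_functions.mult[OF p(1) q(1)]]) (use p q in auto)
  next
    case (UN K)
    then obtain k where k: "k \<in> K" "x \<in> k" by auto
    show ?case using UN.IH[OF k] k(1) by (meson Union_upper subset_trans)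
  next
    case (Basis s)
    then obtain f where "s = {x \<in> S. f x \<noteq> 0}" "f \<in> polynomial_functions F" by auto
    with Basis.prems show ?case by (intro bexI[of _ f]) simp_all
  qed simp
qed

section \<open>Irreducibility of a vector space in the Zariski topology\<close>

text \<open>Were the field finite, the product of all X - a, increased by 1, would be a nonconstant
  polynomial with the value 1 everywhere.\<close>

lemma infinite_alg_closed: "infinite (UNIV :: 'k::alg_closed_field set)"
proof
  assume fin: "finite (UNIV :: 'k set)"
  let ?p = "(\<Prod>a\<in>UNIV. [:-a, 1:]) + 1 :: 'k poly"
  have d: "degree (\<Prod>a\<in>UNIV. [:-a, 1:] :: 'k poly) = card (UNIV :: 'k set)"
    by (subst degree_prod_eq_sum_degree) simp_all
  have "card (UNIV :: 'k set) > 0" using fin by (simp add: card_gt_0_iff)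
  then have "degree ?p > 0" by (subst degree_add_eq_left) (auto simp: d)
  then obtain x where "poly ?p x = 0" using alg_closed_imp_poly_has_root by blast
  moreover have "(\<Prod>a\<in>UNIV. x - a) = 0" by (rule prod_zero[OF fin]) auto
  ultimately show False by (simp add: poly_prod)
qed

text \<open>Linear forms restrict to polynomials of degree at most one in t, and sums and products
  of polynomials are polynomials. The line passes through x at t = 0 and through y at t = 1.\<close>

lemma polynomial_functions_on_line:
  fixes V :: "('k::field, 'm) module"
  assumes "vectorspace class_ring V" "x \<in> carrier V" "y \<in> carrier V"
    and "p \<in> polynomial_functions (linear_forms V)"
  shows "\<exists>P. \<forall>t. p ((1 - t) \<odot>\<^bsub>V\<^esub> x \<oplus>\<^bsub>V\<^esub> t \<odot>\<^bsub>V\<^esub> y) = poly P t"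
  using assms(4)
proof induction
  case (coord f)
  have "f ((1 - t) \<odot>\<^bsub>V\<^esub> x \<oplus>\<^bsub>V\<^esub> t \<odot>\<^bsub>V\<^esub> y) = poly [:f x, f y - f x:] t" for t
    using coord assms(2,3) closed_opsD[OF vectorspaceD(1)[OF assms(1)]]
    by (simp add: linear_forms_iff algebra_simps)
  then show ?case by blast
next
  case (const c)
  show ?case by (rule exI[of _ "[:c:]"]) simp
next
  case (add f h)
  then obtain P R where "\<forall>t. f ((1 - t) \<odot>\<^bsub>V\<^esub> x \<oplus>\<^bsub>V\<^esub> t \<odot>\<^bsub>V\<^esub> y) = poly P t"
    "\<forall>t. h ((1 - t) \<odot>\<^bsub>V\<^esub> x \<oplus>\<^bsub>V\<^esub> t \<odot>\<^bsub>V\<^esub> y) = poly R t" by blast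
  then show ?case by (intro exI[of _ "P + R"]) simp
next
  case (mult f h)
  then obtain P R where "\<forall>t. f ((1 - t) \<odot>\<^bsub>V\<^esub> x \<oplus>\<^bsub>V\<^esub> t \<odot>\<^bsub>V\<^esub> y) = poly P t"
    "\<forall>t. h ((1 - t) \<odot>\<^bsub>V\<^esub> x \<oplus>\<^bsub>V\<^esub> t \<odot>\<^bsub>V\<^esub> y) = poly R t" by blast
  then show ?case by (intro exI[of _ "P * R"]) simp
qed

text \<open>Irreducibility of affine space: restrict both functions to the line through the two points.\<close>
lemma polynomial_functions_nonzero_meet:
  fixes V :: "('k::alg_closed_field, 'm) module"
  assumes V: "vectorspace class_ring V" and x: "x \<in> carrier V" and y: "y \<in> carrier V"
    and p: "p \<in> polynomial_functions (linear_forms V)" "p x \<noteq> 0"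
    and q: "q \<in> polynomial_functions (linear_forms V)" "q y \<noteq> 0"
  shows "\<exists>z\<in>carrier V. p z \<noteq> 0 \<and> q z \<noteq> 0"
proof -
  let ?z = "\<lambda>t. (1 - t) \<odot>\<^bsub>V\<^esub> x \<oplus>\<^bsub>V\<^esub> t \<odot>\<^bsub>V\<^esub> y"
  obtain P where P: "\<And>t. p (?z t) = poly P t" using polynomial_functions_on_line[OF V x y p(1)] by blast
  obtain R where R: "\<And>t. q (?z t) = poly R t" using polynomial_functions_on_line[OF V x y q(1)] by blast
  have z: "?z 0 = x" "?z 1 = y" using x y vectorspaceD[OF V] by simp_all
  have "P \<noteq> 0" "R \<noteq> 0" using P[of 0] R[of 1] z p(2) q(2) by auto
  then have "finite {t. poly (P * R) t = 0}" by (intro poly_roots_finite) simp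
  then obtain t where "poly (P * R) t \<noteq> 0"
    using ex_new_if_finite[OF infinite_alg_closed] by blast
  then have "p (?z t) \<noteq> 0 \<and> q (?z t) \<noteq> 0" by (simp add: P R)
  then show ?thesis using x y closed_opsD[OF vectorspaceD(1)[OF V]] by blast
qed


section \<open>Left modules and quotients\<close>

lemma module_homI:
  assumes "\<And>x. x \<in> carrier M \<Longrightarrow> f x \<in> carrier N"
    and "\<And>x y. x \<in> carrier M \<Longrightarrow> y \<in> carrier M \<Longrightarrow> f (x \<oplus>\<^bsub>M\<^esub> y) = f x \<oplus>\<^bsub>N\<^esub> f y"
    and "\<And>r x. r \<in> carrier L \<Longrightarrow> x \<in> carrier M \<Longrightarrow> f (r \<odot>\<^bsub>M\<^esub> x) = r \<odot>\<^bsub>N\<^esub> f x"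
  shows "f \<in> module_hom L M N"
  using assms by (auto simp: module_hom_def)

lemma module_homD:
  assumes "f \<in> module_hom L M N"
  shows "x \<in> carrier M \<Longrightarrow> f x \<in> carrier N"
    and "x \<in> carrier M \<Longrightarrow> y \<in> carrier M \<Longrightarrow> f (x \<oplus>\<^bsub>M\<^esub> y) = f x \<oplus>\<^bsub>N\<^esub> f y"
    and "r \<in> carrier L \<Longrightarrow> x \<in> carrier M \<Longrightarrow> f (r \<odot>\<^bsub>M\<^esub> x) = r \<odot>\<^bsub>N\<^esub> f x"
  using assms by (auto simp: module_hom_def)

text \<open>The scalars are those of \<open>Lambda\<close>, whose multiplication need not commute,
  hence the module axioms are spelled out over a general ring.\<close>

definition left_module :: "'r ring \<Rightarrow> ('r, 'm) module \<Rightarrow> bool" where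
  "left_module L N \<longleftrightarrow> ring L \<and> abelian_group N \<and>
    (\<forall>r\<in>carrier L. \<forall>x\<in>carrier N. r \<odot>\<^bsub>N\<^esub> x \<in> carrier N) \<and>
    (\<forall>r\<in>carrier L. \<forall>s\<in>carrier L. \<forall>x\<in>carrier N.
      (r \<oplus>\<^bsub>L\<^esub> s) \<odot>\<^bsub>N\<^esub> x = r \<odot>\<^bsub>N\<^esub> x \<oplus>\<^bsub>N\<^esub> s \<odot>\<^bsub>N\<^esub> x) \<and>
    (\<forall>r\<in>carrier L. \<forall>x\<in>carrier N. \<forall>y\<in>carrier N.
      r \<odot>\<^bsub>N\<^esub> (x \<oplus>\<^bsub>N\<^esub> y) = r \<odot>\<^bsub>N\<^esub> x \<oplus>\<^bsub>N\<^esub> r \<odot>\<^bsub>N\<^esub> y) \<and>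
    (\<forall>r\<in>carrier L. \<forall>s\<in>carrier L. \<forall>x\<in>carrier N.
      (r \<otimes>\<^bsub>L\<^esub> s) \<odot>\<^bsub>N\<^esub> x = r \<odot>\<^bsub>N\<^esub> (s \<odot>\<^bsub>N\<^esub> x)) \<and>
    (\<forall>x\<in>carrier N. \<one>\<^bsub>L\<^esub> \<odot>\<^bsub>N\<^esub> x = x)"

lemma left_moduleD:
  assumes "left_module L N"
  shows "ring L" and "abelian_group N"
    and "r \<in> carrier L \<Longrightarrow> x \<in> carrier N \<Longrightarrow> r \<odot>\<^bsub>N\<^esub> x \<in> carrier N"
    and "r \<in> carrier L \<Longrightarrow> s \<in> carrier L \<Longrightarrow> x \<in> carrier N \<Longrightarrow>
      (r \<oplus>\<^bsub>L\<^esub> s) \<odot>\<^bsub>N\<^esub> x = r \<odot>\<^bsub>N\<^esub> x \<oplus>\<^bsub>N\<^esub> s \<odot>\<^bsub>N\<^esub> x"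
    and "r \<in> carrier L \<Longrightarrow> x \<in> carrier N \<Longrightarrow> y \<in> carrier N \<Longrightarrow>
      r \<odot>\<^bsub>N\<^esub> (x \<oplus>\<^bsub>N\<^esub> y) = r \<odot>\<^bsub>N\<^esub> x \<oplus>\<^bsub>N\<^esub> r \<odot>\<^bsub>N\<^esub> y"
    and "r \<in> carrier L \<Longrightarrow> s \<in> carrier L \<Longrightarrow> x \<in> carrier N \<Longrightarrow>
      (r \<otimes>\<^bsub>L\<^esub> s) \<odot>\<^bsub>N\<^esub> x = r \<odot>\<^bsub>N\<^esub> (s \<odot>\<^bsub>N\<^esub> x)"
    and "x \<in> carrier N \<Longrightarrow> \<one>\<^bsub>L\<^esub> \<odot>\<^bsub>N\<^esub> x = x"
    and "x \<in> carrier N \<Longrightarrow> y \<in> carrier N \<Longrightarrow> x \<oplus>\<^bsub>N\<^esub> y \<in> carrier N"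
    and "\<zero>\<^bsub>N\<^esub> \<in> carrier N"
proof -
  interpret abelian_group N using assms by (simp add: left_module_def)
  show "x \<in> carrier N \<Longrightarrow> y \<in> carrier N \<Longrightarrow> x \<oplus>\<^bsub>N\<^esub> y \<in> carrier N" "\<zero>\<^bsub>N\<^esub> \<in> carrier N" by simp_all
qed (use assms in \<open>auto simp: left_module_def\<close>)

lemma abelian_group_zero_unique:
  assumes "abelian_group N" "x \<in> carrier N" "x \<oplus>\<^bsub>N\<^esub> x = x"
  shows "x = \<zero>\<^bsub>N\<^esub>"
proof -
  interpret abelian_group N by fact
  from assms show ?thesis by (metis add.r_cancel_one)
qed

lemma module_hom_zero:
  assumes "f \<in> module_hom L M N" "left_module L M" "abelian_group N"
  shows "f \<zero>\<^bsub>M\<^esub> = \<zero>\<^bsub>N\<^esub>"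
proof (rule abelian_group_zero_unique[OF assms(3)])
  interpret M: abelian_group M using assms(2) by (simp add: left_module_def)
  show "f \<zero>\<^bsub>M\<^esub> \<in> carrier N" using module_homD(1)[OF assms(1)] by simp
  show "f \<zero>\<^bsub>M\<^esub> \<oplus>\<^bsub>N\<^esub> f \<zero>\<^bsub>M\<^esub> = f \<zero>\<^bsub>M\<^esub>"
    using module_homD(2)[OF assms(1), of "\<zero>\<^bsub>M\<^esub>" "\<zero>\<^bsub>M\<^esub>"] by simp
qed

lemma left_module_smult_zero:
  assumes "left_module L N"
  shows "r \<in> carrier L \<Longrightarrow> r \<odot>\<^bsub>N\<^esub> \<zero>\<^bsub>N\<^esub> = \<zero>\<^bsub>N\<^esub>"
    and "x \<in> carrier N \<Longrightarrow> \<zero>\<^bsub>L\<^esub> \<odot>\<^bsub>N\<^esub> x = \<zero>\<^bsub>N\<^esub>"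
proof -
  note D = left_moduleD[OF assms]
  interpret N: abelian_group N by (fact D(2))
  interpret L: ring L by (fact D(1))
  show "r \<odot>\<^bsub>N\<^esub> \<zero>\<^bsub>N\<^esub> = \<zero>\<^bsub>N\<^esub>" if "r \<in> carrier L"
    using D(5)[OF that D(9) D(9)] D(3)[OF that D(9)] by (intro abelian_group_zero_unique[OF D(2)]) simp_all
  show "\<zero>\<^bsub>L\<^esub> \<odot>\<^bsub>N\<^esub> x = \<zero>\<^bsub>N\<^esub>" if "x \<in> carrier N"
    using D(4)[of "\<zero>\<^bsub>L\<^esub>" "\<zero>\<^bsub>L\<^esub>" x] D(3)[of "\<zero>\<^bsub>L\<^esub>" x] that
    by (intro abelian_group_zero_unique[OF D(2)]) simp_all
qed

text \<open>All axioms are carried along \<open>f\<close>. Cokernels obtain their module structure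
  in this way, and so do the modules of representations, as quotients of a projective
  module.\<close>

lemma left_module_surj:
  assumes M: "left_module L M" and f: "f \<in> module_hom L M N" and surj: "f ` carrier M = carrier N"
    and zero: "f \<zero>\<^bsub>M\<^esub> = \<zero>\<^bsub>N\<^esub>"
  shows "left_module L N"
proof -
  note D = left_moduleD[OF M] and f' = module_homD[OF f]
  interpret M: abelian_group M by (fact D(2))
  interpret L: ring L by (fact D(1))
  have add: "f x \<oplus>\<^bsub>N\<^esub> f y = f (x \<oplus>\<^bsub>M\<^esub> y)" if "x \<in> carrier M" "y \<in> carrier M" for x y
    using that f' by simp
  have sm: "r \<odot>\<^bsub>N\<^esub> f x = f (r \<odot>\<^bsub>M\<^esub> x)" if "r \<in> carrier L" "x \<in> carrier M" for r x
    using that f' by simp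
  have "abelian_group N"
  proof (rule abelian_groupI; unfold surj[symmetric])
    show "\<exists>y\<in>f ` carrier M. y \<oplus>\<^bsub>N\<^esub> x = \<zero>\<^bsub>N\<^esub>" if "x \<in> f ` carrier M" for x
      using that by (auto simp: add zero[symmetric] M.l_neg intro!: bexI[of _ "\<ominus>\<^bsub>M\<^esub> _"])
  qed (auto simp: add zero[symmetric] M.a_ac)
  then show ?thesis unfolding left_module_def surj[symmetric]
    using D by (auto simp: add sm)
qed

text \<open>A scalar multiple of a coset is defined as a union over its members; all sets in that
  union coincide once multiplication by \<open>c\<close> is additive and maps N into itself. The
  last claim treats a single scalar, so that it serves both the cokernel, with scalars from the
  ring, and the space of homotopy classes, with scalars from the field.\<close>

lemma quot_module_props:
  assumes M: "abelian_group M" and N: "N \<subseteq> carrier M" "\<zero>\<^bsub>M\<^esub> \<in> N"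
    "\<forall>x\<in>N. \<forall>y\<in>N. x \<oplus>\<^bsub>M\<^esub> y \<in> N" "\<forall>x\<in>N. \<ominus>\<^bsub>M\<^esub> x \<in> N"
  shows "carrier (quot_module M N) = (\<lambda>x. N +>\<^bsub>M\<^esub> x) ` carrier M"
    and "x \<in> carrier M \<Longrightarrow> y \<in> carrier M \<Longrightarrow>
      (N +>\<^bsub>M\<^esub> x) \<oplus>\<^bsub>quot_module M N\<^esub> (N +>\<^bsub>M\<^esub> y) = N +>\<^bsub>M\<^esub> (x \<oplus>\<^bsub>M\<^esub> y)"
    and "x \<in> carrier M \<Longrightarrow> N +>\<^bsub>M\<^esub> x = \<zero>\<^bsub>quot_module M N\<^esub> \<longleftrightarrow> x \<in> N"
    and "\<forall>x\<in>carrier M. c \<odot>\<^bsub>M\<^esub> x \<in> carrier M \<Longrightarrow> \<forall>x\<in>N. c \<odot>\<^bsub>M\<^esub> x \<in> N \<Longrightarrow>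
      \<forall>x\<in>carrier M. \<forall>y\<in>carrier M.
        c \<odot>\<^bsub>M\<^esub> (x \<oplus>\<^bsub>M\<^esub> y) = c \<odot>\<^bsub>M\<^esub> x \<oplus>\<^bsub>M\<^esub> c \<odot>\<^bsub>M\<^esub> y \<Longrightarrow>
      x \<in> carrier M \<Longrightarrow> c \<odot>\<^bsub>quot_module M N\<^esub> (N +>\<^bsub>M\<^esub> x) = N +>\<^bsub>M\<^esub> (c \<odot>\<^bsub>M\<^esub> x)"
proof -
  interpret M: abelian_group M by fact
  have "subgroup N (add_monoid M)"
    by (rule group.subgroupI[OF M.a_group]) (use N in \<open>auto simp: a_inv_def\<close>)
  then interpret additive_subgroup N M by (rule additive_subgroupI)
  interpret abelian_subgroup N M
    by (rule abelian_subgroupI3) (rule additive_subgroup_axioms, rule M)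
  have absorb: "N +>\<^bsub>M\<^esub> (n \<oplus>\<^bsub>M\<^esub> x) = N +>\<^bsub>M\<^esub> x" if "n \<in> N" "x \<in> carrier M" for n x
  proof -
    have "n \<oplus>\<^bsub>M\<^esub> x \<in> N +>\<^bsub>M\<^esub> x" using that by (auto simp: a_r_coset_def')
    then show ?thesis by (rule M.a_repr_independence[symmetric]) (rule that(2), rule a_subgroup)
  qed
  show "carrier (quot_module M N) = (\<lambda>x. N +>\<^bsub>M\<^esub> x) ` carrier M"
    by (auto simp: quot_module_def A_RCOSETS_def')
  show "x \<in> carrier M \<Longrightarrow> y \<in> carrier M \<Longrightarrow>
      (N +>\<^bsub>M\<^esub> x) \<oplus>\<^bsub>quot_module M N\<^esub> (N +>\<^bsub>M\<^esub> y) = N +>\<^bsub>M\<^esub> (x \<oplus>\<^bsub>M\<^esub> y)"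
    by (simp add: quot_module_def a_rcos_sum)
  show "N +>\<^bsub>M\<^esub> x = \<zero>\<^bsub>quot_module M N\<^esub> \<longleftrightarrow> x \<in> N" if x: "x \<in> carrier M"
  proof
    assume "N +>\<^bsub>M\<^esub> x = \<zero>\<^bsub>quot_module M N\<^esub>"
    then show "x \<in> N" using a_rcos_self[OF x] by (simp add: quot_module_def)
  next
    assume "x \<in> N"
    then show "N +>\<^bsub>M\<^esub> x = \<zero>\<^bsub>quot_module M N\<^esub>"
      using absorb[of x "\<zero>\<^bsub>M\<^esub>"] x N(1) by (simp add: quot_module_def)
  qed
  show "c \<odot>\<^bsub>quot_module M N\<^esub> (N +>\<^bsub>M\<^esub> x) = N +>\<^bsub>M\<^esub> (c \<odot>\<^bsub>M\<^esub> x)"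
    if c: "\<forall>x\<in>carrier M. c \<odot>\<^bsub>M\<^esub> x \<in> carrier M" "\<forall>x\<in>N. c \<odot>\<^bsub>M\<^esub> x \<in> N"
      "\<forall>x\<in>carrier M. \<forall>y\<in>carrier M.
        c \<odot>\<^bsub>M\<^esub> (x \<oplus>\<^bsub>M\<^esub> y) = c \<odot>\<^bsub>M\<^esub> x \<oplus>\<^bsub>M\<^esub> c \<odot>\<^bsub>M\<^esub> y"
      and x: "x \<in> carrier M" for c x
  proof -
    have "N +>\<^bsub>M\<^esub> (c \<odot>\<^bsub>M\<^esub> y) = N +>\<^bsub>M\<^esub> (c \<odot>\<^bsub>M\<^esub> x)" if "y \<in> N +>\<^bsub>M\<^esub> x" for y
    proof -
      from that obtain n where n: "n \<in> N" "y = n \<oplus>\<^bsub>M\<^esub> x" by (auto simp: a_r_coset_def')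
      have "c \<odot>\<^bsub>M\<^esub> y = c \<odot>\<^bsub>M\<^esub> n \<oplus>\<^bsub>M\<^esub> c \<odot>\<^bsub>M\<^esub> x"
        unfolding n(2) by (rule c(3)[rule_format]) (use n(1) N(1) x in auto)
      then show ?thesis using absorb[OF c(2)[rule_format, OF n(1)] c(1)[rule_format, OF x]] by simp
    qed
    then have "(\<Union>y\<in>N +>\<^bsub>M\<^esub> x. N +>\<^bsub>M\<^esub> (c \<odot>\<^bsub>M\<^esub> y)) = (\<Union>y\<in>N +>\<^bsub>M\<^esub> x. N +>\<^bsub>M\<^esub> (c \<odot>\<^bsub>M\<^esub> x))"
      by (rule SUP_cong[OF refl])
    also have "\<dots> = N +>\<^bsub>M\<^esub> (c \<odot>\<^bsub>M\<^esub> x)"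
      by (rule cSUP_const) (use a_rcos_self[OF x] in blast)
    finally show ?thesis by (simp add: quot_module_def)
  qed
qed


section \<open>The algebra and its projective modules\<close>

context bound_quiver
begin

abbreviation \<Lambda> where "\<Lambda> \<equiv> Lambda Q I"
abbreviation pathring where "pathring \<equiv> (path_algebra Q :: (('v, 'a) path \<Rightarrow> 'k) ring)"
abbreviation cls where "cls x \<equiv> I +>\<^bsub>pathring\<^esub> x"
abbreviation idem where "idem v \<equiv> vertex_idempotent Q I v"
abbreviation sc where "sc c \<equiv> scalar Q I c"

sublocale P: ring pathring by (rule ring_path_algebra)
sublocale I: ideal I pathring by (rule ideal)

lemma cls_hom:
  assumes "x \<in> carrier pathring" "y \<in> carrier pathring"
  shows "cls x \<in> carrier \<Lambda>"
    and "cls x \<oplus>\<^bsub>\<Lambda>\<^esub> cls y = cls (x \<oplus>\<^bsub>pathring\<^esub> y)"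
    and "cls x \<otimes>\<^bsub>\<Lambda>\<^esub> cls y = cls (x \<otimes>\<^bsub>pathring\<^esub> y)"
  using assms ring_hom_closed[OF I.rcos_ring_hom] ring_hom_add[OF I.rcos_ring_hom]
    ring_hom_mult[OF I.rcos_ring_hom] by (simp_all add: Lambda_def)

lemma cls_one: "cls \<one>\<^bsub>pathring\<^esub> = \<one>\<^bsub>\<Lambda>\<^esub>"
  using ring_hom_one[OF I.rcos_ring_hom] by (simp add: Lambda_def)

lemma carrier_Lambda: "carrier \<Lambda> = cls ` carrier pathring"
  by (auto simp: Lambda_def FactRing_def A_RCOSETS_def')

lemma ring_Lambda: "ring \<Lambda>"
  by (simp add: Lambda_def I.quotient_is_ring)

sublocale L: ring \<Lambda> by (rule ring_Lambda)

lemma path_in_carrier: "w \<in> paths Q \<Longrightarrow> (\<lambda>w'. if w' = w then c else 0) \<in> carrier pathring"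
  by (auto simp: path_algebra_carrier)

lemma trivial_path: "v \<in> verts Q \<Longrightarrow> (v, []) \<in> paths Q"
  by (auto simp: paths_def awalk_Nil_iff)

lemma scalar_one_apply: "c * \<one>\<^bsub>pathring\<^esub> (u, p) = (if u \<in> verts Q \<and> p = [] then c else 0)"
  by (simp add: path_algebra_def)

lemma smult_in_carrier: "x \<in> carrier pathring \<Longrightarrow> (\<lambda>w. c * x w) \<in> carrier pathring"
  by (auto simp: path_algebra_carrier elim: finite_subset[rotated])

lemma scalar_one_in_carrier: "(\<lambda>w. c * \<one>\<^bsub>pathring\<^esub> w) \<in> carrier pathring"
  by (rule smult_in_carrier) simp

lemma smult_mult_path:
  "(\<lambda>w. c * x w) \<otimes>\<^bsub>pathring\<^esub> y = (\<lambda>w. c * (x \<otimes>\<^bsub>pathring\<^esub> y) w)"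
  "x \<otimes>\<^bsub>pathring\<^esub> (\<lambda>w. c * y w) = (\<lambda>w. c * (x \<otimes>\<^bsub>pathring\<^esub> y) w)"
  by (auto simp: path_algebra_mult_apply sum_distrib_left mult_ac intro!: ext sum.cong)

lemma scalar_one_mult:
  assumes "x \<in> carrier pathring"
  shows "(\<lambda>w. c * \<one>\<^bsub>pathring\<^esub> w) \<otimes>\<^bsub>pathring\<^esub> x = (\<lambda>w. c * x w)"
    and "x \<otimes>\<^bsub>pathring\<^esub> (\<lambda>w. c * \<one>\<^bsub>pathring\<^esub> w) = (\<lambda>w. c * x w)"
  using assms by (simp_all add: smult_mult_path)

lemma scalar_in_carrier: "sc c \<in> carrier \<Lambda>"
  unfolding scalar_def by (rule cls_hom(1)[OF scalar_one_in_carrier scalar_one_in_carrier])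

lemma scalar_cls: "x \<in> carrier pathring \<Longrightarrow> sc c \<otimes>\<^bsub>\<Lambda>\<^esub> cls x = cls (\<lambda>w. c * x w)"
  unfolding scalar_def by (subst cls_hom(3)) (simp_all add: scalar_one_in_carrier scalar_one_mult)

lemma scalar_central: "r \<in> carrier \<Lambda> \<Longrightarrow> sc c \<otimes>\<^bsub>\<Lambda>\<^esub> r = r \<otimes>\<^bsub>\<Lambda>\<^esub> sc c"
  unfolding carrier_Lambda scalar_def
  by (elim imageE, hypsubst, subst (1 2) cls_hom(3)) (simp_all add: scalar_one_in_carrier scalar_one_mult)

lemma scalar_mult: "sc (c * d) = sc c \<otimes>\<^bsub>\<Lambda>\<^esub> sc d"
  unfolding scalar_def[of Q I d]
  by (subst scalar_cls[OF scalar_one_in_carrier]) (simp add: scalar_def mult.assoc)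

lemma scalar_add: "sc (c + d) = sc c \<oplus>\<^bsub>\<Lambda>\<^esub> sc d"
  unfolding scalar_def cls_hom(2)[OF scalar_one_in_carrier scalar_one_in_carrier]
  by (simp add: path_algebra_def distrib_right)

lemma scalar_one: "sc 1 = \<one>\<^bsub>\<Lambda>\<^esub>"
  unfolding scalar_def by (simp add: cls_one)

lemma idem_in_carrier: "v \<in> verts Q \<Longrightarrow> idem v \<in> carrier \<Lambda>"
  unfolding vertex_idempotent_def by (rule cls_hom(1)[OF _ P.one_closed]) (simp add: path_in_carrier trivial_path)

lemma idem_idem: 
  assumes "v \<in> verts Q"
  shows "idem v \<otimes>\<^bsub>\<Lambda>\<^esub> idem v = idem v"
proof -
  let ?e = "\<lambda>w. if w = (v, []) then 1 else 0 :: 'k"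
  have "(?e \<otimes>\<^bsub>pathring\<^esub> ?e) (u, p) = ?e (u, p)" for u p
  proof -
    have "(?e \<otimes>\<^bsub>pathring\<^esub> ?e) (u, p) = (\<Sum>i\<le>length p. if i = 0 then ?e (u, p) else 0)"
      unfolding path_algebra_mult_apply by (intro sum.cong) auto
    then show ?thesis by simp
  qed
  then have "?e \<otimes>\<^bsub>pathring\<^esub> ?e = ?e" by auto
  then show ?thesis unfolding vertex_idempotent_def
    by (subst cls_hom(3)) (simp_all add: path_in_carrier trivial_path assms)
qed

section \<open>Vector space structures on modules and Hom spaces\<close>

lemma vectorspace_underlying:
  assumes N: "left_module \<Lambda> N"
  shows "vectorspace class_ring (underlying_space Q I N)"
proof -
  note D = left_moduleD[OF N]
  interpret abelian_group N by (fact D(2))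
  show ?thesis
  proof (rule vectorspaceI; (unfold closed_ops_def)?; simp add: underlying_space_def)
    show "sc (- 1) \<odot>\<^bsub>N\<^esub> x \<oplus>\<^bsub>N\<^esub> x = \<zero>\<^bsub>N\<^esub>" if "x \<in> carrier N" for x
    proof -
      have z: "sc 0 \<odot>\<^bsub>N\<^esub> x = \<zero>\<^bsub>N\<^esub>"
        by (rule abelian_group_zero_unique[OF D(2)])
           (use that D(3,4) scalar_in_carrier scalar_add[of 0 0] in \<open>simp_all add: D(4)[symmetric]\<close>)
      have "sc (- 1) \<odot>\<^bsub>N\<^esub> x \<oplus>\<^bsub>N\<^esub> sc 1 \<odot>\<^bsub>N\<^esub> x = sc (- 1 + 1) \<odot>\<^bsub>N\<^esub> x"
        unfolding scalar_add by (rule D(4)[symmetric]) (simp_all add: scalar_in_carrier that)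
      then show ?thesis using z D(7)[OF that] by (simp add: scalar_one)
    qed
  qed (auto simp: D scalar_in_carrier scalar_add scalar_mult scalar_one a_assoc intro: a_comm)
qed

lemma vectorspace_power_space:
  fixes V :: "('k, 'm) module"
  assumes "vectorspace class_ring V"
  shows "vectorspace class_ring (power_space S V)"
proof -
  note D = vectorspaceD[OF assms] and C = closed_opsD[OF vectorspaceD(1)[OF assms]]
  show ?thesis
    by (rule vectorspaceI; (unfold closed_ops_def)?)
       (auto simp: power_space_def PiE_iff C intro!: restrict_ext extensionalityI[where A = S]
         intro: D C, auto simp: C D(2,4-) intro: D(3))
qed

lemma hom_space_simps:
  "f \<in> carrier (hom_space Q I M N) \<longleftrightarrow> f \<in> module_hom \<Lambda> M N \<and> f \<in> extensional (carrier M)"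
  "\<zero>\<^bsub>hom_space Q I M N\<^esub> = (\<lambda>x\<in>carrier M. \<zero>\<^bsub>N\<^esub>)"
  "f \<oplus>\<^bsub>hom_space Q I M N\<^esub> h = (\<lambda>x\<in>carrier M. f x \<oplus>\<^bsub>N\<^esub> h x)"
  "c \<odot>\<^bsub>hom_space Q I M N\<^esub> f = (\<lambda>x\<in>carrier M. sc c \<odot>\<^bsub>N\<^esub> f x)"
  by (auto simp: hom_space_def)

text \<open>A field multiple of a homomorphism is again a homomorphism because the classes of
  scalars are central in the algebra.\<close>

lemma closed_ops_hom_space:
  assumes M: "left_module \<Lambda> M" and N: "left_module \<Lambda> N"
  shows "closed_ops (hom_space Q I M N)"
proof -
  note DM = left_moduleD[OF M] and D = left_moduleD[OF N]
  interpret abelian_group N by (fact D(2))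
  have comm: "r \<odot>\<^bsub>N\<^esub> (sc c \<odot>\<^bsub>N\<^esub> x) = sc c \<odot>\<^bsub>N\<^esub> (r \<odot>\<^bsub>N\<^esub> x)"
    if "r \<in> carrier \<Lambda>" "x \<in> carrier N" for r c x
    using that D(6) scalar_in_carrier scalar_central by metis
  have "(\<lambda>x\<in>carrier M. \<zero>\<^bsub>N\<^esub>) \<in> module_hom \<Lambda> M N"
    by (rule module_homI) (simp_all add: DM left_module_smult_zero[OF N])
  moreover have "(\<lambda>x\<in>carrier M. f x \<oplus>\<^bsub>N\<^esub> h x) \<in> module_hom \<Lambda> M N"
    if "f \<in> module_hom \<Lambda> M N" "h \<in> module_hom \<Lambda> M N" for f h
    using module_homD[OF that(1)] module_homD[OF that(2)]
    by (intro module_homI) (simp_all add: DM D a_ac)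
  moreover have "(\<lambda>x\<in>carrier M. sc c \<odot>\<^bsub>N\<^esub> f x) \<in> module_hom \<Lambda> M N"
    if "f \<in> module_hom \<Lambda> M N" for f c
    using module_homD[OF that(1)]
    by (intro module_homI) (simp_all add: DM D comm scalar_in_carrier)
  ultimately show ?thesis by (auto simp: closed_ops_def hom_space_simps)
qed

text \<open>The operations on homomorphisms are pointwise, so the vector space axioms can be read
  off in the space of all functions between the carriers.\<close>

lemma lin_hom_space_power:
  "lin (hom_space Q I M N) (power_space (carrier M) (underlying_space Q I N)) id"
  by (auto simp: lin_def hom_space_simps power_space_def underlying_space_def PiE_iff module_hom_def extensional_def)

lemma vectorspace_hom_space:
  assumes M: "left_module \<Lambda> M" and N: "left_module \<Lambda> N"
  shows "vectorspace class_ring (hom_space Q I M N)"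
  by (rule vectorspace_inj[OF vectorspace_power_space[OF vectorspace_underlying[OF N]]
        closed_ops_hom_space[OF M N] lin_hom_space_power]) simp

section \<open>Homomorphisms out of projective modules\<close>

definition gens :: "('v \<Rightarrow> nat) \<Rightarrow> ('v \<times> nat) set" where
  "gens m = (SIGMA v:verts Q. {..<m v})"

lemma finite_gens [simp]: "finite (gens m)"
  by (simp add: gens_def)

lemma gens_verts: "s \<in> gens m \<Longrightarrow> fst s \<in> verts Q"
  by (auto simp: gens_def)

text \<open>As \<open>idem v\<close> squares to itself, lying in the left ideal it generates is an
  equation. Elements of \<open>proj\<close> are thereby described by one equation for each
  index.\<close>

lemma left_ideal_iff:
  assumes "v \<in> verts Q"
  shows "r \<in> (\<lambda>x. x \<otimes>\<^bsub>\<Lambda>\<^esub> idem v) ` carrier \<Lambda> \<longleftrightarrow> r \<in> carrier \<Lambda> \<and> r \<otimes>\<^bsub>\<Lambda>\<^esub> idem v = r"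
proof
  assume "r \<in> (\<lambda>x. x \<otimes>\<^bsub>\<Lambda>\<^esub> idem v) ` carrier \<Lambda>"
  then show "r \<in> carrier \<Lambda> \<and> r \<otimes>\<^bsub>\<Lambda>\<^esub> idem v = r"
    using assms by (auto simp: idem_in_carrier L.m_assoc idem_idem)
next
  assume "r \<in> carrier \<Lambda> \<and> r \<otimes>\<^bsub>\<Lambda>\<^esub> idem v = r"
  then show "r \<in> (\<lambda>x. x \<otimes>\<^bsub>\<Lambda>\<^esub> idem v) ` carrier \<Lambda>" by (metis imageI)
qed

lemma proj_simps:
  "x \<in> carrier (proj Q I m) \<longleftrightarrow> x \<in> extensional (gens m) \<and>
    (\<forall>s\<in>gens m. x s \<in> carrier \<Lambda> \<and> x s \<otimes>\<^bsub>\<Lambda>\<^esub> idem (fst s) = x s)"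
  "\<zero>\<^bsub>proj Q I m\<^esub> = (\<lambda>s\<in>gens m. \<zero>\<^bsub>\<Lambda>\<^esub>)"
  "x \<oplus>\<^bsub>proj Q I m\<^esub> y = (\<lambda>s\<in>gens m. x s \<oplus>\<^bsub>\<Lambda>\<^esub> y s)"
  "r \<odot>\<^bsub>proj Q I m\<^esub> x = (\<lambda>s\<in>gens m. r \<otimes>\<^bsub>\<Lambda>\<^esub> x s)"
proof -
  show "x \<in> carrier (proj Q I m) \<longleftrightarrow> x \<in> extensional (gens m) \<and>
    (\<forall>s\<in>gens m. x s \<in> carrier \<Lambda> \<and> x s \<otimes>\<^bsub>\<Lambda>\<^esub> idem (fst s) = x s)"
    unfolding proj_def Let_def gens_def[symmetric]
    using left_ideal_iff by (auto simp: PiE_iff gens_verts split_beta)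
qed (simp_all add: proj_def Let_def gens_def)

lemma left_module_proj: "left_module \<Lambda> (proj Q I m)"
proof -
  have "abelian_group (proj Q I m)"
  proof (rule abelian_groupI)
    show "\<exists>y\<in>carrier (proj Q I m). y \<oplus>\<^bsub>proj Q I m\<^esub> x = \<zero>\<^bsub>proj Q I m\<^esub>"
      if x: "x \<in> carrier (proj Q I m)" for x
    proof (intro bexI)
      show "(\<lambda>s\<in>gens m. \<ominus>\<^bsub>\<Lambda>\<^esub> x s) \<oplus>\<^bsub>proj Q I m\<^esub> x = \<zero>\<^bsub>proj Q I m\<^esub>"
        using x by (auto simp: proj_simps L.l_neg intro!: restrict_ext)
      show "(\<lambda>s\<in>gens m. \<ominus>\<^bsub>\<Lambda>\<^esub> x s) \<in> carrier (proj Q I m)"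
        using x by (auto simp: proj_simps L.l_minus gens_verts idem_in_carrier)
    qed
  qed (auto simp: proj_simps L.a_ac L.l_distr gens_verts idem_in_carrier
      intro!: restrict_ext extensionalityI[where A = "gens m"])
  then show ?thesis
    unfolding left_module_def using ring_Lambda
    by (auto simp: proj_simps L.l_distr L.r_distr L.m_assoc gens_verts idem_in_carrier
      intro!: restrict_ext extensionalityI[where A = "gens m"])
qed

definition gen :: "('v \<Rightarrow> nat) \<Rightarrow> 'v \<times> nat \<Rightarrow> ('v, 'a, 'k) proj_element" where
  "gen m s = (\<lambda>t\<in>gens m. if t = s then idem (fst s) else \<zero>\<^bsub>\<Lambda>\<^esub>)"

lemma gen_in_carrier: "s \<in> gens m \<Longrightarrow> gen m s \<in> carrier (proj Q I m)"
  by (auto simp: gen_def proj_simps gens_verts idem_in_carrier idem_idem)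

lemma idem_gen: "s \<in> gens m \<Longrightarrow> idem (fst s) \<odot>\<^bsub>proj Q I m\<^esub> gen m s = gen m s"
  unfolding gen_def proj_simps
  by (rule restrict_ext) (simp add: gens_verts idem_in_carrier idem_idem)

text \<open>The universal map out of \<open>proj\<close>. It sends the generator at \<open>s\<close>
  to \<open>idem (fst s)\<close> times \<open>n s\<close>, which is \<open>n s\<close> itself only
  if that idempotent fixes \<open>n s\<close>.\<close>

definition free_map :: "('v \<Rightarrow> nat) \<Rightarrow> (('v, 'a, 'k) residue, 'm) module \<Rightarrow>
    ('v \<times> nat \<Rightarrow> 'm) \<Rightarrow> ('v, 'a, 'k) proj_element \<Rightarrow> 'm" where
  "free_map m N n = (\<lambda>x\<in>carrier (proj Q I m). finsum N (\<lambda>s. x s \<odot>\<^bsub>N\<^esub> n s) (gens m))"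

lemma free_map_hom:
  assumes N: "left_module \<Lambda> N" and n: "\<And>s. s \<in> gens m \<Longrightarrow> n s \<in> carrier N"
  shows "free_map m N n \<in> carrier (hom_space Q I (proj Q I m) N)"
proof -
  note D = left_moduleD[OF N] and P = left_moduleD[OF left_module_proj]
  interpret N: abelian_group N by (fact D(2))
  have cl: "(\<lambda>s. x s \<odot>\<^bsub>N\<^esub> n s) \<in> gens m \<rightarrow> carrier N" if "x \<in> carrier (proj Q I m)" for x
    using that n D(3) by (auto simp: proj_simps)
  have "free_map m N n (r \<odot>\<^bsub>proj Q I m\<^esub> x) = r \<odot>\<^bsub>N\<^esub> free_map m N n x"
    if r: "r \<in> carrier \<Lambda>" and x: "x \<in> carrier (proj Q I m)" for r x
  proof -
    have "r \<odot>\<^bsub>N\<^esub> finsum N (\<lambda>s. x s \<odot>\<^bsub>N\<^esub> n s) S = finsum N (\<lambda>s. r \<odot>\<^bsub>N\<^esub> (x s \<odot>\<^bsub>N\<^esub> n s)) S"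
      if "finite S" "S \<subseteq> gens m" for S using that
    proof (induction S rule: finite_induct)
      case empty
      then show ?case using left_module_smult_zero[OF N] r by simp
    next
      case (insert s S)
      have cS: "(\<lambda>s. x s \<odot>\<^bsub>N\<^esub> n s) \<in> S \<rightarrow> carrier N" using cl[OF x] insert by auto
      then have cS': "(\<lambda>s. r \<odot>\<^bsub>N\<^esub> (x s \<odot>\<^bsub>N\<^esub> n s)) \<in> S \<rightarrow> carrier N" using D(3) r by auto
      have cs: "x s \<odot>\<^bsub>N\<^esub> n s \<in> carrier N" using cl[OF x] insert by auto
      show ?case using insert
        by (simp add: N.finsum_insert[OF _ _ cS cs] N.finsum_insert[OF _ _ cS' D(3)[OF r cs]]
            D(5)[OF r cs N.finsum_closed[OF cS]])
    qed
    from this[of "gens m"]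
    have "r \<odot>\<^bsub>N\<^esub> finsum N (\<lambda>s. x s \<odot>\<^bsub>N\<^esub> n s) (gens m) =
      finsum N (\<lambda>s. r \<odot>\<^bsub>N\<^esub> (x s \<odot>\<^bsub>N\<^esub> n s)) (gens m)" by simp
    also have "\<dots> = finsum N (\<lambda>s. (r \<odot>\<^bsub>proj Q I m\<^esub> x) s \<odot>\<^bsub>N\<^esub> n s) (gens m)"
      by (rule N.finsum_cong')
         (use cl[OF P(3)[OF r x]] x r n in \<open>auto simp: proj_simps D(6)\<close>)
    finally show ?thesis using x P(3)[OF r x] by (simp add: free_map_def)
  qed
  moreover have "free_map m N n (x \<oplus>\<^bsub>proj Q I m\<^esub> y) = free_map m N n x \<oplus>\<^bsub>N\<^esub> free_map m N n y"
    if x: "x \<in> carrier (proj Q I m)" and y: "y \<in> carrier (proj Q I m)" for x y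
  proof -
    have "finsum N (\<lambda>s. (x \<oplus>\<^bsub>proj Q I m\<^esub> y) s \<odot>\<^bsub>N\<^esub> n s) (gens m) =
        finsum N (\<lambda>s. x s \<odot>\<^bsub>N\<^esub> n s \<oplus>\<^bsub>N\<^esub> y s \<odot>\<^bsub>N\<^esub> n s) (gens m)"
      by (rule N.finsum_cong')
         (use cl[OF x] cl[OF y] x y n in \<open>auto simp: proj_simps D(4)\<close>)
    also have "\<dots> = finsum N (\<lambda>s. x s \<odot>\<^bsub>N\<^esub> n s) (gens m) \<oplus>\<^bsub>N\<^esub> finsum N (\<lambda>s. y s \<odot>\<^bsub>N\<^esub> n s) (gens m)"
      by (rule N.finsum_addf[OF cl[OF x] cl[OF y]])
    finally show ?thesis using x y P(8)[OF x y] by (simp add: free_map_def)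
  qed
  ultimately show ?thesis
    unfolding hom_space_simps
    using N.finsum_closed[OF cl] by (auto simp: free_map_def intro!: module_homI)
qed

lemma free_map_gen:
  assumes N: "left_module \<Lambda> N" and n: "\<And>s. s \<in> gens m \<Longrightarrow> n s \<in> carrier N" and s: "s \<in> gens m"
  shows "free_map m N n (gen m s) = idem (fst s) \<odot>\<^bsub>N\<^esub> n s"
proof -
  note D = left_moduleD[OF N]
  interpret N: abelian_group N by (fact D(2))
  have e: "idem (fst s) \<odot>\<^bsub>N\<^esub> n s \<in> carrier N" using D(3) n s gens_verts idem_in_carrier by blast
  have "finsum N (\<lambda>t. gen m s t \<odot>\<^bsub>N\<^esub> n t) (gens m) =
      finsum N (\<lambda>t. if s = t then idem (fst t) \<odot>\<^bsub>N\<^esub> n t else \<zero>\<^bsub>N\<^esub>) (gens m)"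
    by (rule N.finsum_cong')
       (use n D(3) gens_verts idem_in_carrier left_module_smult_zero[OF N] in \<open>auto simp: gen_def\<close>)
  also have "\<dots> = idem (fst s) \<odot>\<^bsub>N\<^esub> n s"
    by (rule N.finsum_singleton[OF s]) (use n D(3) gens_verts idem_in_carrier in auto)
  finally show ?thesis by (simp add: free_map_def gen_in_carrier s)
qed

text \<open>Truncate \<open>x\<close> to a set of indices and let this set grow by one index at a
  time: each new index contributes a multiple of its generator.\<close>

lemma proj_hom_eq_free_map:
  assumes N: "left_module \<Lambda> N" and f: "f \<in> module_hom \<Lambda> (proj Q I m) N"
    and x: "x \<in> carrier (proj Q I m)"
  shows "f x = free_map m N (\<lambda>s. f (gen m s)) x"
proof -
  note D = left_moduleD[OF N] and P = left_moduleD[OF left_module_proj] and f' = module_homD[OF f]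
  interpret N: abelian_group N by (fact D(2))
  let ?x = "\<lambda>S. \<lambda>t\<in>gens m. if t \<in> S then x t else \<zero>\<^bsub>\<Lambda>\<^esub>"
  have xS: "?x S \<in> carrier (proj Q I m)" for S
    using x by (auto simp: proj_simps gens_verts idem_in_carrier)
  have "f (?x S) = finsum N (\<lambda>s. x s \<odot>\<^bsub>N\<^esub> f (gen m s)) S" if "finite S" "S \<subseteq> gens m" for S
    using that
  proof (induction S rule: finite_induct)
    case empty
    have "?x {} = \<zero>\<^bsub>proj Q I m\<^esub>" by (simp add: proj_simps)
    then show ?case using module_hom_zero[OF f left_module_proj D(2)] by simp
  next
    case (insert s S)
    have s: "s \<in> gens m" and xs: "x s \<in> carrier \<Lambda>" using insert x by (auto simp: proj_simps)
    have cl: "x t \<odot>\<^bsub>N\<^esub> f (gen m t) \<in> carrier N" if "t \<in> gens m" for t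
      using that x D(3) f'(1) gen_in_carrier by (auto simp: proj_simps)
    \<comment> \<open>The entry at \<open>s\<close> is split off as a multiple of the generator;
      this uses that \<open>x s\<close> is unchanged by the idempotent on its right, the condition
      for lying in \<open>proj\<close>.\<close>
    have "?x (insert s S) = x s \<odot>\<^bsub>proj Q I m\<^esub> gen m s \<oplus>\<^bsub>proj Q I m\<^esub> ?x S"
      unfolding gen_def proj_simps
    proof (rule restrict_ext)
      fix t assume t: "t \<in> gens m"
      have "x t \<in> carrier \<Lambda>" "x s \<otimes>\<^bsub>\<Lambda>\<^esub> idem (fst s) = x s" using x s t by (simp_all add: proj_simps)
      then show "(if t \<in> insert s S then x t else \<zero>\<^bsub>\<Lambda>\<^esub>) =
        (\<lambda>t\<in>gens m. x s \<otimes>\<^bsub>\<Lambda>\<^esub> (\<lambda>t\<in>gens m. if t = s then idem (fst s) else \<zero>\<^bsub>\<Lambda>\<^esub>) t) t \<oplus>\<^bsub>\<Lambda>\<^esub> ?x S t"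
        using t xs insert(2) by simp
    qed
    then have "f (?x (insert s S)) = x s \<odot>\<^bsub>N\<^esub> f (gen m s) \<oplus>\<^bsub>N\<^esub> f (?x S)"
      using f'(2)[OF P(3)[OF xs gen_in_carrier[OF s]] xS] f'(3)[OF xs gen_in_carrier[OF s]] by simp
    also have "\<dots> = finsum N (\<lambda>s. x s \<odot>\<^bsub>N\<^esub> f (gen m s)) (insert s S)"
      using insert cl by (subst N.finsum_insert) (auto simp del: restrict_apply)
    finally show ?case .
  qed
  from this[of "gens m"]
  have "f (?x (gens m)) = finsum N (\<lambda>s. x s \<odot>\<^bsub>N\<^esub> f (gen m s)) (gens m)" by (simp del: restrict_apply)
  moreover have "?x (gens m) = x"
    by (rule extensionalityI[where A = "gens m"]) (use x in \<open>auto simp: proj_simps\<close>)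
  ultimately show ?thesis using x by (simp add: free_map_def)
qed

lemma proj_hom_ext:
  assumes N: "left_module \<Lambda> N" and f: "f \<in> module_hom \<Lambda> (proj Q I m) N"
    and h: "h \<in> module_hom \<Lambda> (proj Q I m) N"
    and eq: "\<And>s. s \<in> gens m \<Longrightarrow> f (gen m s) = h (gen m s)" and x: "x \<in> carrier (proj Q I m)"
  shows "f x = h x"
proof -
  interpret N: abelian_group N using left_moduleD[OF N] by blast
  have "free_map m N (\<lambda>s. f (gen m s)) x = free_map m N (\<lambda>s. h (gen m s)) x"
    unfolding free_map_def using x eq
      module_homD(1)[OF h gen_in_carrier] left_moduleD(3)[OF N]
    by (simp, intro N.finsum_cong') (auto simp: proj_simps)
  then show ?thesis
    using proj_hom_eq_free_map[OF N f x] proj_hom_eq_free_map[OF N h x] by simp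
qed

lemma module_hom_comp:
  "f \<in> module_hom \<Lambda> M N \<Longrightarrow> h \<in> module_hom \<Lambda> N N' \<Longrightarrow> (\<lambda>x. h (f x)) \<in> module_hom \<Lambda> M N'"
  by (rule module_homI) (auto simp: module_hom_def Pi_iff)

lemma restrict_module_hom:
  assumes "f \<in> module_hom \<Lambda> M N" "left_module \<Lambda> M"
  shows "restrict f (carrier M) \<in> carrier (hom_space Q I M N)"
  using assms module_homD[OF assms(1)] left_moduleD[OF assms(2)]
  by (auto simp: hom_space_simps intro!: module_homI)

text \<open>Projectivity. The preimages \<open>n s\<close> are chosen without regard to idempotents;
  the extra factor brought in by \<open>free_map\<close> is harmless, since the idempotent fixes the
  generator and therefore also its image under \<open>f\<close>.\<close>

lemma proj_lift:
  assumes M: "left_module \<Lambda> M" and N: "left_module \<Lambda> N" and p: "p \<in> module_hom \<Lambda> M N"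
    and f: "f \<in> module_hom \<Lambda> (proj Q I m) N" and im: "f ` carrier (proj Q I m) \<subseteq> p ` carrier M"
  shows "\<exists>h\<in>carrier (hom_space Q I (proj Q I m) M). \<forall>x\<in>carrier (proj Q I m). p (h x) = f x"
proof -
  have "\<exists>y. y \<in> carrier M \<and> p y = f (gen m s)" if "s \<in> gens m" for s
    using im gen_in_carrier[OF that] by (metis image_iff image_subset_iff)
  then obtain n where n: "\<And>s. s \<in> gens m \<Longrightarrow> n s \<in> carrier M" "\<And>s. s \<in> gens m \<Longrightarrow> p (n s) = f (gen m s)"
    by metis
  let ?h = "free_map m M n"
  have h: "?h \<in> carrier (hom_space Q I (proj Q I m) M)" by (rule free_map_hom[OF M n(1)])
  then have h': "?h \<in> module_hom \<Lambda> (proj Q I m) M" by (simp add: hom_space_simps)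
  have "p (?h x) = f x" if x: "x \<in> carrier (proj Q I m)" for x
  proof (rule proj_hom_ext[OF N module_hom_comp[OF h' p] f _ x])
    fix s assume s: "s \<in> gens m"
    have e: "idem (fst s) \<in> carrier \<Lambda>" using gens_verts[OF s] by (rule idem_in_carrier)
    have "p (?h (gen m s)) = idem (fst s) \<odot>\<^bsub>N\<^esub> f (gen m s)"
      using free_map_gen[OF M n(1) s] module_homD(3)[OF p e n(1)[OF s]] n(2)[OF s] by simp
    also have "\<dots> = f (gen m s)"
      using module_homD(3)[OF f e gen_in_carrier[OF s]] idem_gen[OF s] by simp
    finally show "p (?h (gen m s)) = f (gen m s)" .
  qed
  then show ?thesis using h by blast
qed

text \<open>Evaluation at the finitely many generators embeds the Hom space in a finite power of
  N.\<close>

lemma fdvs_hom_proj: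
  assumes N: "left_module \<Lambda> N" and fd: "fdvs (underlying_space Q I N)"
  shows "fdvs (hom_space Q I (proj Q I m) N)"
proof (rule fdvs_inj(1)[OF fdvs_power_space[OF finite_gens[of m] fd] closed_ops_hom_space[OF left_module_proj N]])
  let ?f = "\<lambda>f. \<lambda>s\<in>gens m. f (gen m s)"
  note D = left_moduleD[OF N] and P = left_moduleD[OF left_module_proj]
  show "lin (hom_space Q I (proj Q I m) N) (power_space (gens m) (underlying_space Q I N)) ?f"
    by (rule linI)
       (auto simp: hom_space_simps power_space_def underlying_space_def gen_in_carrier
         intro!: restrict_ext dest: module_homD(1) gen_in_carrier)
  show "inj_on ?f (carrier (hom_space Q I (proj Q I m) N))"
  proof (rule inj_onI)
    fix f h assume f: "f \<in> carrier (hom_space Q I (proj Q I m) N)"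
      and h: "h \<in> carrier (hom_space Q I (proj Q I m) N)" and eq: "?f f = ?f h"
    have "f (gen m s) = h (gen m s)" if "s \<in> gens m" for s
      using fun_cong[OF eq, of s] that by simp
    then have "f x = h x" if "x \<in> carrier (proj Q I m)" for x
      using proj_hom_ext[OF N _ _ _ that] f h by (simp add: hom_space_simps)
    then show "f = h" using f h by (intro extensionalityI) (auto simp: hom_space_simps)
  qed
qed

section \<open>Finite dimension of the algebra and of its projective modules\<close>

text \<open>The algebra as a left module over itself, so that its underlying vector space can be
  formed.\<close>

definition regular_module :: "(('v, 'a, 'k) residue, ('v, 'a, 'k) residue) module" where
  "regular_module = \<lparr>carrier = carrier \<Lambda>, mult = undefined, one = undefined,
    zero = \<zero>\<^bsub>\<Lambda>\<^esub>, add = add \<Lambda>, smult = mult \<Lambda>\<rparr>"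

text \<open>By admissibility some power of the arrow ideal lies in \<open>I\<close>, so the classes
  of the paths shorter than \<open>k\<close> span, and a finite quiver has only finitely many of
  them.\<close>

lemma fdvs_regular: "fdvs (underlying_space Q I regular_module)"
proof -
  obtain k where k: "arrow_ideal_power Q k \<subseteq> I" using admissible by blast
  define E where "E = {w \<in> paths Q. length (snd w) < k}"
  have "E \<subseteq> verts Q \<times> {p. set p \<subseteq> arcs Q \<and> length p \<le> k}"
    by (auto simp: E_def paths_def awalk_def)
  then have fE: "finite E"
    by (rule finite_subset) (simp add: finite_lists_length_le)
  have EP: "c \<in> carrier pathring" if "c \<in> carrier (coord_space E)" for c
  proof -
    have "{w. c w \<noteq> 0} \<subseteq> E" using that by (auto simp: coord_space_simps)
    then show ?thesis using finite_subset[OF _ fE] by (auto simp: path_algebra_carrier E_def)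
  qed
  have l: "lin (coord_space E) (underlying_space Q I regular_module) (\<lambda>c. cls c)"
  proof (rule linI)
    show "cls x \<in> carrier (underlying_space Q I regular_module)"
      if "x \<in> carrier (coord_space E)" for x
      using EP[OF that] cls_hom(1) by (simp add: underlying_space_def regular_module_def)
    show "cls (x \<oplus>\<^bsub>coord_space E\<^esub> y) = cls x \<oplus>\<^bsub>underlying_space Q I regular_module\<^esub> cls y"
      if "x \<in> carrier (coord_space E)" "y \<in> carrier (coord_space E)" for x y
      using cls_hom(2)[OF EP[OF that(1)] EP[OF that(2)]]
      by (simp add: underlying_space_def regular_module_def coord_space_simps path_algebra_def)
    show "cls (c \<odot>\<^bsub>coord_space E\<^esub> x) = c \<odot>\<^bsub>underlying_space Q I regular_module\<^esub> cls x"
      if "x \<in> carrier (coord_space E)" for c x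
      using scalar_cls[OF EP[OF that], of c]
      by (simp add: underlying_space_def regular_module_def coord_space_simps)
    have "cls \<zero>\<^bsub>pathring\<^esub> = \<zero>\<^bsub>\<Lambda>\<^esub>"
      using ring_hom_zero[OF I.rcos_ring_hom P.ring_axioms I.quotient_is_ring] by (simp add: Lambda_def)
    then show "cls \<zero>\<^bsub>coord_space E\<^esub> = \<zero>\<^bsub>underlying_space Q I regular_module\<^esub>"
      by (simp add: underlying_space_def regular_module_def coord_space_simps path_algebra_def)
  qed
  have "r \<in> (\<lambda>c. cls c) ` carrier (coord_space E)" if "r \<in> carrier \<Lambda>" for r
  proof -
    from that obtain x where x: "x \<in> carrier pathring" "r = cls x" by (auto simp: carrier_Lambda)
    \<comment> \<open>\<open>y\<close> keeps the short paths of \<open>x\<close> and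
      \<open>z\<close> the long ones. The latter part lies in the ideal, so \<open>x\<close> and
      \<open>y\<close> have the same class.\<close>
    define y where "y w = (if w \<in> E then x w else 0)" for w
    define z where "z w = (if w \<in> E then 0 else x w)" for w
    have y: "y \<in> carrier (coord_space E)" by (simp add: y_def coord_space_simps)
    have "finite {w. z w \<noteq> 0}"
      by (rule finite_subset[of _ "{w. x w \<noteq> 0}"]) (use x(1) in \<open>auto simp: z_def path_algebra_carrier\<close>)
    then have z: "z \<in> arrow_ideal_power Q k"
      using x(1) unfolding arrow_ideal_power_def E_def
      by (auto simp: z_def path_algebra_carrier E_def split: if_splits)
    then have "z \<in> I" using k by blast
    moreover have "x = z \<oplus>\<^bsub>pathring\<^esub> y" by (auto simp: path_algebra_def y_def z_def)
    ultimately have "x \<in> cls y" by (auto simp: a_r_coset_def')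
    then have "cls y = cls x"
      using P.a_repr_independence[OF _ EP[OF y] I.a_subgroup] by blast
    then show ?thesis using x(2) y by blast
  qed
  then have surj: "(\<lambda>c. cls c) ` carrier (coord_space E) = carrier (underlying_space Q I regular_module)"
    using linD(1)[OF l] by (auto simp: underlying_space_def regular_module_def)
  show ?thesis by (rule fdvs_surj(1)[OF vdim_coord_space(1)[OF fE] l surj])
qed

lemma fdvs_proj: "fdvs (underlying_space Q I (proj Q I m))"
proof (rule fdvs_inj(1)[OF fdvs_power_space[OF finite_gens[of m] fdvs_regular]])
  show "closed_ops (underlying_space Q I (proj Q I m))"
    by (rule vectorspaceD(1)[OF vectorspace_underlying[OF left_module_proj]])
  show "lin (underlying_space Q I (proj Q I m)) (power_space (gens m) (underlying_space Q I regular_module)) id"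
    by (auto simp: lin_def underlying_space_def power_space_def regular_module_def proj_simps PiE_iff)
qed simp

lemma fdvs_presentation_space: "fdvs (hom_space Q I (proj Q I m) (proj Q I m'))"
  by (rule fdvs_hom_proj[OF left_module_proj fdvs_proj])

section \<open>Modules of representations\<close>

text \<open>The sum may run over any finite set of paths from \<open>u\<close> to \<open>v\<close>
  that contains the support, which allows two elements to be added over a common set.\<close>

lemma element_matrix_apply:
  assumes A: "finite A" "{p. awalk u p v \<and> x (u, p) \<noteq> 0} \<subseteq> A" "A \<subseteq> {p. awalk u p v}"
    and ij: "i < d v" "j < d u"
  shows "element_matrix Q d M x u v $$ (i, j) = (\<Sum>p\<in>A. x (u, p) * path_matrix Q d M u p $$ (i, j))"
  unfolding element_matrix_def using ij
  by (simp, intro sum.mono_neutral_left) (use A in auto)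

lemma element_matrix_dim [simp]: "element_matrix Q d M x u v \<in> carrier_mat (d v) (d u)"
  by (simp add: element_matrix_def)

lemma finite_support_at:
  assumes "x \<in> carrier pathring"
  shows "finite {p. awalk u p v \<and> x (u, p) \<noteq> 0}"
proof -
  have "{p. awalk u p v \<and> x (u, p) \<noteq> 0} \<subseteq> snd ` {w. x w \<noteq> 0}" by force
  then show ?thesis by (rule finite_subset) (use assms in \<open>simp add: path_algebra_carrier\<close>)
qed

lemma element_matrix_add:
  assumes x: "x \<in> carrier pathring" and y: "y \<in> carrier pathring"
  shows "element_matrix Q d M (x \<oplus>\<^bsub>pathring\<^esub> y) u v = element_matrix Q d M x u v + element_matrix Q d M y u v"
proof (rule eq_matI)
  fix i j
  assume "i < dim_row (element_matrix Q d M x u v + element_matrix Q d M y u v)"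
    "j < dim_col (element_matrix Q d M x u v + element_matrix Q d M y u v)"
  then have ij: "i < d v" "j < d u" by (simp_all add: element_matrix_def)
  let ?A = "{p. awalk u p v \<and> x (u, p) \<noteq> 0} \<union> {p. awalk u p v \<and> y (u, p) \<noteq> 0}"
  have A: "finite ?A" "?A \<subseteq> {p. awalk u p v}" using finite_support_at x y by auto
  have add: "(x \<oplus>\<^bsub>pathring\<^esub> y) w = x w + y w" for w by (simp add: path_algebra_def)
  have "element_matrix Q d M (x \<oplus>\<^bsub>pathring\<^esub> y) u v $$ (i, j) =
    (\<Sum>p\<in>?A. (x \<oplus>\<^bsub>pathring\<^esub> y) (u, p) * path_matrix Q d M u p $$ (i, j))"
    by (rule element_matrix_apply[OF A(1) _ A(2) ij]) (auto simp: add)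
  also have "\<dots> = (\<Sum>p\<in>?A. x (u, p) * path_matrix Q d M u p $$ (i, j)) +
    (\<Sum>p\<in>?A. y (u, p) * path_matrix Q d M u p $$ (i, j))"
    by (simp only: add distrib_right sum.distrib)
  also have "(\<Sum>p\<in>?A. x (u, p) * path_matrix Q d M u p $$ (i, j)) = element_matrix Q d M x u v $$ (i, j)"
    by (rule element_matrix_apply[OF A(1) _ A(2) ij, symmetric]) blast
  also have "(\<Sum>p\<in>?A. y (u, p) * path_matrix Q d M u p $$ (i, j)) = element_matrix Q d M y u v $$ (i, j)"
    by (rule element_matrix_apply[OF A(1) _ A(2) ij, symmetric]) blast
  finally show "element_matrix Q d M (x \<oplus>\<^bsub>pathring\<^esub> y) u v $$ (i, j) =
    (element_matrix Q d M x u v + element_matrix Q d M y u v) $$ (i, j)"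
    using ij by (simp add: element_matrix_def)
qed (simp_all add: element_matrix_def)

lemma rep_carrier: "carrier (rep_module Q d M) = (\<Pi>\<^sub>E v\<in>verts Q. carrier_vec (d v))"
  by (simp add: rep_module_def)

text \<open>Elements of the ideal have zero matrices at a point of the variety. All representatives
  of a coset therefore act alike, and \<open>the_elem\<close> is applied to a singleton.\<close>

lemma rep_module_smult:
  assumes M: "M \<in> rep_variety Q I d" and x: "x \<in> carrier pathring"
  shows "cls x \<odot>\<^bsub>rep_module Q d M\<^esub> y = element_action Q d M x y"
proof -
  have "element_action Q d M x' y = element_action Q d M x y" if "x' \<in> cls x" for x'
  proof -
    from that obtain i where i: "i \<in> I" "x' = i \<oplus>\<^bsub>pathring\<^esub> x" by (auto simp: a_r_coset_def')
    have iP: "i \<in> carrier pathring" using i(1) I.a_subset by blast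
    have "element_matrix Q d M x' u v = element_matrix Q d M x u v" if "u \<in> verts Q" "v \<in> verts Q" for u v
    proof -
      have "element_matrix Q d M i u v = 0\<^sub>m (d v) (d u)" using M i(1) that by (auto simp: rep_variety_def)
      then show ?thesis unfolding i(2) element_matrix_add[OF iP x]
        using left_add_zero_mat[OF element_matrix_dim] by metis
    qed
    then show ?thesis unfolding element_action_def by (simp cong: restrict_cong sum.cong)
  qed
  then have "(\<lambda>x. element_action Q d M x y) ` cls x = (\<lambda>_. element_action Q d M x y) ` cls x"
    by (rule image_cong[OF refl])
  also have "\<dots> = {element_action Q d M x y}"
    by (rule image_constant[OF I.a_rcos_self[OF x]])
  finally have "(\<lambda>x. element_action Q d M x y) ` cls x = {element_action Q d M x y}" .
  then show ?thesis by (simp add: rep_module_def)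
qed

lemma path_matrix_dim:
  assumes M: "\<And>\<alpha>. \<alpha> \<in> arcs Q \<Longrightarrow> M \<alpha> \<in> carrier_mat (d (head Q \<alpha>)) (d (tail Q \<alpha>))" and "awalk u p v"
  shows "path_matrix Q d M u p \<in> carrier_mat (d v) (d u)"
  using assms(2)
proof (induction p arbitrary: u)
  case Nil
  then show ?case by (simp add: awalk_Nil_iff)
next
  case (Cons \<alpha> p)
  then have "\<alpha> \<in> arcs Q" "tail Q \<alpha> = u" "awalk (head Q \<alpha>) p v" by (auto simp: awalk_Cons_iff)
  with Cons.IH[of "head Q \<alpha>"] M[of \<alpha>] show ?case by (auto intro: mult_carrier_mat)
qed

lemma element_action_scalar:
  assumes y: "y \<in> carrier (rep_module Q d M)"
  shows "element_action Q d M (\<lambda>w. c * \<one>\<^bsub>pathring\<^esub> w) y = (\<lambda>v\<in>verts Q. c \<cdot>\<^sub>v y v)"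
  unfolding element_action_def
proof (rule restrict_ext, rule eq_vecI)
  have yv: "y u \<in> carrier_vec (d u)" if "u \<in> verts Q" for u
    using y that unfolding rep_carrier by (rule PiE_mem)
  fix v i assume v: "v \<in> verts Q" and "i < dim_vec (c \<cdot>\<^sub>v y v)"
  then have i: "i < d v" using carrier_vecD[OF yv[OF v]] by simp
  have mat: "element_matrix Q d M (\<lambda>w. c * \<one>\<^bsub>pathring\<^esub> w) u v = (if u = v then c \<cdot>\<^sub>m 1\<^sub>m (d v) else 0\<^sub>m (d v) (d u))"
    if "u \<in> verts Q" for u
  proof (rule eq_matI)
    fix i j assume "i < dim_row (if u = v then c \<cdot>\<^sub>m 1\<^sub>m (d v) else 0\<^sub>m (d v) (d u))"
      "j < dim_col (if u = v then c \<cdot>\<^sub>m 1\<^sub>m (d v) else 0\<^sub>m (d v) (d u))"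
    then have ij: "i < d v" "j < d u" by (auto split: if_splits)
    show "element_matrix Q d M (\<lambda>w. c * \<one>\<^bsub>pathring\<^esub> w) u v $$ (i, j) =
      (if u = v then c \<cdot>\<^sub>m 1\<^sub>m (d v) else 0\<^sub>m (d v) (d u)) $$ (i, j)"
      (is "_ = ?rhs")
    proof -
      have "element_matrix Q d M (\<lambda>w. c * \<one>\<^bsub>pathring\<^esub> w) u v $$ (i, j) =
        (\<Sum>p\<in>(if u = v then {[]} else {}). (c * \<one>\<^bsub>pathring\<^esub> (u, p)) * path_matrix Q d M u p $$ (i, j))"
        by (rule element_matrix_apply[OF _ _ _ ij])
           (use that v in \<open>auto simp: scalar_one_apply awalk_Nil_iff split: if_splits\<close>)
      also have "\<dots> = ?rhs" using ij that by (cases "u = v") (simp_all add: scalar_one_apply)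
      finally show ?thesis .
    qed
  qed (auto simp: element_matrix_def)
  have one: "((c \<cdot>\<^sub>m 1\<^sub>m (d v)) *\<^sub>v y v) $ i = c * y v $ i"
  proof -
    have "((c \<cdot>\<^sub>m 1\<^sub>m (d v)) *\<^sub>v y v) $ i = (\<Sum>k = 0..<d v. if k = i then c * y v $ k else 0)"
    proof -
      have "((c \<cdot>\<^sub>m 1\<^sub>m (d v)) *\<^sub>v y v) $ i = row (c \<cdot>\<^sub>m 1\<^sub>m (d v)) i \<bullet> y v"
        by (rule index_mult_mat_vec) (simp add: i)
      then show ?thesis unfolding scalar_prod_def carrier_vecD[OF yv[OF v]]
        by (simp only:, intro sum.cong refl) (use i in auto)
    qed
    also have "\<dots> = c * y v $ i" using i by simp
    finally show ?thesis .
  qed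
  have "vec (d v) (\<lambda>i. \<Sum>u\<in>verts Q. (element_matrix Q d M (\<lambda>w. c * \<one>\<^bsub>pathring\<^esub> w) u v *\<^sub>v y u) $ i) $ i =
    (\<Sum>u\<in>verts Q. (element_matrix Q d M (\<lambda>w. c * \<one>\<^bsub>pathring\<^esub> w) u v *\<^sub>v y u) $ i)"
    by (rule index_vec[OF i])
  also have "\<dots> = (\<Sum>u\<in>verts Q. if u = v then c * y v $ i else 0)"
  proof (rule sum.cong[OF refl])
    fix u assume u: "u \<in> verts Q"
    show "(element_matrix Q d M (\<lambda>w. c * \<one>\<^bsub>pathring\<^esub> w) u v *\<^sub>v y u) $ i = (if u = v then c * y v $ i else 0)"
      unfolding mat[OF u] using yv[OF u] i one by (cases "u = v") simp_all
  qed
  also have "\<dots> = (c \<cdot>\<^sub>v y v) $ i" using v i carrier_vecD[OF yv[OF v]] by simp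
  finally show "vec (d v) (\<lambda>i. \<Sum>u\<in>verts Q. (element_matrix Q d M (\<lambda>w. c * \<one>\<^bsub>pathring\<^esub> w) u v *\<^sub>v y u) $ i) $ i =
    (c \<cdot>\<^sub>v y v) $ i" .
next
  fix v assume v: "v \<in> verts Q"
  have "y v \<in> carrier_vec (d v)" using y v unfolding rep_carrier by (rule PiE_mem)
  then show "dim_vec (vec (d v) (\<lambda>i. \<Sum>u\<in>verts Q. (element_matrix Q d M (\<lambda>w. c * \<one>\<^bsub>pathring\<^esub> w) u v *\<^sub>v y u) $ i)) =
    dim_vec (c \<cdot>\<^sub>v y v)" by (simp only: dim_vec index_smult_vec carrier_vecD)
qed

text \<open>The support consists of one path, which contributes to one block only. The cases of
  interest are the trivial path, for the vertex idempotents, and a single arrow.\<close>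

lemma element_action_path:
  fixes M :: "'a \<Rightarrow> 'k mat"
  assumes M: "\<And>\<alpha>. \<alpha> \<in> arcs Q \<Longrightarrow> M \<alpha> \<in> carrier_mat (d (head Q \<alpha>)) (d (tail Q \<alpha>))"
    and y: "y \<in> carrier (rep_module Q d M)" and p: "awalk s p t"
  shows "element_action Q d M (\<lambda>w. if w = (s, p) then 1 else 0) y =
    (\<lambda>v\<in>verts Q. if v = t then path_matrix Q d M s p *\<^sub>v y s else 0\<^sub>v (d v))"
  unfolding element_action_def
proof (rule restrict_ext, rule eq_vecI)
  let ?x = "\<lambda>w. if w = (s, p) then 1 else 0 :: 'k"
  have PM: "path_matrix Q d M s p \<in> carrier_mat (d t) (d s)" by (rule path_matrix_dim[OF M p])
  have s: "s \<in> verts Q" using p by (auto simp: awalk_def)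
  fix v i assume v: "v \<in> verts Q"
    and "i < dim_vec (if v = t then path_matrix Q d M s p *\<^sub>v y s else 0\<^sub>v (d v))"
  then have i: "i < d v" using PM by (auto split: if_splits)
  have yv: "y u \<in> carrier_vec (d u)" if "u \<in> verts Q" for u
    using y that unfolding rep_carrier by (rule PiE_mem)
  \<comment> \<open>A path has only one end, so \<open>p\<close> is counted in the block from
    \<open>s\<close> to \<open>t\<close> alone.\<close>
  have uniq: "v = t" if "awalk s p v" using that p by (metis awalk_def awlast_if_cas)
  have mat: "element_matrix Q d M ?x u v = (if u = s \<and> v = t then path_matrix Q d M s p else 0\<^sub>m (d v) (d u))"
    if "u \<in> verts Q" for u
  proof (rule eq_matI)
    fix i j assume "i < dim_row (if u = s \<and> v = t then path_matrix Q d M s p else 0\<^sub>m (d v) (d u))"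
      "j < dim_col (if u = s \<and> v = t then path_matrix Q d M s p else 0\<^sub>m (d v) (d u))"
    then have ij: "i < d v" "j < d u" using PM by (auto split: if_splits)
    show "element_matrix Q d M ?x u v $$ (i, j) =
      (if u = s \<and> v = t then path_matrix Q d M s p else 0\<^sub>m (d v) (d u)) $$ (i, j)"
      (is "_ = ?rhs")
    proof -
      have "element_matrix Q d M ?x u v $$ (i, j) =
        (\<Sum>q\<in>(if u = s \<and> v = t then {p} else {}). ?x (u, q) * path_matrix Q d M u q $$ (i, j))"
      proof (rule element_matrix_apply[OF _ _ _ ij])
        show "{q. awalk u q v \<and> ?x (u, q) \<noteq> 0} \<subseteq> (if u = s \<and> v = t then {p} else {})"
          using uniq by (cases "u = s \<and> v = t") (simp_all split: if_splits, blast+)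
        show "(if u = s \<and> v = t then {p} else {}) \<subseteq> {q. awalk u q v}" using p by simp
      qed simp
      also have "\<dots> = ?rhs"
        by (cases "u = s \<and> v = t") (simp_all only: if_True if_False sum.insert finite.emptyI empty_iff
          sum.empty index_zero_mat ij mult_1_left add_0_right not_False_eq_True simp_thms)
      finally show ?thesis .
    qed
  qed (cases "u = s \<and> v = t", use PM in \<open>simp_all add: element_matrix_def\<close>)+
  have "vec (d v) (\<lambda>i. \<Sum>u\<in>verts Q. (element_matrix Q d M ?x u v *\<^sub>v y u) $ i) $ i =
    (\<Sum>u\<in>verts Q. (element_matrix Q d M ?x u v *\<^sub>v y u) $ i)"
    by (rule index_vec[OF i])
  also have "\<dots> = (\<Sum>u\<in>verts Q. if u = s then (if v = t then path_matrix Q d M s p *\<^sub>v y s else 0\<^sub>v (d v)) $ i else 0)"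
  proof (rule sum.cong[OF refl])
    fix u assume u: "u \<in> verts Q"
    show "(element_matrix Q d M ?x u v *\<^sub>v y u) $ i =
      (if u = s then (if v = t then path_matrix Q d M s p *\<^sub>v y s else 0\<^sub>v (d v)) $ i else 0)"
      unfolding mat[OF u] using yv[OF u] i by (cases "u = s"; cases "v = t") simp_all
  qed
  also have "\<dots> = (if v = t then path_matrix Q d M s p *\<^sub>v y s else 0\<^sub>v (d v)) $ i"
    using s by simp
  finally show "vec (d v) (\<lambda>i. \<Sum>u\<in>verts Q. (element_matrix Q d M ?x u v *\<^sub>v y u) $ i) $ i =
    (if v = t then path_matrix Q d M s p *\<^sub>v y s else 0\<^sub>v (d v)) $ i" .
next
  fix v
  have "path_matrix Q d M s p \<in> carrier_mat (d t) (d s)" by (rule path_matrix_dim[OF M p])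
  then show "dim_vec (vec (d v) (\<lambda>i. \<Sum>u\<in>verts Q.
      (element_matrix Q d M (\<lambda>w. if w = (s, p) then 1 else 0) u v *\<^sub>v y u) $ i)) =
    dim_vec (if v = t then path_matrix Q d M s p *\<^sub>v y s else 0\<^sub>v (d v))"
    by (cases "v = t") (simp_all only: dim_vec dim_mult_mat_vec carrier_matD if_True if_False index_zero_vec simp_thms)
qed

end

section \<open>Linear forms in coordinates\<close>

text \<open>Build \<open>f\<close> from multiples of unit functions, one index at a time. The
  formula turns an arbitrary linear form on a space of matrix entries into a polynomial in these
  entries.\<close>

lemma coord_linear_form:
  fixes l :: "('e \<Rightarrow> 'k::field) \<Rightarrow> 'k"
  assumes E: "finite E" and l: "l \<in> linear_forms (coord_space E)" and f: "f \<in> carrier (coord_space E)"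
  shows "l f = (\<Sum>e\<in>E. f e * l (\<lambda>i. if i = e then 1 else 0))"
proof -
  let ?d = "\<lambda>e i. if i = e then 1 else 0 :: 'k"
  have add: "l (\<lambda>i. x i + y i) = l x + l y"
    if "x \<in> carrier (coord_space E)" "y \<in> carrier (coord_space E)" for x y
    using l that by (auto simp: linear_forms_iff coord_space_simps)
  have sm: "l (\<lambda>i. c * x i) = c * l x" if "x \<in> carrier (coord_space E)" for c x
    using l that by (auto simp: linear_forms_iff coord_space_simps)
  have "l (\<lambda>i. if i \<in> S then f i else 0) = (\<Sum>e\<in>S. f e * l (?d e))" if "finite S" "S \<subseteq> E" for S
    using that
  proof (induction S rule: finite_induct)
    case empty
    show ?case using sm[of "\<lambda>_. 0" 0] by (simp add: coord_space_simps)
  next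
    case (insert s S)
    have "(\<lambda>i. if i \<in> insert s S then f i else 0) = (\<lambda>i. f s * ?d s i + (if i \<in> S then f i else 0))"
      using insert(2) by auto
    moreover have "?d s \<in> carrier (coord_space E)" "(\<lambda>i. f s * ?d s i) \<in> carrier (coord_space E)"
      "(\<lambda>i. if i \<in> S then f i else 0) \<in> carrier (coord_space E)"
      using insert by (auto simp: coord_space_simps)
    ultimately show ?case using insert by (simp only: add sm sum.insert) simp
  qed
  from this[OF E] have "l (\<lambda>i. if i \<in> E then f i else 0) = (\<Sum>e\<in>E. f e * l (?d e))" by simp
  moreover have "(\<lambda>i. if i \<in> E then f i else 0) = f" using f by (auto simp: coord_space_simps)
  ultimately show ?thesis by simp
qed

lemma vec_linear_form:
  fixes l :: "'k::field vec \<Rightarrow> 'k"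
  assumes add: "\<And>x y. x \<in> carrier_vec n \<Longrightarrow> y \<in> carrier_vec n \<Longrightarrow> l (x + y) = l x + l y"
    and sm: "\<And>c x. x \<in> carrier_vec n \<Longrightarrow> l (c \<cdot>\<^sub>v x) = c * l x" and y: "y \<in> carrier_vec n"
  shows "l y = (\<Sum>j<n. y $ j * l (unit_vec n j))"
proof -
  let ?C = "coord_space {..<n} :: ('k, nat \<Rightarrow> 'k) module"
  have vadd: "vec n (\<lambda>i. x i + z i) = vec n x + vec n z" for x z :: "nat \<Rightarrow> 'k" by (rule eq_vecI) simp_all
  have vsm: "vec n (\<lambda>i. c * x i) = c \<cdot>\<^sub>v vec n x" for c and x :: "nat \<Rightarrow> 'k" by (rule eq_vecI) simp_all
  have "(\<lambda>c. l (vec n c)) \<in> linear_forms ?C"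
    by (auto simp: linear_forms_iff coord_space_simps vadd vsm add sm)
  moreover have "(\<lambda>i. if i < n then y $ i else 0) \<in> carrier ?C" by (simp add: coord_space_simps)
  ultimately have "l (vec n (\<lambda>i. if i < n then y $ i else 0)) =
    (\<Sum>j<n. (if j < n then y $ j else 0) * l (vec n (\<lambda>i. if i = j then 1 else 0)))"
    by (rule coord_linear_form[OF finite_lessThan])
  moreover have "vec n (\<lambda>i. if i < n then y $ i else 0) = y" using y by (intro eq_vecI) auto
  moreover have "vec n (\<lambda>i. if i = j then 1 else 0) = (unit_vec n j :: 'k vec)" for j
    by (rule eq_vecI) (auto simp: unit_vec_def)
  ultimately show ?thesis by simp
qed

context bound_quiver
begin

lemma rep_variety_dim:
  "M \<in> rep_variety Q I d \<Longrightarrow> \<alpha> \<in> arcs Q \<Longrightarrow> M \<alpha> \<in> carrier_mat (d (head Q \<alpha>)) (d (tail Q \<alpha>))"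
  by (auto simp: rep_variety_def)

text \<open>The action is resolved into single paths, so that compatibility with the action can be
  checked for one path matrix at a time.\<close>

lemma element_action_apply:
  fixes M :: "'a \<Rightarrow> 'k mat"
  assumes M: "M \<in> rep_variety Q I d" and x: "x \<in> carrier pathring"
    and y: "\<And>u. u \<in> verts Q \<Longrightarrow> y u \<in> carrier_vec (d u)" and v: "v \<in> verts Q" and i: "i < d v"
  shows "element_action Q d M x y v $ i =
    (\<Sum>u\<in>verts Q. \<Sum>p | awalk u p v \<and> x (u, p) \<noteq> 0. x (u, p) * (path_matrix Q d M u p *\<^sub>v y u) $ i)"
proof -
  have "(element_matrix Q d M x u v *\<^sub>v y u) $ i =
    (\<Sum>p | awalk u p v \<and> x (u, p) \<noteq> 0. x (u, p) * (path_matrix Q d M u p *\<^sub>v y u) $ i)" if u: "u \<in> verts Q" for u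
  proof -
    let ?A = "{p. awalk u p v \<and> x (u, p) \<noteq> 0}"
    have dy: "dim_vec (y u) = d u" by (rule carrier_vecD[OF y[OF u]])
    have "(element_matrix Q d M x u v *\<^sub>v y u) $ i = (\<Sum>j = 0..<d u. element_matrix Q d M x u v $$ (i, j) * y u $ j)"
      using i dy carrier_matD[OF element_matrix_dim, of d M x u v] by (simp add: scalar_prod_def)
    also have "\<dots> = (\<Sum>j = 0..<d u. \<Sum>p\<in>?A. x (u, p) * (path_matrix Q d M u p $$ (i, j) * y u $ j))"
    proof (rule sum.cong[OF refl])
      fix j assume "j \<in> {0..<d u}"
      then have j: "j < d u" by simp
      show "element_matrix Q d M x u v $$ (i, j) * y u $ j =
        (\<Sum>p\<in>?A. x (u, p) * (path_matrix Q d M u p $$ (i, j) * y u $ j))"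
        by (subst element_matrix_apply[OF finite_support_at[OF x] order_refl _ i j])
          (blast, simp only: sum_distrib_right mult.assoc)
    qed
    also have "\<dots> = (\<Sum>p\<in>?A. \<Sum>j = 0..<d u. x (u, p) * (path_matrix Q d M u p $$ (i, j) * y u $ j))"
      by (rule sum.swap)
    also have "\<dots> = (\<Sum>p\<in>?A. x (u, p) * (path_matrix Q d M u p *\<^sub>v y u) $ i)"
    proof (rule sum.cong[OF refl])
      fix p assume p: "p \<in> ?A"
      then have "path_matrix Q d M u p \<in> carrier_mat (d v) (d u)"
        by (intro path_matrix_dim[OF rep_variety_dim[OF M]]) auto
      then have "(path_matrix Q d M u p *\<^sub>v y u) $ i = (\<Sum>j = 0..<d u. path_matrix Q d M u p $$ (i, j) * y u $ j)"
        using i dy by (simp add: scalar_prod_def)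
      then show "(\<Sum>j = 0..<d u. x (u, p) * (path_matrix Q d M u p $$ (i, j) * y u $ j)) =
        x (u, p) * (path_matrix Q d M u p *\<^sub>v y u) $ i" by (simp only: sum_distrib_left)
    qed
    finally show ?thesis .
  qed
  then have "(\<Sum>u\<in>verts Q. (element_matrix Q d M x u v *\<^sub>v y u) $ i) =
    (\<Sum>u\<in>verts Q. \<Sum>p | awalk u p v \<and> x (u, p) \<noteq> 0. x (u, p) * (path_matrix Q d M u p *\<^sub>v y u) $ i)"
    by (rule sum.cong[OF refl])
  then show ?thesis unfolding element_action_def using v by (simp only: restrict_apply' index_vec[OF i])
qed

section \<open>Families of matrices compatible with the arrows\<close>

text \<open>The commuting squares belonging to the arrows are pasted together along the
  path.\<close>

lemma path_matrix_intertwine: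
  fixes M N :: "'a \<Rightarrow> 'k mat"
  assumes M: "M \<in> rep_variety Q I d" and N: "N \<in> rep_variety Q I d'"
    and H: "\<And>v. v \<in> verts Q \<Longrightarrow> H v \<in> carrier_mat (d' v) (d v)"
    and comm: "\<And>\<alpha>. \<alpha> \<in> arcs Q \<Longrightarrow> N \<alpha> * H (tail Q \<alpha>) = H (head Q \<alpha>) * M \<alpha>"
    and p: "awalk u p v"
  shows "path_matrix Q d' N u p * H u = H v * path_matrix Q d M u p"
  using p
proof (induction p arbitrary: u)
  case Nil
  then have "u = v" "u \<in> verts Q" by (auto simp: awalk_Nil_iff)
  then show ?case using left_mult_one_mat[OF H[of v]] right_mult_one_mat[OF H[of v]] by simp
next
  case (Cons \<alpha> p)
  then have a: "\<alpha> \<in> arcs Q" "tail Q \<alpha> = u" "awalk (head Q \<alpha>) p v" by (auto simp: awalk_Cons_iff)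
  let ?h = "head Q \<alpha>"
  have vs: "u \<in> verts Q" "?h \<in> verts Q" using a Cons.prems by (auto simp: awalk_def)
  have v: "v \<in> verts Q" using a(3) by (metis awalk_def awalk_last_in_verts awlast_if_cas)
  have PN: "path_matrix Q d' N ?h p \<in> carrier_mat (d' v) (d' ?h)" and PM: "path_matrix Q d M ?h p \<in> carrier_mat (d v) (d ?h)"
    using path_matrix_dim[OF rep_variety_dim[OF N] a(3)] path_matrix_dim[OF rep_variety_dim[OF M] a(3)] by blast+
  have Na: "N \<alpha> \<in> carrier_mat (d' ?h) (d' u)" and Ma: "M \<alpha> \<in> carrier_mat (d ?h) (d u)"
    using rep_variety_dim[OF N a(1)] rep_variety_dim[OF M a(1)] a(2) by simp_all
  have "path_matrix Q d' N ?h p * N \<alpha> * H u = path_matrix Q d' N ?h p * (N \<alpha> * H u)"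
    by (rule assoc_mult_mat[OF PN Na H[OF vs(1)]])
  also have "\<dots> = path_matrix Q d' N ?h p * (H ?h * M \<alpha>)" using comm[OF a(1)] a(2) by simp
  also have "\<dots> = path_matrix Q d' N ?h p * H ?h * M \<alpha>"
    by (rule assoc_mult_mat[OF PN H[OF vs(2)] Ma, symmetric])
  also have "\<dots> = H v * path_matrix Q d M ?h p * M \<alpha>" unfolding Cons.IH[OF a(3)] ..
  also have "\<dots> = H v * (path_matrix Q d M ?h p * M \<alpha>)"
    by (rule assoc_mult_mat[OF H[OF v] PM Ma])
  finally show ?case by (simp only: path_matrix.simps)
qed

text \<open>Both sides are sums over the paths in the support of \<open>x\<close>. After exchanging
  the finite sums, H is moved past each path matrix separately.\<close>

lemma element_action_intertwine:
  fixes M N :: "'a \<Rightarrow> 'k mat"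
  assumes M: "M \<in> rep_variety Q I d" and N: "N \<in> rep_variety Q I d'"
    and H: "\<And>v. v \<in> verts Q \<Longrightarrow> H v \<in> carrier_mat (d' v) (d v)"
    and comm: "\<And>\<alpha>. \<alpha> \<in> arcs Q \<Longrightarrow> N \<alpha> * H (tail Q \<alpha>) = H (head Q \<alpha>) * M \<alpha>"
    and x: "x \<in> carrier pathring" and y: "\<And>u. u \<in> verts Q \<Longrightarrow> y u \<in> carrier_vec (d u)"
  shows "element_action Q d' N x (\<lambda>v\<in>verts Q. H v *\<^sub>v y v) =
    (\<lambda>v\<in>verts Q. H v *\<^sub>v element_action Q d M x y v)"
proof (rule extensionalityI[where A = "verts Q"])
  show "element_action Q d' N x (\<lambda>v\<in>verts Q. H v *\<^sub>v y v) \<in> extensional (verts Q)"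
    unfolding element_action_def by (rule restrict_extensional)
  show "(\<lambda>v\<in>verts Q. H v *\<^sub>v element_action Q d M x y v) \<in> extensional (verts Q)"
    by (rule restrict_extensional)
  fix v assume v: "v \<in> verts Q"
  let ?z = "\<lambda>v\<in>verts Q. H v *\<^sub>v y v"
  have z: "?z u \<in> carrier_vec (d' u)" if "u \<in> verts Q" for u
    using mult_mat_vec_carrier[OF H[OF that] y[OF that]] that by (simp only: restrict_apply')
  have dH: "dim_row (H v) = d' v" "dim_col (H v) = d v" using carrier_matD[OF H[OF v]] .
  have dim_ea: "dim_vec (element_action Q d M x y v) = d v" using v by (simp only: element_action_def restrict_apply' dim_vec)
  have "element_action Q d' N x ?z v = H v *\<^sub>v element_action Q d M x y v"
  proof (rule eq_vecI)
    fix i assume "i < dim_vec (H v *\<^sub>v element_action Q d M x y v)"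
    then have i: "i < d' v" by (simp only: dim_mult_mat_vec dH)
    have "(H v *\<^sub>v element_action Q d M x y v) $ i = (\<Sum>k = 0..<d v. H v $$ (i, k) * element_action Q d M x y v $ k)"
      using i dH dim_ea by (simp only: index_mult_mat_vec scalar_prod_def) (intro sum.cong refl, simp)
    also have "\<dots> = (\<Sum>k = 0..<d v. \<Sum>u\<in>verts Q. \<Sum>p | awalk u p v \<and> x (u, p) \<noteq> 0.
      x (u, p) * (H v $$ (i, k) * (path_matrix Q d M u p *\<^sub>v y u) $ k))"
    proof (rule sum.cong[OF refl])
      fix k assume "k \<in> {0..<d v}"
      then have k: "k < d v" by simp
      show "H v $$ (i, k) * element_action Q d M x y v $ k = (\<Sum>u\<in>verts Q. \<Sum>p | awalk u p v \<and> x (u, p) \<noteq> 0.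
        x (u, p) * (H v $$ (i, k) * (path_matrix Q d M u p *\<^sub>v y u) $ k))"
        by (simp only: element_action_apply[OF M x y v k] sum_distrib_left mult.left_commute)
    qed
    also have "\<dots> = (\<Sum>u\<in>verts Q. \<Sum>k = 0..<d v. \<Sum>p | awalk u p v \<and> x (u, p) \<noteq> 0.
      x (u, p) * (H v $$ (i, k) * (path_matrix Q d M u p *\<^sub>v y u) $ k))" by (rule sum.swap)
    also have "\<dots> = (\<Sum>u\<in>verts Q. \<Sum>p | awalk u p v \<and> x (u, p) \<noteq> 0. \<Sum>k = 0..<d v.
      x (u, p) * (H v $$ (i, k) * (path_matrix Q d M u p *\<^sub>v y u) $ k))" by (intro sum.cong refl sum.swap)
    also have "\<dots> = (\<Sum>u\<in>verts Q. \<Sum>p | awalk u p v \<and> x (u, p) \<noteq> 0. x (u, p) * (path_matrix Q d' N u p *\<^sub>v ?z u) $ i)"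
    proof (intro sum.cong refl)
      fix u p assume u: "u \<in> verts Q" and "p \<in> {p. awalk u p v \<and> x (u, p) \<noteq> 0}"
      then have p: "awalk u p v" by simp
      have PN: "path_matrix Q d' N u p \<in> carrier_mat (d' v) (d' u)" and PM: "path_matrix Q d M u p \<in> carrier_mat (d v) (d u)"
        using path_matrix_dim[OF rep_variety_dim[OF N] p] path_matrix_dim[OF rep_variety_dim[OF M] p] by blast+
      have "(\<Sum>k = 0..<d v. x (u, p) * (H v $$ (i, k) * (path_matrix Q d M u p *\<^sub>v y u) $ k)) =
        x (u, p) * (\<Sum>k = 0..<d v. H v $$ (i, k) * (path_matrix Q d M u p *\<^sub>v y u) $ k)"
        by (simp only: sum_distrib_left)
      also have "(\<Sum>k = 0..<d v. H v $$ (i, k) * (path_matrix Q d M u p *\<^sub>v y u) $ k) =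
        (H v *\<^sub>v (path_matrix Q d M u p *\<^sub>v y u)) $ i"
        using i dH carrier_matD[OF PM] by (simp add: scalar_prod_def)
      also have "H v *\<^sub>v (path_matrix Q d M u p *\<^sub>v y u) = (H v * path_matrix Q d M u p) *\<^sub>v y u"
        by (rule assoc_mult_mat_vec[OF H[OF v] PM y[OF u], symmetric])
      also have "\<dots> = (path_matrix Q d' N u p * H u) *\<^sub>v y u"
        using path_matrix_intertwine[where H = H, OF M N H comm p] by simp
      also have "\<dots> = path_matrix Q d' N u p *\<^sub>v (H u *\<^sub>v y u)"
        by (rule assoc_mult_mat_vec[OF PN H[OF u] y[OF u]])
      also have "H u *\<^sub>v y u = ?z u" using u by simp
      finally show "(\<Sum>k = 0..<d v. x (u, p) * (H v $$ (i, k) * (path_matrix Q d M u p *\<^sub>v y u) $ k)) =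
        x (u, p) * (path_matrix Q d' N u p *\<^sub>v ?z u) $ i" .
    qed
    also have "\<dots> = element_action Q d' N x ?z v $ i"
      by (rule element_action_apply[OF N x z v i, symmetric])
    finally show "element_action Q d' N x ?z v $ i = (H v *\<^sub>v element_action Q d M x y v) $ i" ..
  next
    show "dim_vec (element_action Q d' N x ?z v) = dim_vec (H v *\<^sub>v element_action Q d M x y v)"
      using v by (simp only: element_action_def restrict_apply' dim_vec dim_mult_mat_vec dH)
  qed
  then show "element_action Q d' N x ?z v = (\<lambda>v\<in>verts Q. H v *\<^sub>v element_action Q d M x y v) v"
    using v by (simp only: restrict_apply')
qed

lemma rep_module_simps:
  "\<zero>\<^bsub>rep_module Q d M\<^esub> = (\<lambda>v\<in>verts Q. 0\<^sub>v (d v))"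
  "x \<oplus>\<^bsub>rep_module Q d M\<^esub> y = (\<lambda>v\<in>verts Q. x v + y v)"
  by (simp_all add: rep_module_def)

lemma rep_carrierD: "y \<in> carrier (rep_module Q d M) \<Longrightarrow> v \<in> verts Q \<Longrightarrow> y v \<in> carrier_vec (d v)"
  unfolding rep_carrier by (rule PiE_mem)

lemma rep_ext:
  assumes "x \<in> carrier (rep_module Q d M)" "y \<in> carrier (rep_module Q d M)"
    and "\<And>v. v \<in> verts Q \<Longrightarrow> x v = y v"
  shows "x = y"
  using assms unfolding rep_carrier by (rule PiE_ext)

lemma rep_smult_closed:
  assumes M: "M \<in> rep_variety Q I d" and r: "r \<in> carrier \<Lambda>"
  shows "r \<odot>\<^bsub>rep_module Q d M\<^esub> y \<in> carrier (rep_module Q d M)"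
proof -
  obtain x where x: "x \<in> carrier pathring" "r = cls x" using r by (auto simp: carrier_Lambda)
  show ?thesis unfolding x(2) rep_module_smult[OF M x(1)] rep_carrier element_action_def
    by (rule restrict_PiE_iff[THEN iffD2]) simp
qed

lemma rep_add_closed:
  assumes "x \<in> carrier (rep_module Q d M)" "y \<in> carrier (rep_module Q d M)"
  shows "x \<oplus>\<^bsub>rep_module Q d M\<^esub> y \<in> carrier (rep_module Q d M)"
  unfolding rep_module_simps unfolding rep_carrier
  by (rule restrict_PiE_iff[THEN iffD2]) (intro ballI add_carrier_vec rep_carrierD[OF assms(1)] rep_carrierD[OF assms(2)])

text \<open>This has two uses: H as a base change between points of one orbit, and H as the matrices
  of an arbitrary homomorphism of representations.\<close>

lemma rep_matrix_hom:
  fixes M N :: "'a \<Rightarrow> 'k mat"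
  assumes M: "M \<in> rep_variety Q I d" and N: "N \<in> rep_variety Q I d'"
    and H: "\<And>v. v \<in> verts Q \<Longrightarrow> H v \<in> carrier_mat (d' v) (d v)"
    and comm: "\<And>\<alpha>. \<alpha> \<in> arcs Q \<Longrightarrow> N \<alpha> * H (tail Q \<alpha>) = H (head Q \<alpha>) * M \<alpha>"
  shows "(\<lambda>y. \<lambda>v\<in>verts Q. H v *\<^sub>v y v) \<in> module_hom \<Lambda> (rep_module Q d M) (rep_module Q d' N)"
proof (rule module_homI)
  fix y assume y: "y \<in> carrier (rep_module Q d M)"
  show "(\<lambda>v\<in>verts Q. H v *\<^sub>v y v) \<in> carrier (rep_module Q d' N)"
    unfolding rep_carrier by (rule restrict_PiE_iff[THEN iffD2])
      (use mult_mat_vec_carrier[OF H rep_carrierD[OF y]] in blast)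
  fix z assume z: "z \<in> carrier (rep_module Q d M)"
  show "(\<lambda>v\<in>verts Q. H v *\<^sub>v (y \<oplus>\<^bsub>rep_module Q d M\<^esub> z) v) =
    (\<lambda>v\<in>verts Q. H v *\<^sub>v y v) \<oplus>\<^bsub>rep_module Q d' N\<^esub> (\<lambda>v\<in>verts Q. H v *\<^sub>v z v)"
    unfolding rep_module_simps
  proof (rule restrict_ext)
    fix v assume v: "v \<in> verts Q"
    show "H v *\<^sub>v (\<lambda>v\<in>verts Q. y v + z v) v =
      (\<lambda>v\<in>verts Q. H v *\<^sub>v y v) v + (\<lambda>v\<in>verts Q. H v *\<^sub>v z v) v"
      using v mult_add_distrib_mat_vec[OF H[OF v] rep_carrierD[OF y v] rep_carrierD[OF z v]]
      by (simp only: restrict_apply')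
  qed
next
  fix r y assume r: "r \<in> carrier \<Lambda>" and y: "y \<in> carrier (rep_module Q d M)"
  obtain x where x: "x \<in> carrier pathring" "r = cls x" using r by (auto simp: carrier_Lambda)
  show "(\<lambda>v\<in>verts Q. H v *\<^sub>v (r \<odot>\<^bsub>rep_module Q d M\<^esub> y) v) =
    r \<odot>\<^bsub>rep_module Q d' N\<^esub> (\<lambda>v\<in>verts Q. H v *\<^sub>v y v)"
    unfolding x(2) rep_module_smult[OF M x(1)] rep_module_smult[OF N x(1)]
    by (rule element_action_intertwine[where H = H, OF M N H comm x(1) rep_carrierD[OF y], symmetric])
qed


section \<open>Homomorphisms between representations as matrices\<close>

text \<open>Positions (vertex, row, column) in a family H of matrices from dimension vector
  \<open>d\<close> to \<open>d'\<close>; correspondingly, \<open>arrow_index\<close> holds the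
  positions in the family N H - H M, with one block for each arrow.\<close>

definition hom_index :: "('v \<Rightarrow> nat) \<Rightarrow> ('v \<Rightarrow> nat) \<Rightarrow> ('v \<times> nat \<times> nat) set" where
  "hom_index d d' = (SIGMA v:verts Q. {..<d' v} \<times> {..<d v})"

definition arrow_index :: "('v \<Rightarrow> nat) \<Rightarrow> ('v \<Rightarrow> nat) \<Rightarrow> ('a \<times> nat \<times> nat) set" where
  "arrow_index d d' = (SIGMA \<alpha>:arcs Q. {..<d' (head Q \<alpha>)} \<times> {..<d (tail Q \<alpha>)})"

lemma finite_hom_index [simp]: "finite (hom_index d d')"
  and finite_arrow_index [simp]: "finite (arrow_index d d')"
  by (simp_all add: hom_index_def arrow_index_def)

text \<open>In coordinates, the map sending a family of matrices H to the family N H - H M, whose kernel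
  is the space of homomorphisms from M to N.\<close>
definition commutator :: "('v \<Rightarrow> nat) \<Rightarrow> ('v \<Rightarrow> nat) \<Rightarrow> ('a \<Rightarrow> 'k mat) \<Rightarrow> ('a \<Rightarrow> 'k mat) \<Rightarrow>
    ('v \<times> nat \<times> nat \<Rightarrow> 'k) \<Rightarrow> 'a \<times> nat \<times> nat \<Rightarrow> 'k" where
  "commutator d d' M N c = (\<lambda>e. if e \<in> arrow_index d d' then (case e of (\<alpha>, i, j) \<Rightarrow>
    (\<Sum>k = 0..<d' (tail Q \<alpha>). N \<alpha> $$ (i, k) * c (tail Q \<alpha>, k, j)) -
    (\<Sum>k = 0..<d (head Q \<alpha>). c (head Q \<alpha>, i, k) * M \<alpha> $$ (k, j))) else 0)"

lemma lin_commutator: "lin (coord_space (hom_index d d')) (coord_space (arrow_index d d')) (commutator d d' M N)"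
  by (rule linI)
     (auto simp: coord_space_simps commutator_def fun_eq_iff distrib_left distrib_right sum.distrib
        sum_distrib_left right_diff_distrib mult_ac)

definition coord_mat :: "('v \<Rightarrow> nat) \<Rightarrow> ('v \<Rightarrow> nat) \<Rightarrow> ('v \<times> nat \<times> nat \<Rightarrow> 'k) \<Rightarrow> 'v \<Rightarrow> 'k mat" where
  "coord_mat d d' c v = mat (d' v) (d v) (\<lambda>(i, j). c (v, i, j))"

lemma coord_mat_carrier: "coord_mat d d' c v \<in> carrier_mat (d' v) (d v)"
  by (simp add: coord_mat_def)

lemma commutator_zero_iff:
  assumes M: "M \<in> rep_variety Q I d" and N: "N \<in> rep_variety Q I d'"
  shows "commutator d d' M N c = (\<lambda>_. 0) \<longleftrightarrow>
    (\<forall>\<alpha>\<in>arcs Q. N \<alpha> * coord_mat d d' c (tail Q \<alpha>) = coord_mat d d' c (head Q \<alpha>) * M \<alpha>)"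
proof -
  have entry: "(N \<alpha> * coord_mat d d' c (tail Q \<alpha>)) $$ (i, j) = (\<Sum>k = 0..<d' (tail Q \<alpha>). N \<alpha> $$ (i, k) * c (tail Q \<alpha>, k, j))"
    "(coord_mat d d' c (head Q \<alpha>) * M \<alpha>) $$ (i, j) = (\<Sum>k = 0..<d (head Q \<alpha>). c (head Q \<alpha>, i, k) * M \<alpha> $$ (k, j))"
    if a: "\<alpha> \<in> arcs Q" and ij: "i < d' (head Q \<alpha>)" "j < d (tail Q \<alpha>)" for \<alpha> i j
    using carrier_matD[OF rep_variety_dim[OF M a]] carrier_matD[OF rep_variety_dim[OF N a]] ij
    by (simp_all add: coord_mat_def scalar_prod_def)
  show ?thesis
  proof
    assume L: "commutator d d' M N c = (\<lambda>_. 0)"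
    show "\<forall>\<alpha>\<in>arcs Q. N \<alpha> * coord_mat d d' c (tail Q \<alpha>) = coord_mat d d' c (head Q \<alpha>) * M \<alpha>"
    proof (intro ballI eq_matI)
      fix \<alpha> i j assume a: "\<alpha> \<in> arcs Q" and "i < dim_row (coord_mat d d' c (head Q \<alpha>) * M \<alpha>)"
        "j < dim_col (coord_mat d d' c (head Q \<alpha>) * M \<alpha>)"
      then have ij: "i < d' (head Q \<alpha>)" "j < d (tail Q \<alpha>)"
        using carrier_matD[OF rep_variety_dim[OF M a]] by (simp_all add: coord_mat_def)
      have "(\<alpha>, i, j) \<in> arrow_index d d'" using a ij by (simp add: arrow_index_def)
      then show "(N \<alpha> * coord_mat d d' c (tail Q \<alpha>)) $$ (i, j) = (coord_mat d d' c (head Q \<alpha>) * M \<alpha>) $$ (i, j)"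
        using fun_cong[OF L, of "(\<alpha>, i, j)"] unfolding entry[OF a ij] by (simp add: commutator_def)
    next
      fix \<alpha> assume a: "\<alpha> \<in> arcs Q"
      show "dim_row (N \<alpha> * coord_mat d d' c (tail Q \<alpha>)) = dim_row (coord_mat d d' c (head Q \<alpha>) * M \<alpha>)"
        "dim_col (N \<alpha> * coord_mat d d' c (tail Q \<alpha>)) = dim_col (coord_mat d d' c (head Q \<alpha>) * M \<alpha>)"
        using carrier_matD[OF rep_variety_dim[OF M a]] carrier_matD[OF rep_variety_dim[OF N a]]
        by (simp_all add: coord_mat_def)
    qed
  next
    assume R: "\<forall>\<alpha>\<in>arcs Q. N \<alpha> * coord_mat d d' c (tail Q \<alpha>) = coord_mat d d' c (head Q \<alpha>) * M \<alpha>"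
    show "commutator d d' M N c = (\<lambda>_. 0)"
    proof
      fix e :: "'a \<times> nat \<times> nat"
      obtain \<alpha> i j where e: "e = (\<alpha>, i, j)" by (cases e)
      show "commutator d d' M N c e = 0"
      proof (cases "e \<in> arrow_index d d'")
        case True
        then have a: "\<alpha> \<in> arcs Q" and ij: "i < d' (head Q \<alpha>)" "j < d (tail Q \<alpha>)" by (auto simp: e arrow_index_def)
        show ?thesis using entry[OF a ij] R a True by (simp add: commutator_def e)
      qed (simp add: commutator_def)
    qed
  qed
qed

definition matrix_hom :: "('v \<Rightarrow> nat) \<Rightarrow> ('v \<Rightarrow> nat) \<Rightarrow> ('a \<Rightarrow> 'k mat) \<Rightarrow> ('v \<times> nat \<times> nat \<Rightarrow> 'k) \<Rightarrow>
    ('v \<Rightarrow> 'k vec) \<Rightarrow> 'v \<Rightarrow> 'k vec" where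
  "matrix_hom d d' M c = (\<lambda>y\<in>carrier (rep_module Q d M). \<lambda>v\<in>verts Q. coord_mat d d' c v *\<^sub>v y v)"

text \<open>The inclusion of the space at \<open>v\<close> into the direct sum over all
  vertices.\<close>

definition unit_elem :: "('v \<Rightarrow> nat) \<Rightarrow> 'v \<Rightarrow> 'k vec \<Rightarrow> 'v \<Rightarrow> 'k vec" where
  "unit_elem d v z = (\<lambda>u\<in>verts Q. if u = v then z else 0\<^sub>v (d u))"

lemma unit_elem_carrier: "z \<in> carrier_vec (d v) \<Longrightarrow> unit_elem d v z \<in> carrier (rep_module Q d M)"
  unfolding rep_carrier unit_elem_def by (rule restrict_PiE_iff[THEN iffD2]) simp

text \<open>The vertex idempotents are the projections onto the summands, which forces homomorphisms
  to respect the decomposition over the vertices.\<close>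

lemma idem_action:
  assumes M: "M \<in> rep_variety Q I d" and y: "y \<in> carrier (rep_module Q d M)" and v: "v \<in> verts Q"
  shows "idem v \<odot>\<^bsub>rep_module Q d M\<^esub> y = unit_elem d v (y v)"
proof -
  have aw: "awalk v [] v" using v by (simp add: awalk_Nil_iff)
  have "idem v \<odot>\<^bsub>rep_module Q d M\<^esub> y = element_action Q d M (\<lambda>w. if w = (v, []) then 1 else 0) y"
    unfolding vertex_idempotent_def by (rule rep_module_smult[OF M path_in_carrier[OF trivial_path[OF v]]])
  also have "\<dots> = (\<lambda>u\<in>verts Q. if u = v then path_matrix Q d M v [] *\<^sub>v y v else 0\<^sub>v (d u))"
    by (rule element_action_path[OF rep_variety_dim[OF M] y aw])
  also have "path_matrix Q d M v [] *\<^sub>v y v = y v"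
    unfolding path_matrix.simps by (rule one_mult_mat_vec[OF rep_carrierD[OF y v]])
  finally show ?thesis unfolding unit_elem_def .
qed

lemma scalar_action:
  assumes M: "M \<in> rep_variety Q I d" and y: "y \<in> carrier (rep_module Q d M)"
  shows "sc c \<odot>\<^bsub>rep_module Q d M\<^esub> y = (\<lambda>v\<in>verts Q. c \<cdot>\<^sub>v y v)"
  unfolding scalar_def rep_module_smult[OF M scalar_one_in_carrier] by (rule element_action_scalar[OF y])

lemma matrix_hom_apply:
  "y \<in> carrier (rep_module Q d M) \<Longrightarrow> v \<in> verts Q \<Longrightarrow> matrix_hom d d' M c y v = coord_mat d d' c v *\<^sub>v y v"
  unfolding matrix_hom_def by (simp only: restrict_apply')

lemma coord_mat_mult_entry:
  assumes "z \<in> carrier_vec (d v)" "i < d' v"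
  shows "(coord_mat d d' c v *\<^sub>v z) $ i = (\<Sum>j = 0..<d v. c (v, i, j) * z $ j)"
  using assms by (simp add: coord_mat_def scalar_prod_def)

lemma mult_unit_vec_sum:
  assumes "j < n"
  shows "(\<Sum>k = 0..<n. f k * unit_vec n j $ k) = (f j :: 'k)"
proof -
  have "(\<Sum>k = 0..<n. f k * unit_vec n j $ k) = (\<Sum>k = 0..<n. if k = j then f k else 0)"
    by (rule sum.cong) (auto simp: unit_vec_def)
  then show ?thesis using assms by simp
qed

lemma matrix_hom_in_hom_space:
  assumes M: "M \<in> rep_variety Q I d" and N: "N \<in> rep_variety Q I d'" and c: "commutator d d' M N c = (\<lambda>_. 0)"
  shows "matrix_hom d d' M c \<in> carrier (hom_space Q I (rep_module Q d M) (rep_module Q d' N))"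
proof -
  have "\<And>\<alpha>. \<alpha> \<in> arcs Q \<Longrightarrow> N \<alpha> * coord_mat d d' c (tail Q \<alpha>) = coord_mat d d' c (head Q \<alpha>) * M \<alpha>"
    using c unfolding commutator_zero_iff[OF M N] by blast
  note F = module_homD[OF rep_matrix_hom[where H = "coord_mat d d' c", OF M N coord_mat_carrier this]]
  have "matrix_hom d d' M c \<in> module_hom \<Lambda> (rep_module Q d M) (rep_module Q d' N)"
    using F unfolding matrix_hom_def
    by (intro module_homI) (simp_all only: restrict_apply' rep_add_closed rep_smult_closed[OF M])
  then show ?thesis unfolding hom_space_simps by (simp only: matrix_hom_def restrict_extensional simp_thms)
qed

text \<open>Evaluation at unit vectors recovers every entry, whence different families of matrices
  give different homomorphisms.\<close>

lemma matrix_hom_unit: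
  assumes "v \<in> verts Q" "i < d' v" "j < d v"
  shows "matrix_hom d d' M c (unit_elem d v (unit_vec (d v) j)) v $ i = c (v, i, j)"
proof -
  have "matrix_hom d d' M c (unit_elem d v (unit_vec (d v) j)) v = coord_mat d d' c v *\<^sub>v unit_elem d v (unit_vec (d v) j) v"
    by (rule matrix_hom_apply[OF unit_elem_carrier assms(1)]) simp
  also have "unit_elem d v (unit_vec (d v) j) v = unit_vec (d v) j" using assms(1) by (simp add: unit_elem_def)
  finally show ?thesis
    using coord_mat_mult_entry[of "unit_vec (d v) j" d v i d' c, OF unit_vec_carrier assms(2)]
      mult_unit_vec_sum[OF assms(3), of "\<lambda>j. c (v, i, j)"] by simp
qed

text \<open>Commuting with the vertex idempotents splits \<open>f\<close> into components at the
  vertices, and commuting with the scalars makes each component linear, hence a matrix whose columns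
  are the images of unit vectors. That these matrices are compatible with the arrows is settled in
  \<open>hom_dim_rep\<close>.\<close>

lemma hom_eq_matrix_hom:
  assumes M: "M \<in> rep_variety Q I d" and N: "N \<in> rep_variety Q I d'"
    and f: "f \<in> module_hom \<Lambda> (rep_module Q d M) (rep_module Q d' N)"
    and c: "\<And>v i j. v \<in> verts Q \<Longrightarrow> i < d' v \<Longrightarrow> j < d v \<Longrightarrow>
      c (v, i, j) = f (unit_elem d v (unit_vec (d v) j)) v $ i"
    and y: "y \<in> carrier (rep_module Q d M)"
  shows "f y = matrix_hom d d' M c y"
proof (rule rep_ext)
  note f' = module_homD[OF f]
  show fy: "f y \<in> carrier (rep_module Q d' N)" by (rule f'(1)[OF y])
  show "matrix_hom d d' M c y \<in> carrier (rep_module Q d' N)"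
    unfolding matrix_hom_def restrict_apply'[OF y] unfolding rep_carrier
    by (rule restrict_PiE_iff[THEN iffD2]) (intro ballI mult_mat_vec_carrier[OF coord_mat_carrier] rep_carrierD[OF y])
  fix v assume v: "v \<in> verts Q"
  let ?e = "unit_elem d v"
  have add: "?e (z + z') = ?e z \<oplus>\<^bsub>rep_module Q d M\<^esub> ?e z'" if "z \<in> carrier_vec (d v)" "z' \<in> carrier_vec (d v)" for z z'
    unfolding rep_module_simps unit_elem_def by (rule restrict_ext) (simp only: restrict_apply' split: if_split, simp)
  have sm: "?e (a \<cdot>\<^sub>v z) = sc a \<odot>\<^bsub>rep_module Q d M\<^esub> ?e z" if z: "z \<in> carrier_vec (d v)" for a z
  proof (rule rep_ext[OF unit_elem_carrier rep_smult_closed[OF M scalar_in_carrier]])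
    have z0: "a \<cdot>\<^sub>v 0\<^sub>v n = (0\<^sub>v n :: 'k vec)" for n by (rule eq_vecI) simp_all
    fix u assume "u \<in> verts Q"
    then show "?e (a \<cdot>\<^sub>v z) u = (sc a \<odot>\<^bsub>rep_module Q d M\<^esub> ?e z) u"
      unfolding scalar_action[OF M unit_elem_carrier[of z d v M, OF z]] unfolding unit_elem_def
      by (simp only: restrict_apply') (cases "u = v", simp_all add: z0)
  qed (use z in simp)
  \<comment> \<open>Multiplying by the idempotent at \<open>v\<close> shows that the component of
    \<open>f y\<close> at \<open>v\<close> depends on the component of \<open>y\<close> at
    \<open>v\<close> alone.\<close>
  have "f y v = f (?e (y v)) v"
  proof -
    have "idem v \<odot>\<^bsub>rep_module Q d' N\<^esub> f y = f (?e (y v))"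
      using f'(3)[OF idem_in_carrier[OF v] y] idem_action[OF M y v] by simp
    then have "unit_elem d' v (f y v) = f (?e (y v))" using idem_action[OF N fy v] by simp
    moreover have "unit_elem d' v (f y v) v = f y v" using v by (simp add: unit_elem_def)
    ultimately show ?thesis by (simp only:)
  qed
  also have "\<dots> = coord_mat d d' c v *\<^sub>v y v"
  proof (rule eq_vecI)
    note yv = rep_carrierD[OF y v]
    fix i assume "i < dim_vec (coord_mat d d' c v *\<^sub>v y v)"
    then have i: "i < d' v" by (simp add: coord_mat_def)
    have dfe: "dim_vec (f (?e z) v) = d' v" if "z \<in> carrier_vec (d v)" for z
      by (rule carrier_vecD[OF rep_carrierD[OF f'(1)[OF unit_elem_carrier[of _ d v M, OF that]] v]])
    have "f (?e (y v)) v $ i = (\<Sum>j<d v. y v $ j * f (?e (unit_vec (d v) j)) v $ i)"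
    proof (rule vec_linear_form[where l = "\<lambda>z. f (unit_elem d v z) v $ i", OF _ _ yv])
      fix z z' :: "'k vec" assume z: "z \<in> carrier_vec (d v)" "z' \<in> carrier_vec (d v)"
      have "f (?e (z + z')) = f (?e z) \<oplus>\<^bsub>rep_module Q d' N\<^esub> f (?e z')"
        unfolding add[OF z] by (rule f'(2)[OF unit_elem_carrier[of z d v M, OF z(1)] unit_elem_carrier[of z' d v M, OF z(2)]])
      then have "f (?e (z + z')) v = f (?e z) v + f (?e z') v"
        unfolding rep_module_simps using v by (simp only: restrict_apply')
      then show "f (?e (z + z')) v $ i = f (?e z) v $ i + f (?e z') v $ i"
        using i dfe[OF z(2)] by (simp only: index_add_vec)
    next
      fix a and z :: "'k vec" assume z: "z \<in> carrier_vec (d v)"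
      have "f (?e (a \<cdot>\<^sub>v z)) = sc a \<odot>\<^bsub>rep_module Q d' N\<^esub> f (?e z)"
        unfolding sm[OF z] by (rule f'(3)[OF scalar_in_carrier unit_elem_carrier[of z d v M, OF z]])
      also have "\<dots> = (\<lambda>v\<in>verts Q. a \<cdot>\<^sub>v f (?e z) v)"
        by (rule scalar_action[OF N f'(1)[OF unit_elem_carrier[of z d v M, OF z]]])
      finally have "f (?e (a \<cdot>\<^sub>v z)) v = a \<cdot>\<^sub>v f (?e z) v" using v by (simp only: restrict_apply')
      then show "f (?e (a \<cdot>\<^sub>v z)) v $ i = a * f (?e z) v $ i"
        using i dfe[OF z] by (simp only: index_smult_vec)
    qed
    also have "\<dots> = (\<Sum>j = 0..<d v. c (v, i, j) * y v $ j)"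
      unfolding lessThan_atLeast0 by (rule sum.cong[OF refl]) (simp add: c[OF v i] mult.commute)
    also have "\<dots> = (coord_mat d d' c v *\<^sub>v y v) $ i" by (rule coord_mat_mult_entry[of "y v" d v i d' c, OF yv i, symmetric])
    finally show "f (?e (y v)) v $ i = (coord_mat d d' c v *\<^sub>v y v) $ i" .
  next
    show "dim_vec (f (?e (y v)) v) = dim_vec (coord_mat d d' c v *\<^sub>v y v)"
      using carrier_vecD[OF rep_carrierD[OF f'(1)[OF unit_elem_carrier[of "y v" d v M, OF rep_carrierD[OF y v]]] v]]
      by (simp add: coord_mat_def)
  qed
  also have "\<dots> = matrix_hom d d' M c y v" by (rule matrix_hom_apply[OF y v, symmetric])
  finally show "f y v = matrix_hom d d' M c y v" .
qed

text \<open>Rank-nullity for the commutator, whose kernel is in bijection with the homomorphisms;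
  the Hom space receives its vector space structure through this bijection. The right-hand side
  depends on the dimension vectors only, so lower semicontinuity of the rank becomes upper
  semicontinuity of the Hom dimension.\<close>

theorem hom_dim_rep:
  assumes M: "M \<in> rep_variety Q I d" and N: "N \<in> rep_variety Q I d'"
  shows "vdim ((coord_space (arrow_index d d'))\<lparr>carrier :=
      commutator d d' M N ` carrier (coord_space (hom_index d d'))\<rparr>) +
    hom_dim Q I (rep_module Q d M) (rep_module Q d' N) = card (hom_index d d')"
proof -
  let ?W = "coord_space (hom_index d d') :: ('k, 'v \<times> nat \<times> nat \<Rightarrow> 'k) module"
  let ?V = "coord_space (arrow_index d d') :: ('k, 'a \<times> nat \<times> nat \<Rightarrow> 'k) module"
  let ?T = "commutator d d' M N" and ?H = "hom_space Q I (rep_module Q d M) (rep_module Q d' N)"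
  define K where "K = {c \<in> carrier ?W. ?T c = \<zero>\<^bsub>?V\<^esub>}"
  have W: "fdvs ?W" "vdim ?W = card (hom_index d d')" by (simp_all add: vdim_coord_space)
  have "lin ?W (?V\<lparr>carrier := ?T ` carrier ?W\<rparr>) ?T" using lin_commutator[of d d' M N] by (auto simp: lin_def)
  from fdvs_surj(2)[OF W(1) this]
  have rn: "card (hom_index d d') = vdim (?V\<lparr>carrier := ?T ` carrier ?W\<rparr>) + vdim (?W\<lparr>carrier := K\<rparr>)"
    by (simp add: W(2) K_def)
  have K: "fdvs (?W\<lparr>carrier := K\<rparr>)"
    unfolding K_def
    by (rule fdvs_subset(1)[OF W(1) lin_kernel[OF closed_ops_coord_space lin_commutator vectorspace_coord_space]]) blast
  have K0: "?T c = (\<lambda>_. 0)" if "c \<in> K" for c using that by (simp add: K_def coord_space_simps)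
  let ?F = "matrix_hom d d' M"
  have mat: "coord_mat d d' (\<lambda>i. a i + b i) v *\<^sub>v z = coord_mat d d' a v *\<^sub>v z + coord_mat d d' b v *\<^sub>v z"
    "coord_mat d d' (\<lambda>i. x * a i) v *\<^sub>v z = x \<cdot>\<^sub>v (coord_mat d d' a v *\<^sub>v z)" if z: "z \<in> carrier_vec (d v)" for a b x v z
  proof -
    note e = coord_mat_mult_entry[of z d v _ d', OF z]
    show "coord_mat d d' (\<lambda>i. a i + b i) v *\<^sub>v z = coord_mat d d' a v *\<^sub>v z + coord_mat d d' b v *\<^sub>v z"
    proof (rule eq_vecI)
      fix i assume "i < dim_vec (coord_mat d d' a v *\<^sub>v z + coord_mat d d' b v *\<^sub>v z)"
      then have i: "i < d' v" by (simp add: coord_mat_def)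
      then have "i < dim_vec (coord_mat d d' b v *\<^sub>v z)" by (simp add: coord_mat_def)
      then show "(coord_mat d d' (\<lambda>i. a i + b i) v *\<^sub>v z) $ i = (coord_mat d d' a v *\<^sub>v z + coord_mat d d' b v *\<^sub>v z) $ i"
        by (simp only: index_add_vec e[OF i] distrib_right sum.distrib)
    qed (simp add: coord_mat_def)
    show "coord_mat d d' (\<lambda>i. x * a i) v *\<^sub>v z = x \<cdot>\<^sub>v (coord_mat d d' a v *\<^sub>v z)"
    proof (rule eq_vecI)
      fix i assume "i < dim_vec (x \<cdot>\<^sub>v (coord_mat d d' a v *\<^sub>v z))"
      then have i: "i < d' v" by (simp add: coord_mat_def)
      then have "i < dim_vec (coord_mat d d' a v *\<^sub>v z)" by (simp add: coord_mat_def)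
      then show "(coord_mat d d' (\<lambda>i. x * a i) v *\<^sub>v z) $ i = (x \<cdot>\<^sub>v (coord_mat d d' a v *\<^sub>v z)) $ i"
        by (simp only: index_smult_vec e[OF i] sum_distrib_left mult.assoc)
    qed (simp add: coord_mat_def)
  qed
  have F: "lin (?W\<lparr>carrier := K\<rparr>) ?H ?F"
  proof (rule linI)
    show "?F c \<in> carrier ?H" if "c \<in> carrier (?W\<lparr>carrier := K\<rparr>)" for c
      by (rule matrix_hom_in_hom_space[OF M N K0]) (use that in simp)
    have z: "coord_mat d d' (\<lambda>_. 0) v *\<^sub>v z = 0\<^sub>v (d' v)" if "z \<in> carrier_vec (d v)" for v z
    proof (rule eq_vecI)
      fix i assume "i < dim_vec (0\<^sub>v (d' v))"
      then have i: "i < d' v" by simp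
      show "(coord_mat d d' (\<lambda>_. 0) v *\<^sub>v z) $ i = 0\<^sub>v (d' v) $ i"
        using coord_mat_mult_entry[of z d v i d' "\<lambda>_. 0", OF that i] i by simp
    qed (simp add: coord_mat_def)
    show "?F \<zero>\<^bsub>?W\<lparr>carrier := K\<rparr>\<^esub> = \<zero>\<^bsub>?H\<^esub>"
      unfolding matrix_hom_def hom_space_simps rep_module_simps
    proof (intro restrict_ext)
      fix y v assume "y \<in> carrier (rep_module Q d M)" "v \<in> verts Q"
      from z[OF rep_carrierD[OF this]]
      show "coord_mat d d' \<zero>\<^bsub>?W\<lparr>carrier := K\<rparr>\<^esub> v *\<^sub>v y v = 0\<^sub>v (d' v)" by (simp add: coord_space_simps)
    qed
    show "?F (a \<oplus>\<^bsub>?W\<lparr>carrier := K\<rparr>\<^esub> b) = ?F a \<oplus>\<^bsub>?H\<^esub> ?F b" for a b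
      unfolding hom_space_simps
    proof (rule extensionalityI[where A = "carrier (rep_module Q d M)"])
      fix y assume y: "y \<in> carrier (rep_module Q d M)"
      have "?F (a \<oplus>\<^bsub>?W\<lparr>carrier := K\<rparr>\<^esub> b) y = ?F a y \<oplus>\<^bsub>rep_module Q d' N\<^esub> ?F b y"
        unfolding matrix_hom_def restrict_apply'[OF y] rep_module_simps
      proof (rule restrict_ext)
        fix v assume v: "v \<in> verts Q"
        show "coord_mat d d' (a \<oplus>\<^bsub>?W\<lparr>carrier := K\<rparr>\<^esub> b) v *\<^sub>v y v =
          (\<lambda>v\<in>verts Q. coord_mat d d' a v *\<^sub>v y v) v + (\<lambda>v\<in>verts Q. coord_mat d d' b v *\<^sub>v y v) v"
          using mat(1)[OF rep_carrierD[OF y v], of a b] v by (simp only: restrict_apply') (simp add: coord_space_simps)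
      qed
      then show "?F (a \<oplus>\<^bsub>?W\<lparr>carrier := K\<rparr>\<^esub> b) y =
        (\<lambda>x\<in>carrier (rep_module Q d M). ?F a x \<oplus>\<^bsub>rep_module Q d' N\<^esub> ?F b x) y"
        unfolding restrict_apply'[OF y] .
    qed (simp_all only: matrix_hom_def restrict_extensional)
    show "?F (x \<odot>\<^bsub>?W\<lparr>carrier := K\<rparr>\<^esub> a) = x \<odot>\<^bsub>?H\<^esub> ?F a" if a: "a \<in> carrier (?W\<lparr>carrier := K\<rparr>)" for x a
      unfolding hom_space_simps
    proof (rule extensionalityI[where A = "carrier (rep_module Q d M)"])
      fix y assume y: "y \<in> carrier (rep_module Q d M)"
      have "a \<in> K" using a by simp
      then have Fa: "?F a y \<in> carrier (rep_module Q d' N)"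
        using matrix_hom_in_hom_space[OF M N K0] y unfolding hom_space_simps by (blast dest: module_homD(1))
      have "?F (x \<odot>\<^bsub>?W\<lparr>carrier := K\<rparr>\<^esub> a) y = sc x \<odot>\<^bsub>rep_module Q d' N\<^esub> ?F a y"
        unfolding scalar_action[OF N Fa] unfolding matrix_hom_def restrict_apply'[OF y]
      proof (rule restrict_ext)
        fix v assume v: "v \<in> verts Q"
        show "coord_mat d d' (x \<odot>\<^bsub>?W\<lparr>carrier := K\<rparr>\<^esub> a) v *\<^sub>v y v =
          x \<cdot>\<^sub>v (\<lambda>v\<in>verts Q. coord_mat d d' a v *\<^sub>v y v) v"
          using mat(2)[OF rep_carrierD[OF y v], of x a] v by (simp only: restrict_apply') (simp add: coord_space_simps)
      qed
      then show "?F (x \<odot>\<^bsub>?W\<lparr>carrier := K\<rparr>\<^esub> a) y =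
        (\<lambda>y\<in>carrier (rep_module Q d M). sc x \<odot>\<^bsub>rep_module Q d' N\<^esub> ?F a y) y"
        unfolding restrict_apply'[OF y] .
    qed (simp_all only: matrix_hom_def restrict_extensional)
  qed
  have bij: "bij_betw ?F K (carrier ?H)"
  proof (rule bij_betw_imageI)
    show "inj_on ?F K"
    proof (rule inj_onI, rule ext)
      fix a b and e :: "'v \<times> nat \<times> nat" assume ab: "a \<in> K" "b \<in> K" "?F a = ?F b"
      obtain v i j where e: "e = (v, i, j)" by (cases e)
      show "a e = b e"
      proof (cases "e \<in> hom_index d d'")
        case True
        then have ij: "v \<in> verts Q" "i < d' v" "j < d v" by (auto simp: e hom_index_def)
        show ?thesis
          using matrix_hom_unit[of v i d' j d M a, OF ij] matrix_hom_unit[of v i d' j d M b, OF ij] ab(3)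
          unfolding e by simp
      next
        case False
        then show ?thesis using ab(1,2) unfolding e by (simp add: K_def coord_space_simps)
      qed
    qed
    have "f \<in> ?F ` K" if f: "f \<in> carrier ?H" for f
    proof -
      \<comment> \<open>The matrix entries of \<open>f\<close>, read off on unit vectors. The value
        zero off the index set is what membership in the coordinate space demands.\<close>
      define c where "c e = (if e \<in> hom_index d d' then (case e of (v, i, j) \<Rightarrow>
        f (unit_elem d v (unit_vec (d v) j)) v $ i) else 0)" for e
      have f': "f \<in> module_hom \<Lambda> (rep_module Q d M) (rep_module Q d' N)" "f \<in> extensional (carrier (rep_module Q d M))"
        using f unfolding hom_space_simps by blast+
      have eq: "f y = ?F c y" if "y \<in> carrier (rep_module Q d M)" for y
        by (rule hom_eq_matrix_hom[OF M N f'(1) _ that]) (simp add: c_def hom_index_def)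
      have "?F c \<in> extensional (carrier (rep_module Q d M))" by (simp only: matrix_hom_def restrict_extensional)
      then have fc: "f = ?F c" by (rule extensionalityI[OF f'(2)]) (rule eq)
      \<comment> \<open>Let the class of the arrow act on the j-th unit vector at its tail and apply
        \<open>f\<close>. Computing the component at the head by letting the arrow act before or
        after \<open>f\<close> shows that the two products have the same j-th column.\<close>
      have "N \<alpha> * coord_mat d d' c (tail Q \<alpha>) = coord_mat d d' c (head Q \<alpha>) * M \<alpha>" if a: "\<alpha> \<in> arcs Q" for \<alpha>
      proof (rule eq_matI)
        let ?t = "tail Q \<alpha>" and ?h = "head Q \<alpha>"
        have vt: "?t \<in> verts Q" "?h \<in> verts Q" using a by simp_all
        note Ma = rep_variety_dim[OF M a] and Na = rep_variety_dim[OF N a]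
        fix i j assume "i < dim_row (coord_mat d d' c ?h * M \<alpha>)" "j < dim_col (coord_mat d d' c ?h * M \<alpha>)"
        then have i: "i < d' ?h" and j: "j < d ?t" using carrier_matD[OF Ma] by (simp_all add: coord_mat_def)
        have aw: "awalk ?t [\<alpha>] ?h" using a by (simp add: awalk_def)
        let ?y = "unit_elem d ?t (unit_vec (d ?t) j)" and ?x = "\<lambda>w. if w = (?t, [\<alpha>]) then 1 else 0 :: 'k"
        have y: "?y \<in> carrier (rep_module Q d M)" by (rule unit_elem_carrier) simp
        have yt: "?y ?t = unit_vec (d ?t) j" using vt by (simp add: unit_elem_def)
        have P: "?x \<in> carrier pathring" by (rule path_in_carrier) (use aw in \<open>auto simp: paths_def\<close>)
        have act: "(cls ?x \<odot>\<^bsub>rep_module Q e L\<^esub> z) ?h = L \<alpha> *\<^sub>v z ?t"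
          if L: "L \<in> rep_variety Q I e" and z: "z \<in> carrier (rep_module Q e L)" for e L z
        proof -
          have "cls ?x \<odot>\<^bsub>rep_module Q e L\<^esub> z =
            (\<lambda>v\<in>verts Q. if v = ?h then path_matrix Q e L ?t [\<alpha>] *\<^sub>v z ?t else 0\<^sub>v (e v))"
            unfolding rep_module_smult[OF L P] by (rule element_action_path[OF rep_variety_dim[OF L] z aw])
          moreover have "path_matrix Q e L ?t [\<alpha>] = L \<alpha>"
            unfolding path_matrix.simps by (rule left_mult_one_mat[OF rep_variety_dim[OF L a]])
          ultimately show ?thesis using vt by simp
        qed
        have fy: "f ?y \<in> carrier (rep_module Q d' N)" by (rule module_homD(1)[OF f'(1) y])
        have cx: "cls ?x \<in> carrier \<Lambda>" by (rule cls_hom(1)[OF P P])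
        have fyv: "f z v = coord_mat d d' c v *\<^sub>v z v" if "z \<in> carrier (rep_module Q d M)" "v \<in> verts Q" for z v
          unfolding fc by (rule matrix_hom_apply[OF that])
        have "f (cls ?x \<odot>\<^bsub>rep_module Q d M\<^esub> ?y) ?h = N \<alpha> *\<^sub>v f ?y ?t"
          unfolding module_homD(3)[OF f'(1) cx y] by (rule act[OF N fy])
        moreover have "f (cls ?x \<odot>\<^bsub>rep_module Q d M\<^esub> ?y) ?h = coord_mat d d' c ?h *\<^sub>v (M \<alpha> *\<^sub>v unit_vec (d ?t) j)"
          unfolding fyv[OF rep_smult_closed[OF M cx] vt(2)] act[OF M y] yt ..
        moreover have "f ?y ?t = coord_mat d d' c ?t *\<^sub>v unit_vec (d ?t) j"
          unfolding fyv[OF y vt(1)] yt ..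
        ultimately have "N \<alpha> *\<^sub>v (coord_mat d d' c ?t *\<^sub>v unit_vec (d ?t) j) =
          coord_mat d d' c ?h *\<^sub>v (M \<alpha> *\<^sub>v unit_vec (d ?t) j)" by metis
        then have eq: "(N \<alpha> * coord_mat d d' c ?t) *\<^sub>v unit_vec (d ?t) j = (coord_mat d d' c ?h * M \<alpha>) *\<^sub>v unit_vec (d ?t) j"
          unfolding assoc_mult_mat_vec[OF Na coord_mat_carrier[of d d' c ?t] unit_vec_carrier[of "d ?t" j]]
            assoc_mult_mat_vec[OF coord_mat_carrier[of d d' c ?h] Ma unit_vec_carrier[of "d ?t" j]] .
        have col: "(A *\<^sub>v unit_vec (d ?t) j) $ i = A $$ (i, j)" if "A \<in> carrier_mat (d' ?h) (d ?t)" for A :: "'k mat"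
        proof -
          have "(A *\<^sub>v unit_vec (d ?t) j) $ i = (\<Sum>k = 0..<d ?t. A $$ (i, k) * unit_vec (d ?t) j $ k)"
            using i carrier_matD[OF that]
            by (simp add: scalar_prod_def del: index_unit_vec, intro sum.cong) simp_all
          then show ?thesis using mult_unit_vec_sum[OF j, of "\<lambda>k. A $$ (i, k)"] by (simp only:)
        qed
        show "(N \<alpha> * coord_mat d d' c ?t) $$ (i, j) = (coord_mat d d' c ?h * M \<alpha>) $$ (i, j)"
          using col[OF mult_carrier_mat[OF Na coord_mat_carrier[of d d' c ?t]]] col[OF mult_carrier_mat[OF coord_mat_carrier[of d d' c ?h] Ma]] eq
          by (simp only:)
      next
        show "dim_row (N \<alpha> * coord_mat d d' c (tail Q \<alpha>)) = dim_row (coord_mat d d' c (head Q \<alpha>) * M \<alpha>)"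
          "dim_col (N \<alpha> * coord_mat d d' c (tail Q \<alpha>)) = dim_col (coord_mat d d' c (head Q \<alpha>) * M \<alpha>)"
          using carrier_matD[OF rep_variety_dim[OF M a]] carrier_matD[OF rep_variety_dim[OF N a]]
          by (simp_all add: coord_mat_def)
      qed
      then have "?T c = (\<lambda>_. 0)" unfolding commutator_zero_iff[OF M N] by blast
      then have "c \<in> K" by (simp add: K_def coord_space_simps c_def)
      then show ?thesis using fc by blast
    qed
    moreover have "?F ` K \<subseteq> carrier ?H" using linD(1)[OF F] by auto
    ultimately show "?F ` K = carrier ?H" by blast
  qed
  have "vdim ?H = vdim (?W\<lparr>carrier := K\<rparr>)" by (rule vdim_bij[OF K F]) (use bij in simp)
  then show ?thesis using rn by (simp add: hom_dim_def)
qed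

end

text \<open>Rank-nullity for the projection onto the quotient, whose kernel is N. Closure under
  multiplication by -1 makes N a subgroup.\<close>

lemma vdim_quot_module:
  fixes V :: "('k::field, 'm) module"
  assumes V: "fdvs V" and N: "closed_ops (V\<lparr>carrier := N\<rparr>)" "N \<subseteq> carrier V"
  shows "vdim (quot_module V N) + vdim (V\<lparr>carrier := N\<rparr>) = vdim V"
proof -
  have vs: "vectorspace class_ring V" using V by (simp add: fdvs_def)
  interpret V: vectorspace class_ring V by (fact vs)
  note D = vectorspaceD[OF vs] and C = closed_opsD[OF vectorspaceD(1)[OF vs]]
  note N' = closed_opsD[OF N(1), simplified]
  have ag: "abelian_group V" by (rule V.M.abelian_group_axioms)
  have neg: "\<forall>x\<in>N. \<ominus>\<^bsub>V\<^esub> x \<in> N"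
  proof
    fix x assume x: "x \<in> N"
    have xV: "x \<in> carrier V" using x N(2) by blast
    have "\<ominus>\<^bsub>V\<^esub> x = (-1) \<odot>\<^bsub>V\<^esub> x"
      by (rule V.M.minus_equality) (use D(6)[OF xV] xV C(3)[OF xV] in auto)
    then show "\<ominus>\<^bsub>V\<^esub> x \<in> N" using N'(3)[OF x, of "-1"] by simp
  qed
  have "\<forall>x\<in>N. \<forall>y\<in>N. x \<oplus>\<^bsub>V\<^esub> y \<in> N" using N'(2) by blast
  note q = quot_module_props[OF ag N(2) N'(1) this neg]
  let ?q = "\<lambda>x. N +>\<^bsub>V\<^esub> x"
  have l: "lin V (quot_module V N) ?q"
  proof (rule linI)
    show "?q x \<in> carrier (quot_module V N)" if "x \<in> carrier V" for x using that q(1) by auto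
    show "?q \<zero>\<^bsub>V\<^esub> = \<zero>\<^bsub>quot_module V N\<^esub>" using q(3)[OF C(1)] N'(1) by simp
    show "?q (x \<oplus>\<^bsub>V\<^esub> y) = ?q x \<oplus>\<^bsub>quot_module V N\<^esub> ?q y" if "x \<in> carrier V" "y \<in> carrier V" for x y
      using q(2)[OF that] by simp
    show "?q (c \<odot>\<^bsub>V\<^esub> x) = c \<odot>\<^bsub>quot_module V N\<^esub> ?q x" if "x \<in> carrier V" for c x
      by (rule q(4)[symmetric]) (use C(3) N'(3) D(8) that in simp_all)
  qed
  have "{x \<in> carrier V. ?q x = \<zero>\<^bsub>quot_module V N\<^esub>} = N" using q(3) N(2) by auto
  then show ?thesis using fdvs_surj(2)[OF V l q(1)[symmetric]] by simp
qed

context bound_quiver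
begin

section \<open>Homomorphisms out of a cokernel\<close>

text \<open>Three maps are composed: the projection of P0 onto the cokernel, the inverse of the
  isomorphism between \<open>\<phi> a\<close> and the cokernel, and the base change leading from
  \<open>\<phi> a\<close> to M within its orbit. The last two are bijective, so the kernel remains
  the image of \<open>a\<close>.\<close>

lemma presentation:
  assumes gc: "generic_cokernel Q I g d U \<phi>" and a: "a \<in> U" and M: "M \<in> orbit Q I d (\<phi> a)"
  shows "\<exists>p\<in>module_hom \<Lambda> (proj Q I (pos_mult g)) (rep_module Q d M).
    p ` carrier (proj Q I (pos_mult g)) = carrier (rep_module Q d M) \<and>
    (\<forall>x\<in>carrier (proj Q I (pos_mult g)).
      p x = \<zero>\<^bsub>rep_module Q d M\<^esub> \<longleftrightarrow> x \<in> a ` carrier (proj Q I (neg_mult g)))"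
proof -
  let ?P0 = "proj Q I (pos_mult g)" and ?P1 = "proj Q I (neg_mult g)"
  let ?A = "a ` carrier ?P1"
  have "openin (presentation_topology Q I g) U" using gc by (simp add: generic_cokernel_def)
  from openin_subset[OF this] have "U \<subseteq> carrier (presentation_space Q I g)"
    by (simp add: presentation_topology_def topspace_zariski)
  then have ahom: "a \<in> module_hom \<Lambda> ?P1 ?P0"
    using a by (auto simp: presentation_space_def hom_space_simps)
  note ah = module_homD[OF ahom]
  note L0 = left_module_proj[of "pos_mult g"] and L1 = left_module_proj[of "neg_mult g"]
  note D0 = left_moduleD[OF L0] and D1 = left_moduleD[OF L1]
  interpret P0: abelian_group ?P0 by (fact D0(2))
  interpret P1: abelian_group ?P1 by (fact D1(2))
  have a0: "a \<zero>\<^bsub>?P1\<^esub> = \<zero>\<^bsub>?P0\<^esub>" by (rule module_hom_zero[OF ahom L1 D0(2)])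
  have A: "?A \<subseteq> carrier ?P0" using ah(1) by blast
  have A0: "\<zero>\<^bsub>?P0\<^esub> \<in> ?A" using a0 D1(9) by (metis imageI)
  have Aadd: "\<forall>x\<in>?A. \<forall>y\<in>?A. x \<oplus>\<^bsub>?P0\<^esub> y \<in> ?A"
  proof (intro ballI, elim imageE, hypsubst)
    fix x y assume xy: "x \<in> carrier ?P1" "y \<in> carrier ?P1"
    show "a x \<oplus>\<^bsub>?P0\<^esub> a y \<in> ?A" unfolding ah(2)[OF xy, symmetric] by (rule imageI[OF D1(8)[OF xy]])
  qed
  have Aneg: "\<forall>x\<in>?A. \<ominus>\<^bsub>?P0\<^esub> x \<in> ?A"
  proof
    fix x assume x: "x \<in> ?A"
    obtain y where y: "y \<in> carrier ?P1" "x = a y" using x by blast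
    have "a (\<ominus>\<^bsub>?P1\<^esub> y) \<oplus>\<^bsub>?P0\<^esub> a y = \<zero>\<^bsub>?P0\<^esub>"
      using ah(2)[of "\<ominus>\<^bsub>?P1\<^esub> y" y] y(1) a0 P1.l_neg[OF y(1)] by simp
    then have "\<ominus>\<^bsub>?P0\<^esub> x = a (\<ominus>\<^bsub>?P1\<^esub> y)"
      using y ah(1) by (intro P0.minus_equality) simp_all
    then show "\<ominus>\<^bsub>?P0\<^esub> x \<in> ?A" using y(1) by simp
  qed
  have Asm: "\<forall>x\<in>?A. r \<odot>\<^bsub>?P0\<^esub> x \<in> ?A" if r: "r \<in> carrier \<Lambda>" for r
  proof (intro ballI, elim imageE, hypsubst)
    fix x assume x: "x \<in> carrier ?P1"
    show "r \<odot>\<^bsub>?P0\<^esub> a x \<in> ?A" unfolding ah(3)[OF r x, symmetric] by (rule imageI[OF D1(3)[OF r x]])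
  qed
  note q = quot_module_props[OF D0(2) A A0 Aadd Aneg]
  let ?C = "cokernel Q I g a" and ?q = "\<lambda>x. ?A +>\<^bsub>?P0\<^esub> x"
  have C: "?C = quot_module ?P0 ?A" by (simp add: cokernel_def)
  have qhom: "?q \<in> module_hom \<Lambda> ?P0 ?C" unfolding C
  proof (rule module_homI)
    show "?q x \<in> carrier (quot_module ?P0 ?A)" if "x \<in> carrier ?P0" for x using that q(1) by blast
    show "?q (x \<oplus>\<^bsub>?P0\<^esub> y) = ?q x \<oplus>\<^bsub>quot_module ?P0 ?A\<^esub> ?q y" if "x \<in> carrier ?P0" "y \<in> carrier ?P0" for x y
      by (rule q(2)[OF that, symmetric])
    show "?q (r \<odot>\<^bsub>?P0\<^esub> x) = r \<odot>\<^bsub>quot_module ?P0 ?A\<^esub> ?q x" if "r \<in> carrier \<Lambda>" "x \<in> carrier ?P0" for r x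
    proof (rule q(4)[symmetric, OF _ Asm[OF that(1)] _ that(2)]; intro ballI)
      show "r \<odot>\<^bsub>?P0\<^esub> x \<in> carrier ?P0" if "x \<in> carrier ?P0" for x by (rule D0(3)[OF \<open>r \<in> carrier \<Lambda>\<close> that])
      show "r \<odot>\<^bsub>?P0\<^esub> (x \<oplus>\<^bsub>?P0\<^esub> y) = r \<odot>\<^bsub>?P0\<^esub> x \<oplus>\<^bsub>?P0\<^esub> r \<odot>\<^bsub>?P0\<^esub> y"
        if "x \<in> carrier ?P0" "y \<in> carrier ?P0" for x y by (rule D0(5)[OF \<open>r \<in> carrier \<Lambda>\<close> that])
    qed
  qed
  have qsurj: "?q ` carrier ?P0 = carrier ?C" unfolding C by (rule q(1)[symmetric])
  have q0: "?q x = \<zero>\<^bsub>?C\<^esub> \<longleftrightarrow> x \<in> ?A" if "x \<in> carrier ?P0" for x unfolding C by (rule q(3)[OF that])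
  \<comment> \<open>The group structure of the cokernel is what later shows that the isomorphism
    \<open>f\<close> preserves zero.\<close>
  have LC: "left_module \<Lambda> ?C"
    by (rule left_module_surj[OF L0 qhom qsurj]) (use q0[OF D0(9)] A0 in blast)
  let ?R = "rep_module Q d (\<phi> a)"
  have \<phi>: "\<phi> a \<in> rep_variety Q I d" and iso: "module_iso Q I ?R ?C"
    using gc a by (auto simp: generic_cokernel_def)
  obtain f where f: "f \<in> module_hom \<Lambda> ?R ?C" and bij: "bij_betw f (carrier ?R) (carrier ?C)"
    using iso by (auto simp: module_iso_def)
  note fh = module_homD[OF f]
  have inj: "inj_on f (carrier ?R)" and fsurj: "f ` carrier ?R = carrier ?C" using bij by (auto simp: bij_betw_def)
  have R0: "\<zero>\<^bsub>?R\<^esub> \<in> carrier ?R" unfolding rep_module_simps rep_carrier by (rule restrict_PiE_iff[THEN iffD2]) simp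
  \<comment> \<open>At this point \<open>rep_module\<close> is not known to be a group, so the sum
    is computed entrywise.\<close>
  have R00: "\<zero>\<^bsub>?R\<^esub> \<oplus>\<^bsub>?R\<^esub> \<zero>\<^bsub>?R\<^esub> = \<zero>\<^bsub>?R\<^esub>"
    unfolding rep_module_simps by (rule restrict_ext) simp
  have f0: "f \<zero>\<^bsub>?R\<^esub> = \<zero>\<^bsub>?C\<^esub>"
    by (rule abelian_group_zero_unique[OF left_moduleD(2)[OF LC] fh(1)[OF R0]]) (use fh(2)[OF R0 R0] R00 in simp)
  define F where "F = inv_into (carrier ?R) f"
  have F: "F c \<in> carrier ?R" "f (F c) = c" if "c \<in> carrier ?C" for c
    using that unfolding F_def fsurj[symmetric] by (rule inv_into_into, rule f_inv_into_f)
  let ?r = "\<lambda>x. F (?q x)"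
  have rR: "?r x \<in> carrier ?R" and fr: "f (?r x) = ?q x" if "x \<in> carrier ?P0" for x
    using F[OF module_homD(1)[OF qhom that]] by blast+
  have rhom: "?r \<in> module_hom \<Lambda> ?P0 ?R"
  proof (rule module_homI)
    fix x assume x: "x \<in> carrier ?P0"
    show "?r x \<in> carrier ?R" by (rule rR[OF x])
    fix y assume y: "y \<in> carrier ?P0"
    show "?r (x \<oplus>\<^bsub>?P0\<^esub> y) = ?r x \<oplus>\<^bsub>?R\<^esub> ?r y"
    proof (rule inj_onD[OF inj])
      show "f (?r (x \<oplus>\<^bsub>?P0\<^esub> y)) = f (?r x \<oplus>\<^bsub>?R\<^esub> ?r y)"
        unfolding fr[OF D0(8)[OF x y]] fh(2)[OF rR[OF x] rR[OF y]] fr[OF x] fr[OF y]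
        by (rule module_homD(2)[OF qhom x y])
    qed (rule rR[OF D0(8)[OF x y]], rule rep_add_closed[OF rR[OF x] rR[OF y]])
  next
    fix s x assume s: "s \<in> carrier \<Lambda>" and x: "x \<in> carrier ?P0"
    show "?r (s \<odot>\<^bsub>?P0\<^esub> x) = s \<odot>\<^bsub>?R\<^esub> ?r x"
    proof (rule inj_onD[OF inj])
      show "f (?r (s \<odot>\<^bsub>?P0\<^esub> x)) = f (s \<odot>\<^bsub>?R\<^esub> ?r x)"
        unfolding fr[OF D0(3)[OF s x]] fh(3)[OF s rR[OF x]] fr[OF x] by (rule module_homD(3)[OF qhom s x])
    qed (rule rR[OF D0(3)[OF s x]], rule rep_smult_closed[OF \<phi> s])
  qed
  have rsurj: "?r ` carrier ?P0 = carrier ?R"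
  proof
    show "carrier ?R \<subseteq> ?r ` carrier ?P0"
    proof
      fix y assume y: "y \<in> carrier ?R"
      then have "f y \<in> ?q ` carrier ?P0" unfolding qsurj by (rule fh(1))
      then obtain x where x: "x \<in> carrier ?P0" "f y = ?q x" by blast
      have "?r x = y" by (rule inj_onD[OF inj _ rR[OF x(1)] y]) (simp only: fr[OF x(1)] x(2))
      then show "y \<in> ?r ` carrier ?P0" using x(1) by blast
    qed
  qed (use rR in blast)
  have r0: "?r x = \<zero>\<^bsub>?R\<^esub> \<longleftrightarrow> x \<in> ?A" if x: "x \<in> carrier ?P0" for x
  proof -
    have "?r x = \<zero>\<^bsub>?R\<^esub> \<longleftrightarrow> f (?r x) = f \<zero>\<^bsub>?R\<^esub>" using inj_on_eq_iff[OF inj rR[OF x] R0] by blast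
    then show ?thesis unfolding fr[OF x] f0 q0[OF x] .
  qed
  let ?S = "rep_module Q d M"
  have MV: "M \<in> rep_variety Q I d" using M by (simp add: orbit_def)
  obtain h where h: "\<And>v. v \<in> verts Q \<Longrightarrow> h v \<in> carrier_mat (d v) (d v)"
    "\<And>v. v \<in> verts Q \<Longrightarrow> invertible_mat (h v)"
    "\<And>\<alpha>. \<alpha> \<in> arcs Q \<Longrightarrow> M \<alpha> * h (tail Q \<alpha>) = h (head Q \<alpha>) * \<phi> a \<alpha>"
    using M by (auto simp: orbit_def)
  let ?T = "\<lambda>y. \<lambda>v\<in>verts Q. h v *\<^sub>v y v"
  have T: "?T \<in> module_hom \<Lambda> ?R ?S" by (rule rep_matrix_hom[where H = h, OF \<phi> MV h(1,3)])
  \<comment> \<open>The definition of invertibility leaves the size of the inverse open; it is read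
    off from the two products.\<close>
  have "\<exists>k. k \<in> carrier_mat (d v) (d v) \<and> h v * k = 1\<^sub>m (d v) \<and> k * h v = 1\<^sub>m (d v)" if v: "v \<in> verts Q" for v
  proof -
    obtain k where k: "inverts_mat (h v) k" "inverts_mat k (h v)" using h(2)[OF v] by (auto simp: invertible_mat_def)
    have 1: "h v * k = 1\<^sub>m (d v)" "k * h v = 1\<^sub>m (dim_row k)"
      using k carrier_matD[OF h(1)[OF v]] by (simp_all add: inverts_mat_def)
    have "dim_col k = d v" using arg_cong[OF 1(1), of dim_col] by simp
    moreover have "dim_row k = d v" using arg_cong[OF 1(2), of dim_col] carrier_matD[OF h(1)[OF v]] by simp
    ultimately show ?thesis using 1 by (intro exI[of _ k]) auto
  qed
  then have "\<forall>v\<in>verts Q. \<exists>k. k \<in> carrier_mat (d v) (d v) \<and> h v * k = 1\<^sub>m (d v) \<and> k * h v = 1\<^sub>m (d v)"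
    by (rule ballI)
  from bchoice[OF this] obtain k where "\<forall>v\<in>verts Q. k v \<in> carrier_mat (d v) (d v) \<and>
    h v * k v = 1\<^sub>m (d v) \<and> k v * h v = 1\<^sub>m (d v)" by (elim exE)
  then have k: "\<And>v. v \<in> verts Q \<Longrightarrow> k v \<in> carrier_mat (d v) (d v)"
    "\<And>v. v \<in> verts Q \<Longrightarrow> h v * k v = 1\<^sub>m (d v)" "\<And>v. v \<in> verts Q \<Longrightarrow> k v * h v = 1\<^sub>m (d v)" by simp_all
  let ?K = "\<lambda>y. \<lambda>v\<in>verts Q. k v *\<^sub>v y v"
  have KR: "?K y \<in> carrier ?R" if y: "y \<in> carrier ?S" for y
    unfolding rep_carrier by (rule restrict_PiE_iff[THEN iffD2]) (intro ballI mult_mat_vec_carrier[OF k(1)] rep_carrierD[OF y])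
  have TK: "?T (?K y) = y" if y: "y \<in> carrier ?S" for y
  proof (rule rep_ext[OF module_homD(1)[OF T KR[OF y]] y])
    fix v assume v: "v \<in> verts Q"
    have "h v *\<^sub>v (k v *\<^sub>v y v) = (h v * k v) *\<^sub>v y v"
      by (rule assoc_mult_mat_vec[OF h(1)[OF v] k(1)[OF v] rep_carrierD[OF y v], symmetric])
    also have "\<dots> = y v" unfolding k(2)[OF v] by (rule one_mult_mat_vec[OF rep_carrierD[OF y v]])
    finally show "?T (?K y) v = y v" using v by (simp only: restrict_apply')
  qed
  have KT: "?K (?T y) = y" if y: "y \<in> carrier ?R" for y
  proof (rule rep_ext[OF KR[OF module_homD(1)[OF T y]] y])
    fix v assume v: "v \<in> verts Q"
    have "k v *\<^sub>v (h v *\<^sub>v y v) = (k v * h v) *\<^sub>v y v"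
      by (rule assoc_mult_mat_vec[OF k(1)[OF v] h(1)[OF v] rep_carrierD[OF y v], symmetric])
    also have "\<dots> = y v" unfolding k(3)[OF v] by (rule one_mult_mat_vec[OF rep_carrierD[OF y v]])
    finally show "?K (?T y) v = y v" using v by (simp only: restrict_apply')
  qed
  have T0: "?T \<zero>\<^bsub>?R\<^esub> = \<zero>\<^bsub>?S\<^esub>"
    unfolding rep_module_simps
  proof (rule restrict_ext)
    fix v assume v: "v \<in> verts Q"
    have "h v *\<^sub>v 0\<^sub>v (d v) = 0\<^sub>v (d v)" using h(1)[OF v] by (intro eq_vecI) simp_all
    then show "h v *\<^sub>v (\<lambda>v\<in>verts Q. 0\<^sub>v (d v)) v = 0\<^sub>v (d v)" using v by (simp only: restrict_apply')
  qed
  have "(\<lambda>x. ?T (?r x)) ` carrier ?P0 = ?T ` carrier ?R" unfolding rsurj[symmetric] image_image ..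
  also have "\<dots> = carrier ?S"
  proof
    show "?T ` carrier ?R \<subseteq> carrier ?S" using module_homD(1)[OF T] by blast
    show "carrier ?S \<subseteq> ?T ` carrier ?R"
    proof
      fix y assume y: "y \<in> carrier ?S"
      have "?T (?K y) \<in> ?T ` carrier ?R" by (rule imageI[OF KR[OF y]])
      then show "y \<in> ?T ` carrier ?R" unfolding TK[OF y] .
    qed
  qed
  finally have surj: "(\<lambda>x. ?T (?r x)) ` carrier ?P0 = carrier ?S" .
  moreover have "?T (?r x) = \<zero>\<^bsub>?S\<^esub> \<longleftrightarrow> x \<in> ?A" if x: "x \<in> carrier ?P0" for x
  proof -
    have "?T (?r x) = ?T \<zero>\<^bsub>?R\<^esub> \<longleftrightarrow> ?r x = \<zero>\<^bsub>?R\<^esub>"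
    proof
      assume "?T (?r x) = ?T \<zero>\<^bsub>?R\<^esub>"
      then have "?K (?T (?r x)) = ?K (?T \<zero>\<^bsub>?R\<^esub>)" by (rule arg_cong)
      then show "?r x = \<zero>\<^bsub>?R\<^esub>" unfolding KT[OF rR[OF x]] KT[OF R0] .
    next
      assume "?r x = \<zero>\<^bsub>?R\<^esub>"
      then show "?T (?r x) = ?T \<zero>\<^bsub>?R\<^esub>" by (simp only:)
    qed
    then show ?thesis unfolding T0 r0[OF x] .
  qed
  ultimately show ?thesis using module_hom_comp[OF rhom T] by (intro bexI conjI ballI)
qed

section \<open>Dimension of the homomorphisms from a projective module to a representation\<close>

definition hom_index_proj :: "('v \<Rightarrow> nat) \<Rightarrow> ('v \<Rightarrow> nat) \<Rightarrow> (('v \<times> nat) \<times> nat) set" where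
  "hom_index_proj m d = (SIGMA s:gens m. {..<d (fst s)})"

text \<open>A homomorphism amounts to a choice, for each generator, of an element fixed by the
  idempotent of that generator. Such elements form the space of the representation at the vertex
  \<open>v\<close> of the generator, of dimension \<open>d v\<close>.\<close>

lemma vdim_hom_proj_rep:
  assumes M: "M \<in> rep_variety Q I d" and L: "left_module \<Lambda> (rep_module Q d M)"
  shows "fdvs (hom_space Q I (proj Q I m) (rep_module Q d M))"
    and "vdim (hom_space Q I (proj Q I m) (rep_module Q d M)) = (\<Sum>v\<in>verts Q. m v * d v)"
proof -
  let ?P = "proj Q I m" and ?R = "rep_module Q d M"
  let ?H = "hom_space Q I ?P ?R" and ?E = "hom_index_proj m d"
  have fE: "finite ?E" by (simp add: hom_index_proj_def)
  have "card ?E = (\<Sum>s\<in>gens m. d (fst s))" by (simp add: hom_index_proj_def)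
  also have "\<dots> = (\<Sum>v\<in>verts Q. \<Sum>i<m v. d v)"
    unfolding gens_def by (subst sum.Sigma) (auto simp: split_beta)
  finally have cE: "card ?E = (\<Sum>v\<in>verts Q. m v * d v)" by simp
  define \<psi> where "\<psi> f = (\<lambda>(s, j). if (s, j) \<in> ?E then f (gen m s) (fst s) $ j else 0)"
    for f :: "('v, 'a, 'k) proj_element \<Rightarrow> 'v \<Rightarrow> 'k vec"
  have fg: "f (gen m s) \<in> carrier ?R" if "f \<in> carrier ?H" "s \<in> gens m" for f s
  proof -
    have "f \<in> module_hom \<Lambda> ?P ?R" using that(1) unfolding hom_space_simps by (elim conjE)
    then show ?thesis by (rule module_homD(1)[OF _ gen_in_carrier[OF that(2)]])
  qed
  have l: "lin ?H (coord_space ?E) \<psi>"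
  proof (rule linI)
    show "\<psi> f \<in> carrier (coord_space ?E)" for f by (auto simp: \<psi>_def coord_space_simps)
    have ev: "\<psi> f (s, j) = f (gen m s) (fst s) $ j" if "s \<in> gens m" "j < d (fst s)" for f s j
      using that by (simp add: \<psi>_def hom_index_proj_def)
    have E: "s \<in> gens m" "fst s \<in> verts Q" "j < d (fst s)" if "(s, j) \<in> ?E" for s j
      using that gens_verts[of s m] by (simp_all add: hom_index_proj_def)
    have out: "\<psi> f (s, j) = 0" if "(s, j) \<notin> ?E" for f s j using that by (simp add: \<psi>_def)
    show "\<psi> \<zero>\<^bsub>?H\<^esub> = \<zero>\<^bsub>coord_space ?E\<^esub>"
    proof (rule ext, clarify)
      fix a b j
      show "\<psi> \<zero>\<^bsub>?H\<^esub> ((a, b), j) = \<zero>\<^bsub>coord_space ?E\<^esub> ((a, b), j)"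
      proof (cases "((a, b), j) \<in> ?E")
        case True
        note E = E[OF True]
        show ?thesis unfolding ev[OF E(1,3)] unfolding hom_space_simps coord_space_simps rep_module_simps
          restrict_apply'[OF gen_in_carrier[OF E(1)]] restrict_apply'[OF E(2)] by (rule index_zero_vec(1)[OF E(3)])
      qed (simp add: out coord_space_simps)
    qed
    show "\<psi> (f \<oplus>\<^bsub>?H\<^esub> h) = \<psi> f \<oplus>\<^bsub>coord_space ?E\<^esub> \<psi> h" if f: "f \<in> carrier ?H" and h: "h \<in> carrier ?H" for f h
    proof (rule ext, clarify)
      fix a b j
      show "\<psi> (f \<oplus>\<^bsub>?H\<^esub> h) ((a, b), j) = (\<psi> f \<oplus>\<^bsub>coord_space ?E\<^esub> \<psi> h) ((a, b), j)"
      proof (cases "((a, b), j) \<in> ?E")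
        case True
        note E = E[OF True]
        have "j < dim_vec (h (gen m (a, b)) (fst (a, b)))"
          using carrier_vecD[OF rep_carrierD[OF fg[OF h E(1)] E(2)]] E(3) by simp
        then show ?thesis unfolding coord_space_simps ev[OF E(1,3)] unfolding hom_space_simps rep_module_simps
          restrict_apply'[OF gen_in_carrier[OF E(1)]] restrict_apply'[OF E(2)] by (rule index_add_vec(1))
      qed (simp add: out coord_space_simps)
    qed
    show "\<psi> (c \<odot>\<^bsub>?H\<^esub> f) = c \<odot>\<^bsub>coord_space ?E\<^esub> \<psi> f" if f: "f \<in> carrier ?H" for c f
    proof (rule ext, clarify)
      fix a b j
      show "\<psi> (c \<odot>\<^bsub>?H\<^esub> f) ((a, b), j) = (c \<odot>\<^bsub>coord_space ?E\<^esub> \<psi> f) ((a, b), j)"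
      proof (cases "((a, b), j) \<in> ?E")
        case True
        note E = E[OF True]
        have "j < dim_vec (f (gen m (a, b)) (fst (a, b)))"
          using carrier_vecD[OF rep_carrierD[OF fg[OF f E(1)] E(2)]] E(3) by simp
        then show ?thesis unfolding coord_space_simps ev[OF E(1,3)] unfolding hom_space_simps
          restrict_apply'[OF gen_in_carrier[OF E(1)]] scalar_action[OF M fg[OF f E(1)]] restrict_apply'[OF E(2)]
          by (rule index_smult_vec(1))
      qed (simp add: out coord_space_simps)
    qed
  qed
  \<comment> \<open>The idempotent fixes the generator, hence also its image, which is therefore
    concentrated at the vertex \<open>fst s\<close>.\<close>
  have gen_eq: "f (gen m s) = unit_elem d (fst s) (f (gen m s) (fst s))" if f: "f \<in> carrier ?H" and s: "s \<in> gens m" for f s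
  proof -
    note v = gens_verts[OF s]
    have f': "f \<in> module_hom \<Lambda> ?P ?R" using f by (simp add: hom_space_simps)
    have "f (gen m s) = idem (fst s) \<odot>\<^bsub>?R\<^esub> f (gen m s)"
      using module_homD(3)[OF f' idem_in_carrier[OF v] gen_in_carrier[OF s]] idem_gen[OF s] by simp
    also have "\<dots> = unit_elem d (fst s) (f (gen m s) (fst s))" by (rule idem_action[OF M fg[OF f s] v])
    finally show ?thesis .
  qed
  have inj: "inj_on \<psi> (carrier ?H)"
  proof (rule inj_onI)
    fix f h assume f: "f \<in> carrier ?H" and h: "h \<in> carrier ?H" and eq: "\<psi> f = \<psi> h"
    have fh: "f \<in> module_hom \<Lambda> ?P ?R" "h \<in> module_hom \<Lambda> ?P ?R" "f \<in> extensional (carrier ?P)" "h \<in> extensional (carrier ?P)"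
      using f h by (simp_all add: hom_space_simps)
    have "f (gen m s) = h (gen m s)" if s: "s \<in> gens m" for s
    proof -
      have dv: "dim_vec (f (gen m s) (fst s)) = d (fst s)" "dim_vec (h (gen m s) (fst s)) = d (fst s)"
        using carrier_vecD[OF rep_carrierD[OF fg[OF f s] gens_verts[OF s]]] carrier_vecD[OF rep_carrierD[OF fg[OF h s] gens_verts[OF s]]] .
      have "f (gen m s) (fst s) = h (gen m s) (fst s)"
      proof (rule eq_vecI)
        fix j assume "j < dim_vec (h (gen m s) (fst s))"
        then have "(s, j) \<in> ?E" using s dv by (simp add: hom_index_proj_def)
        then show "f (gen m s) (fst s) $ j = h (gen m s) (fst s) $ j"
          using fun_cong[OF eq, of "(s, j)"] by (simp add: \<psi>_def)
      qed (simp only: dv)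
      then show ?thesis using gen_eq[OF f s] gen_eq[OF h s] by simp
    qed
    then show "f = h" using proj_hom_ext[OF L fh(1,2)] by (intro extensionalityI[OF fh(3,4)]) blast
  qed
  show fd: "fdvs ?H"
    by (rule fdvs_inj(1)[OF vdim_coord_space(1)[OF fE] closed_ops_hom_space[OF left_module_proj L] l inj])
  have "c \<in> \<psi> ` carrier ?H" if c: "c \<in> carrier (coord_space ?E)" for c
  proof -
    \<comment> \<open>Vectors prescribed at the vertices of the generators are realised by the free
      map; as \<open>n s\<close> is concentrated at \<open>fst s\<close>, the idempotent in
      \<open>free_map_gen\<close> leaves it unchanged.\<close>
    define n where "n s = unit_elem d (fst s) (vec (d (fst s)) (\<lambda>j. c (s, j)))" for s
    have n: "n s \<in> carrier ?R" for s unfolding n_def by (rule unit_elem_carrier) simp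
    have fm: "free_map m ?R n \<in> carrier ?H" by (rule free_map_hom[OF L n])
    have "free_map m ?R n (gen m s) (fst s) = vec (d (fst s)) (\<lambda>j. c (s, j))" if s: "s \<in> gens m" for s
    proof -
      note v = gens_verts[OF s]
      have "free_map m ?R n (gen m s) = unit_elem d (fst s) (n s (fst s))"
        unfolding free_map_gen[OF L n s] by (rule idem_action[OF M n v])
      then show ?thesis using v by (simp add: n_def unit_elem_def)
    qed
    then have "\<psi> (free_map m ?R n) = c"
      using c by (auto simp: \<psi>_def hom_index_proj_def coord_space_simps fun_eq_iff)
    then show ?thesis using fm by (intro image_eqI[of _ _ "free_map m ?R n"]) simp_all
  qed
  then have "\<psi> ` carrier ?H = carrier (coord_space ?E)" using linD(1)[OF l] by (intro equalityI image_subsetI subsetI)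
  then have "bij_betw \<psi> (carrier ?H) (carrier (coord_space ?E))" using inj by (simp add: bij_betw_def)
  from vdim_bij[OF fd l this] show "vdim ?H = (\<Sum>v\<in>verts Q. m v * d v)"
    by (simp only: vdim_coord_space(2)[OF fE] cE)
qed

section \<open>Composition maps on Hom spaces and homotopies\<close>

lemma lin_precomp:
  assumes X: "left_module \<Lambda> X" and Z: "left_module \<Lambda> Z" and Y: "left_module \<Lambda> Y"
    and a: "a \<in> module_hom \<Lambda> X Z"
  shows "lin (hom_space Q I Z Y) (hom_space Q I X Y) (\<lambda>h. \<lambda>x\<in>carrier X. h (a x))"
proof (rule linI)
  show "(\<lambda>x\<in>carrier X. h (a x)) \<in> carrier (hom_space Q I X Y)" if "h \<in> carrier (hom_space Q I Z Y)" for h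
  proof -
    have "h \<in> module_hom \<Lambda> Z Y" using that by (simp add: hom_space_simps)
    from restrict_module_hom[OF module_hom_comp[OF a this] X] show ?thesis .
  qed
qed (auto simp: hom_space_simps module_homD(1)[OF a] intro!: restrict_ext)

lemma lin_postcomp:
  assumes X: "left_module \<Lambda> X" and Z: "left_module \<Lambda> Z" and Y: "left_module \<Lambda> Y"
    and b: "b \<in> module_hom \<Lambda> Z Y"
  shows "lin (hom_space Q I X Z) (hom_space Q I X Y) (\<lambda>h. \<lambda>x\<in>carrier X. b (h x))"
proof (rule linI)
  note b' = module_homD[OF b]
  have h: "h \<in> module_hom \<Lambda> X Z" if "h \<in> carrier (hom_space Q I X Z)" for h
    using that by (simp add: hom_space_simps)
  show "(\<lambda>x\<in>carrier X. b (h x)) \<in> carrier (hom_space Q I X Y)" if "h \<in> carrier (hom_space Q I X Z)" for h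
    by (rule restrict_module_hom[OF module_hom_comp[OF h[OF that] b] X])
  show "(\<lambda>x\<in>carrier X. b (\<zero>\<^bsub>hom_space Q I X Z\<^esub> x)) = \<zero>\<^bsub>hom_space Q I X Y\<^esub>"
    unfolding hom_space_simps using module_hom_zero[OF b Z left_moduleD(2)[OF Y]]
    by (intro restrict_ext) simp
  show "(\<lambda>x\<in>carrier X. b ((f \<oplus>\<^bsub>hom_space Q I X Z\<^esub> h) x)) =
    (\<lambda>x\<in>carrier X. b (f x)) \<oplus>\<^bsub>hom_space Q I X Y\<^esub> (\<lambda>x\<in>carrier X. b (h x))"
    if "f \<in> carrier (hom_space Q I X Z)" "h \<in> carrier (hom_space Q I X Z)" for f h
    unfolding hom_space_simps
    by (intro restrict_ext) (simp add: b'(2) module_homD(1)[OF h[OF that(1)]] module_homD(1)[OF h[OF that(2)]])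
  show "(\<lambda>x\<in>carrier X. b ((c \<odot>\<^bsub>hom_space Q I X Z\<^esub> f) x)) = c \<odot>\<^bsub>hom_space Q I X Y\<^esub> (\<lambda>x\<in>carrier X. b (f x))"
    if "f \<in> carrier (hom_space Q I X Z)" for c f
    unfolding hom_space_simps
    by (intro restrict_ext) (simp add: b'(3) scalar_in_carrier module_homD(1)[OF h[OF that]])
qed

text \<open>Modulo these maps, Hom(P1, P0) is the space of morphisms from a to the shift of b in the
  homotopy category; \<open>n\<close> and \<open>m\<close> belong to the terms in degrees -1 and 0.
  The sum is written without the sign of the shifted differential, which is absorbed into
  \<open>s\<close>.\<close>

definition homotopies :: "('v \<Rightarrow> nat) \<Rightarrow> ('v \<Rightarrow> nat) \<Rightarrow>
    (('v, 'a, 'k) proj_element \<Rightarrow> ('v, 'a, 'k) proj_element) \<Rightarrow>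
    (('v, 'a, 'k) proj_element \<Rightarrow> ('v, 'a, 'k) proj_element) \<Rightarrow>
    (('v, 'a, 'k) proj_element \<Rightarrow> ('v, 'a, 'k) proj_element) set" where
  "homotopies m n a b = {f \<in> carrier (hom_space Q I (proj Q I n) (proj Q I m)).
    \<exists>s\<in>carrier (hom_space Q I (proj Q I n) (proj Q I n)). \<exists>t\<in>carrier (hom_space Q I (proj Q I m) (proj Q I m)).
      \<forall>x\<in>carrier (proj Q I n). f x = b (s x) \<oplus>\<^bsub>proj Q I m\<^esub> t (a x)}"

lemma closed_ops_homotopies:
  assumes a: "a \<in> module_hom \<Lambda> (proj Q I n) (proj Q I m)" and b: "b \<in> module_hom \<Lambda> (proj Q I n) (proj Q I m)"
  shows "closed_ops ((hom_space Q I (proj Q I n) (proj Q I m))\<lparr>carrier := homotopies m n a b\<rparr>)"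
proof -
  let ?P1 = "proj Q I n" and ?P0 = "proj Q I m"
  let ?H = "hom_space Q I ?P1 ?P0" and ?S = "hom_space Q I ?P1 ?P1" and ?T = "hom_space Q I ?P0 ?P0"
  note L1 = left_module_proj[of n] and L0 = left_module_proj[of m]
  note D0 = left_moduleD[OF L0]
  interpret P0: abelian_group ?P0 by (fact D0(2))
  note CH = closed_opsD[OF closed_ops_hom_space[OF L1 L0]] and CS = closed_opsD[OF closed_ops_hom_space[OF L1 L1]]
    and CT = closed_opsD[OF closed_ops_hom_space[OF L0 L0]]
  note a' = module_homD[OF a] and b' = module_homD[OF b]
  have S: "s x \<in> carrier ?P1" if "s \<in> carrier ?S" "x \<in> carrier ?P1" for s x
    using that module_homD(1) unfolding hom_space_simps by fast
  have T: "t x \<in> carrier ?P0" if "t \<in> carrier ?T" "x \<in> carrier ?P0" for t x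
    using that module_homD(1) unfolding hom_space_simps by fast
  have "\<zero>\<^bsub>?H\<^esub> \<in> homotopies m n a b"
    unfolding homotopies_def mem_Collect_eq
  proof (intro conjI CH(1) bexI[OF _ CS(1)] bexI[OF _ CT(1)] ballI)
    fix x assume x: "x \<in> carrier ?P1"
    show "\<zero>\<^bsub>?H\<^esub> x = b (\<zero>\<^bsub>?S\<^esub> x) \<oplus>\<^bsub>?P0\<^esub> \<zero>\<^bsub>?T\<^esub> (a x)"
      unfolding hom_space_simps restrict_apply'[OF x] restrict_apply'[OF a'(1)[OF x]] module_hom_zero[OF b L1 D0(2)]
      by simp
  qed
  moreover have "f \<oplus>\<^bsub>?H\<^esub> h \<in> homotopies m n a b" if f: "f \<in> homotopies m n a b" and h: "h \<in> homotopies m n a b" for f h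
  proof -
    obtain s t where st: "s \<in> carrier ?S" "t \<in> carrier ?T" "\<And>x. x \<in> carrier ?P1 \<Longrightarrow> f x = b (s x) \<oplus>\<^bsub>?P0\<^esub> t (a x)"
      using f unfolding homotopies_def by blast
    obtain s' t' where st': "s' \<in> carrier ?S" "t' \<in> carrier ?T" "\<And>x. x \<in> carrier ?P1 \<Longrightarrow> h x = b (s' x) \<oplus>\<^bsub>?P0\<^esub> t' (a x)"
      using h unfolding homotopies_def by blast
    have fh: "f \<in> carrier ?H" "h \<in> carrier ?H" using f h unfolding homotopies_def by blast+
    show ?thesis
      unfolding homotopies_def mem_Collect_eq
    proof (intro conjI CH(2)[OF fh] bexI[OF _ CS(2)[OF st(1) st'(1)]] bexI[OF _ CT(2)[OF st(2) st'(2)]] ballI)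
      fix x assume x: "x \<in> carrier ?P1"
      note c = b'(1)[OF S[OF st(1) x]] b'(1)[OF S[OF st'(1) x]] T[OF st(2) a'(1)[OF x]] T[OF st'(2) a'(1)[OF x]]
      have "b (s x) \<oplus>\<^bsub>?P0\<^esub> t (a x) \<oplus>\<^bsub>?P0\<^esub> (b (s' x) \<oplus>\<^bsub>?P0\<^esub> t' (a x)) =
        b (s x) \<oplus>\<^bsub>?P0\<^esub> b (s' x) \<oplus>\<^bsub>?P0\<^esub> (t (a x) \<oplus>\<^bsub>?P0\<^esub> t' (a x))"
        using c by (simp only: P0.a_ac P0.a_closed)
      then show "(f \<oplus>\<^bsub>?H\<^esub> h) x = b ((s \<oplus>\<^bsub>?S\<^esub> s') x) \<oplus>\<^bsub>?P0\<^esub> (t \<oplus>\<^bsub>?T\<^esub> t') (a x)"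
        unfolding hom_space_simps restrict_apply'[OF x] restrict_apply'[OF a'(1)[OF x]] st(3)[OF x] st'(3)[OF x]
          b'(2)[OF S[OF st(1) x] S[OF st'(1) x]] .
    qed
  qed
  moreover have "c \<odot>\<^bsub>?H\<^esub> f \<in> homotopies m n a b" if f: "f \<in> homotopies m n a b" for c f
  proof -
    obtain s t where st: "s \<in> carrier ?S" "t \<in> carrier ?T" "\<And>x. x \<in> carrier ?P1 \<Longrightarrow> f x = b (s x) \<oplus>\<^bsub>?P0\<^esub> t (a x)"
      using f unfolding homotopies_def by blast
    have fH: "f \<in> carrier ?H" using f unfolding homotopies_def by blast
    show ?thesis
      unfolding homotopies_def mem_Collect_eq
    proof (intro conjI CH(3)[OF fH] bexI[OF _ CS(3)[OF st(1)]] bexI[OF _ CT(3)[OF st(2)]] ballI)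
      fix x assume x: "x \<in> carrier ?P1"
      show "(c \<odot>\<^bsub>?H\<^esub> f) x = b ((c \<odot>\<^bsub>?S\<^esub> s) x) \<oplus>\<^bsub>?P0\<^esub> (c \<odot>\<^bsub>?T\<^esub> t) (a x)"
        unfolding hom_space_simps restrict_apply'[OF x] restrict_apply'[OF a'(1)[OF x]] st(3)[OF x]
          b'(3)[OF scalar_in_carrier S[OF st(1) x]]
        by (rule D0(5)[OF scalar_in_carrier b'(1)[OF S[OF st(1) x]] T[OF st(2) a'(1)[OF x]]])
    qed
  qed
  ultimately show ?thesis by (simp add: closed_ops_def)
qed

text \<open>Left exactness of Hom into Y: composition with \<open>p\<close> identifies Hom(X, Y)
  with the maps on P0 that vanish on the image of \<open>a\<close>. They form the kernel of
  composition with \<open>a\<close>, and rank-nullity applies.\<close>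

lemma vdim_hom_cokernel:
  assumes X: "left_module \<Lambda> X" and Y: "left_module \<Lambda> Y"
    and a: "a \<in> module_hom \<Lambda> (proj Q I n) (proj Q I m)"
    and p: "p \<in> module_hom \<Lambda> (proj Q I m) X" "p ` carrier (proj Q I m) = carrier X"
      "\<And>x. x \<in> carrier (proj Q I m) \<Longrightarrow> p x = \<zero>\<^bsub>X\<^esub> \<longleftrightarrow> x \<in> a ` carrier (proj Q I n)"
    and fd: "fdvs (hom_space Q I (proj Q I m) Y)"
  shows "hom_dim Q I X Y + vdim ((hom_space Q I (proj Q I n) Y)\<lparr>carrier :=
      (\<lambda>h. \<lambda>x\<in>carrier (proj Q I n). h (a x)) ` carrier (hom_space Q I (proj Q I m) Y)\<rparr>) =
    vdim (hom_space Q I (proj Q I m) Y)"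
proof -
  let ?P1 = "proj Q I n" and ?P0 = "proj Q I m"
  let ?H0 = "hom_space Q I ?P0 Y" and ?H1 = "hom_space Q I ?P1 Y" and ?T = "\<lambda>h. \<lambda>x\<in>carrier ?P1. h (a x)"
  note L1 = left_module_proj[of n] and L0 = left_module_proj[of m]
  note D0 = left_moduleD[OF L0]
  interpret P0: abelian_group ?P0 by (fact D0(2))
  interpret X: abelian_group X by (rule left_moduleD(2)[OF X])
  interpret Y: abelian_group Y by (rule left_moduleD(2)[OF Y])
  define K where "K = {h \<in> carrier ?H0. ?T h = \<zero>\<^bsub>?H1\<^esub>}"
  have T: "lin ?H0 ?H1 ?T" by (rule lin_precomp[OF L1 L0 Y a])
  then have T': "lin ?H0 (?H1\<lparr>carrier := ?T ` carrier ?H0\<rparr>) ?T" unfolding lin_def by simp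
  have rn: "vdim ?H0 = vdim (?H1\<lparr>carrier := ?T ` carrier ?H0\<rparr>) + vdim (?H0\<lparr>carrier := K\<rparr>)"
    using fdvs_surj(2)[OF fd T'] unfolding K_def by simp
  let ?S = "\<lambda>f. \<lambda>x\<in>carrier ?P0. f (p x)"
  have S: "lin (hom_space Q I X Y) ?H0 ?S" by (rule lin_precomp[OF L0 X Y p(1)])
  have K: "h \<in> K \<longleftrightarrow> h \<in> carrier ?H0 \<and> (\<forall>x\<in>carrier ?P1. h (a x) = \<zero>\<^bsub>Y\<^esub>)" for h
  proof -
    have "?T h = \<zero>\<^bsub>?H1\<^esub> \<longleftrightarrow> (\<forall>x\<in>carrier ?P1. h (a x) = \<zero>\<^bsub>Y\<^esub>)"
    proof (intro iffI ballI)
      fix x assume eq: "?T h = \<zero>\<^bsub>?H1\<^esub>" and x: "x \<in> carrier ?P1"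
      show "h (a x) = \<zero>\<^bsub>Y\<^esub>"
        using fun_cong[OF eq, of x] unfolding hom_space_simps(2) restrict_apply'[OF x] .
    next
      assume z: "\<forall>x\<in>carrier ?P1. h (a x) = \<zero>\<^bsub>Y\<^esub>"
      show "?T h = \<zero>\<^bsub>?H1\<^esub>" unfolding hom_space_simps(2) by (rule restrict_ext) (rule bspec[OF z])
    qed
    then show ?thesis unfolding K_def mem_Collect_eq by (simp only:)
  qed
  have hom: "f \<in> module_hom \<Lambda> X Y" "f \<in> extensional (carrier X)" if "f \<in> carrier (hom_space Q I X Y)" for f
    using that unfolding hom_space_simps by blast+
  have hom0: "h \<in> module_hom \<Lambda> ?P0 Y" "h \<in> extensional (carrier ?P0)" if "h \<in> carrier ?H0" for h
    using that unfolding hom_space_simps by blast+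
  have SK: "?S f \<in> K" if f: "f \<in> carrier (hom_space Q I X Y)" for f
    unfolding K
  proof (intro conjI ballI)
    show "?S f \<in> carrier ?H0" by (rule linD(1)[OF S f])
    fix x assume x: "x \<in> carrier ?P1"
    note ax = module_homD(1)[OF a x]
    have "p (a x) = \<zero>\<^bsub>X\<^esub>" unfolding p(3)[OF ax] by (rule imageI[OF x])
    then show "?S f (a x) = \<zero>\<^bsub>Y\<^esub>"
      unfolding restrict_apply'[OF ax] using module_hom_zero[OF hom(1)[OF f] X left_moduleD(2)[OF Y]] by simp
  qed
  have inj: "inj_on ?S (carrier (hom_space Q I X Y))"
  proof (rule inj_onI)
    fix f h assume f: "f \<in> carrier (hom_space Q I X Y)" and h: "h \<in> carrier (hom_space Q I X Y)" and eq: "?S f = ?S h"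
    show "f = h"
    proof (rule extensionalityI[OF hom(2)[OF f] hom(2)[OF h]])
      fix y assume "y \<in> carrier X"
      then obtain x where x: "x \<in> carrier ?P0" "y = p x" unfolding p(2)[symmetric] by blast
      show "f y = h y" using fun_cong[OF eq, of x] x by simp
    qed
  qed
  have surj: "h \<in> ?S ` carrier (hom_space Q I X Y)" if h: "h \<in> K" for h
  proof -
    have hH: "h \<in> carrier ?H0" and h0: "h (a x) = \<zero>\<^bsub>Y\<^esub>" if "x \<in> carrier ?P1" for x using h that unfolding K by blast+
    have hH: "h \<in> carrier ?H0" using h unfolding K by blast
    note hh = module_homD[OF hom0(1)[OF hH]] and ph = module_homD[OF p(1)]
    \<comment> \<open>Elements with the same image under \<open>p\<close> differ by an element of
      the image of \<open>a\<close>, on which \<open>h\<close> vanishes; so \<open>h\<close> is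
      constant on the fibres of \<open>p\<close>.\<close>
    have well: "h x = h y" if x: "x \<in> carrier ?P0" and y: "y \<in> carrier ?P0" and eq: "p x = p y" for x y
    proof -
      have my: "\<ominus>\<^bsub>?P0\<^esub> y \<in> carrier ?P0" using y by simp
      let ?z = "x \<oplus>\<^bsub>?P0\<^esub> \<ominus>\<^bsub>?P0\<^esub> y"
      have z: "?z \<in> carrier ?P0" using x my by (rule P0.a_closed)
      have "?z \<oplus>\<^bsub>?P0\<^esub> y = x" using x y by (simp add: P0.a_assoc P0.l_neg)
      then have xz: "x = ?z \<oplus>\<^bsub>?P0\<^esub> y" ..
      have "p ?z \<oplus>\<^bsub>X\<^esub> p y = p y" using ph(2)[OF z y] xz eq by simp
      then have "p ?z = \<zero>\<^bsub>X\<^esub>" using ph(1)[OF z] ph(1)[OF y] by (metis X.add.r_cancel_one)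
      then obtain w where w: "w \<in> carrier ?P1" "?z = a w" unfolding p(3)[OF z] by blast
      have "h x = h ?z \<oplus>\<^bsub>Y\<^esub> h y" using hh(2)[OF z y] xz by simp
      also have "h ?z = \<zero>\<^bsub>Y\<^esub>" unfolding w(2) by (rule h0[OF w(1)])
      finally show ?thesis using hh(1)[OF y] by simp
    qed
    \<comment> \<open>A section of \<open>p\<close> as a mere function. By \<open>well\<close> its
      choices do not affect \<open>h (s y)\<close>, which is why \<open>h\<close> after
      \<open>s\<close> is a homomorphism.\<close>
    define s where "s = inv_into (carrier ?P0) p"
    have s: "s y \<in> carrier ?P0" "p (s y) = y" if "y \<in> carrier X" for y
      using that unfolding s_def p(2)[symmetric] by (rule inv_into_into, rule f_inv_into_f)
    have f: "(\<lambda>y. h (s y)) \<in> module_hom \<Lambda> X Y"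
    proof (rule module_homI)
      fix y assume y: "y \<in> carrier X"
      show "h (s y) \<in> carrier Y" by (rule hh(1)[OF s(1)[OF y]])
      fix z assume z: "z \<in> carrier X"
      have "h (s (y \<oplus>\<^bsub>X\<^esub> z)) = h (s y \<oplus>\<^bsub>?P0\<^esub> s z)"
        by (rule well[OF s(1)[OF X.a_closed[OF y z]] P0.a_closed[OF s(1)[OF y] s(1)[OF z]]])
          (simp only: s(2)[OF X.a_closed[OF y z]] ph(2)[OF s(1)[OF y] s(1)[OF z]] s(2)[OF y] s(2)[OF z])
      then show "h (s (y \<oplus>\<^bsub>X\<^esub> z)) = h (s y) \<oplus>\<^bsub>Y\<^esub> h (s z)" unfolding hh(2)[OF s(1)[OF y] s(1)[OF z]] .
    next
      fix r y assume r: "r \<in> carrier \<Lambda>" and y: "y \<in> carrier X"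
      have ry: "r \<odot>\<^bsub>X\<^esub> y \<in> carrier X" by (rule left_moduleD(3)[OF X r y])
      have "h (s (r \<odot>\<^bsub>X\<^esub> y)) = h (r \<odot>\<^bsub>?P0\<^esub> s y)"
        by (rule well[OF s(1)[OF ry] D0(3)[OF r s(1)[OF y]]])
          (simp only: s(2)[OF ry] ph(3)[OF r s(1)[OF y]] s(2)[OF y])
      then show "h (s (r \<odot>\<^bsub>X\<^esub> y)) = r \<odot>\<^bsub>Y\<^esub> h (s y)" unfolding hh(3)[OF r s(1)[OF y]] .
    qed
    have eq: "?S (\<lambda>y\<in>carrier X. h (s y)) = h"
    proof (rule extensionalityI[OF restrict_extensional hom0(2)[OF hH]])
      fix x assume x: "x \<in> carrier ?P0"
      show "?S (\<lambda>y\<in>carrier X. h (s y)) x = h x"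
        unfolding restrict_apply'[OF x] restrict_apply'[OF ph(1)[OF x]]
        by (rule well[OF s(1)[OF ph(1)[OF x]] x s(2)[OF ph(1)[OF x]]])
    qed
    have "?S (\<lambda>y\<in>carrier X. h (s y)) \<in> ?S ` carrier (hom_space Q I X Y)"
      by (rule imageI[OF restrict_module_hom[OF f X]])
    then show ?thesis unfolding eq .
  qed
  have fdX: "fdvs (hom_space Q I X Y)" by (rule fdvs_inj(1)[OF fd closed_ops_hom_space[OF X Y] S inj])
  have lK: "lin (hom_space Q I X Y) (?H0\<lparr>carrier := K\<rparr>) ?S" using S SK unfolding lin_def by simp
  have "?S ` carrier (hom_space Q I X Y) = K"
  proof
    show "?S ` carrier (hom_space Q I X Y) \<subseteq> K" by (rule image_subsetI) (rule SK)
    show "K \<subseteq> ?S ` carrier (hom_space Q I X Y)" by (rule subsetI) (rule surj)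
  qed
  then have "bij_betw ?S (carrier (hom_space Q I X Y)) (carrier (?H0\<lparr>carrier := K\<rparr>))"
    using inj by (simp only: bij_betw_def module.simps partial_object.simps) simp
  from vdim_bij[OF fdX lK this] show ?thesis using rn by (simp add: hom_dim_def)
qed

text \<open>Composition with p maps Hom(P1, P0) onto Hom(P1, Y) because P1 is projective; its kernel
  consists of the maps into the image of b, so it is contained in the homotopies, and the homotopies
  are mapped onto the image of Hom(P0, Y) under composition with a.\<close>
lemma vdim_homotopies:
  assumes Y: "left_module \<Lambda> Y"
    and a: "a \<in> module_hom \<Lambda> (proj Q I n) (proj Q I m)" and b: "b \<in> module_hom \<Lambda> (proj Q I n) (proj Q I m)"
    and p: "p \<in> module_hom \<Lambda> (proj Q I m) Y" "p ` carrier (proj Q I m) = carrier Y"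
      "\<And>x. x \<in> carrier (proj Q I m) \<Longrightarrow> p x = \<zero>\<^bsub>Y\<^esub> \<longleftrightarrow> x \<in> b ` carrier (proj Q I n)"
  shows "vdim ((hom_space Q I (proj Q I n) (proj Q I m))\<lparr>carrier := homotopies m n a b\<rparr>) +
      vdim (hom_space Q I (proj Q I n) Y) =
    vdim ((hom_space Q I (proj Q I n) Y)\<lparr>carrier :=
      (\<lambda>h. \<lambda>x\<in>carrier (proj Q I n). h (a x)) ` carrier (hom_space Q I (proj Q I m) Y)\<rparr>) +
    vdim (hom_space Q I (proj Q I n) (proj Q I m))"
proof -
  let ?P1 = "proj Q I n" and ?P0 = "proj Q I m"
  let ?H = "hom_space Q I ?P1 ?P0" and ?HY = "hom_space Q I ?P1 Y"
  let ?T = "\<lambda>h. \<lambda>x\<in>carrier ?P1. h (a x)" and ?S = "\<lambda>f. \<lambda>x\<in>carrier ?P1. p (f x)"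
  let ?B = "homotopies m n a b" and ?K = "{f \<in> carrier ?H. ?S f = \<zero>\<^bsub>?HY\<^esub>}"
  let ?T' = "?T ` carrier (hom_space Q I ?P0 Y)"
  note L1 = left_module_proj[of n] and L0 = left_module_proj[of m]
  note D0 = left_moduleD[OF L0] and D1 = left_moduleD[OF L1]
  note a' = module_homD[OF a] and b' = module_homD[OF b] and p' = module_homD[OF p(1)]
  interpret P0: abelian_group ?P0 by (fact D0(2))
  interpret Y: abelian_group Y by (rule left_moduleD(2)[OF Y])
  have S: "lin ?H ?HY ?S" by (rule lin_postcomp[OF L1 L0 Y p(1)])
  have fdH: "fdvs ?H" by (rule fdvs_presentation_space)
  have hom: "f \<in> module_hom \<Lambda> X Z" "f \<in> extensional (carrier X)" if "f \<in> carrier (hom_space Q I X Z)"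
    for f and X :: "(('v, 'a, 'k) residue, 'm) module" and Z :: "(('v, 'a, 'k) residue, 'n) module"
    using that unfolding hom_space_simps by blast+
  have Ssurj: "?S ` carrier ?H = carrier ?HY"
  proof (intro equalityI image_subsetI subsetI)
    show "?S f \<in> carrier ?HY" if "f \<in> carrier ?H" for f by (rule linD(1)[OF S that])
    fix k assume k: "k \<in> carrier ?HY"
    have im: "k ` carrier ?P1 \<subseteq> p ` carrier ?P0" unfolding p(2) using module_homD(1)[OF hom(1)[OF k]] by blast
    obtain h where h: "h \<in> carrier ?H" "\<forall>x\<in>carrier ?P1. p (h x) = k x"
      using proj_lift[OF L0 Y p(1) hom(1)[OF k] im] by blast
    have "?S h = k"
      by (rule extensionalityI[OF restrict_extensional hom(2)[OF k]]) (use h(2) in simp)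
    then show "k \<in> ?S ` carrier ?H" using imageI[OF h(1), of ?S] by simp
  qed
  have rn1: "vdim ?H = vdim ?HY + vdim (?H\<lparr>carrier := ?K\<rparr>)" by (rule fdvs_surj(2)[OF fdH S Ssurj])
  \<comment> \<open>The homotopies are the full preimage of the image of Hom(P0, Y). For the
    converse direction a lift along \<open>p\<close> gives \<open>t\<close>; then f - t a takes
    values in the image of \<open>b\<close>, and a lift along \<open>b\<close> gives
    \<open>s\<close>.\<close>
  have B: "f \<in> ?B \<longleftrightarrow> f \<in> carrier ?H \<and> ?S f \<in> ?T'" for f
  proof
    assume "f \<in> ?B"
    then obtain s t where st: "s \<in> carrier (hom_space Q I ?P1 ?P1)" "t \<in> carrier (hom_space Q I ?P0 ?P0)"
      "\<And>x. x \<in> carrier ?P1 \<Longrightarrow> f x = b (s x) \<oplus>\<^bsub>?P0\<^esub> t (a x)" and f: "f \<in> carrier ?H" unfolding homotopies_def by blast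
    have pt: "(\<lambda>x\<in>carrier ?P0. p (t x)) \<in> carrier (hom_space Q I ?P0 Y)"
      by (rule linD(1)[OF lin_postcomp[OF L0 L0 Y p(1)] st(2)])
    have "?S f = ?T (\<lambda>x\<in>carrier ?P0. p (t x))"
    proof (rule restrict_ext)
      fix x assume x: "x \<in> carrier ?P1"
      have sx: "s x \<in> carrier ?P1" by (rule module_homD(1)[OF hom(1)[OF st(1)] x])
      have tx: "t (a x) \<in> carrier ?P0" by (rule module_homD(1)[OF hom(1)[OF st(2)] a'(1)[OF x]])
      have "p (b (s x)) = \<zero>\<^bsub>Y\<^esub>" unfolding p(3)[OF b'(1)[OF sx]] by (rule imageI[OF sx])
      then show "p (f x) = (\<lambda>x\<in>carrier ?P0. p (t x)) (a x)"
        unfolding restrict_apply'[OF a'(1)[OF x]] st(3)[OF x] p'(2)[OF b'(1)[OF sx] tx] using p'(1)[OF tx] by simp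
    qed
    then show "f \<in> carrier ?H \<and> ?S f \<in> ?T'" using f imageI[OF pt, of ?T] by simp
  next
    assume "f \<in> carrier ?H \<and> ?S f \<in> ?T'"
    then obtain h where f: "f \<in> carrier ?H" and h: "h \<in> carrier (hom_space Q I ?P0 Y)" and eq: "?S f = ?T h" by blast
    note f' = module_homD[OF hom(1)[OF f]]
    have im: "h ` carrier ?P0 \<subseteq> p ` carrier ?P0" unfolding p(2) using module_homD(1)[OF hom(1)[OF h]] by blast
    obtain t where t: "t \<in> carrier (hom_space Q I ?P0 ?P0)" "\<forall>x\<in>carrier ?P0. p (t x) = h x"
      using proj_lift[OF L0 Y p(1) hom(1)[OF h] im] by blast
    note t' = module_homD[OF hom(1)[OF t(1)]]
    have ta: "t (a x) \<in> carrier ?P0" if "x \<in> carrier ?P1" for x by (rule t'(1)[OF a'(1)[OF that]])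
    let ?k = "\<lambda>x. f x \<oplus>\<^bsub>?P0\<^esub> sc (- 1) \<odot>\<^bsub>?P0\<^esub> t (a x)"
    have "(\<lambda>x\<in>carrier ?P1. t (a x)) \<in> carrier ?H"
      by (rule restrict_module_hom[OF module_hom_comp[OF a hom(1)[OF t(1)]] L1])
    note CH = closed_opsD[OF closed_ops_hom_space[OF L1 L0]]
    have "f \<oplus>\<^bsub>?H\<^esub> ((- 1) \<odot>\<^bsub>?H\<^esub> (\<lambda>x\<in>carrier ?P1. t (a x))) \<in> carrier ?H"
      by (rule CH(2)[OF f CH(3)]) fact
    note k = hom(1)[OF this]
    have kx: "(f \<oplus>\<^bsub>?H\<^esub> ((- 1) \<odot>\<^bsub>?H\<^esub> (\<lambda>x\<in>carrier ?P1. t (a x)))) x = ?k x" if x: "x \<in> carrier ?P1" for x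
      unfolding hom_space_simps restrict_apply'[OF x] ..
    have "p (?k x) = \<zero>\<^bsub>Y\<^esub>" if x: "x \<in> carrier ?P1" for x
    proof -
      have eqx: "p (f x) = p (t (a x))"
        using fun_cong[OF eq, of x] t(2) a'(1)[OF x] x by simp
      have m: "sc (- 1) \<odot>\<^bsub>?P0\<^esub> t (a x) \<in> carrier ?P0" by (rule D0(3)[OF scalar_in_carrier ta[OF x]])
      have "p (?k x) = p (t (a x)) \<oplus>\<^bsub>Y\<^esub> sc (- 1) \<odot>\<^bsub>Y\<^esub> p (t (a x))"
        unfolding p'(2)[OF f'(1)[OF x] m] p'(3)[OF scalar_in_carrier ta[OF x]] eqx ..
      also have "\<dots> = sc (- 1) \<odot>\<^bsub>Y\<^esub> p (t (a x)) \<oplus>\<^bsub>Y\<^esub> p (t (a x))"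
        by (rule Y.a_comm[OF p'(1)[OF ta[OF x]] left_moduleD(3)[OF Y scalar_in_carrier p'(1)[OF ta[OF x]]]])
      also have "\<dots> = \<zero>\<^bsub>Y\<^esub>"
        using vectorspaceD(6)[OF vectorspace_underlying[OF Y], of "p (t (a x))"] p'(1)[OF ta[OF x]]
        by (simp add: underlying_space_def)
      finally show ?thesis .
    qed
    moreover have "?k x \<in> carrier ?P0" if x: "x \<in> carrier ?P1" for x
      using module_homD(1)[OF k x] unfolding kx[OF x] .
    ultimately have "?k x \<in> b ` carrier ?P1" if "x \<in> carrier ?P1" for x using p(3) that by blast
    then have imk: "(f \<oplus>\<^bsub>?H\<^esub> ((- 1) \<odot>\<^bsub>?H\<^esub> (\<lambda>x\<in>carrier ?P1. t (a x)))) ` carrier ?P1 \<subseteq> b ` carrier ?P1"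
      using kx by (intro image_subsetI) simp
    obtain s where s: "s \<in> carrier (hom_space Q I ?P1 ?P1)" "\<forall>x\<in>carrier ?P1. b (s x) = ?k x"
    proof (rule bexE[OF proj_lift[OF L1 L0 b k imk]])
      fix s assume s: "s \<in> carrier (hom_space Q I ?P1 ?P1)"
        "\<forall>x\<in>carrier ?P1. b (s x) = (f \<oplus>\<^bsub>?H\<^esub> ((- 1) \<odot>\<^bsub>?H\<^esub> (\<lambda>x\<in>carrier ?P1. t (a x)))) x"
      have "\<forall>x\<in>carrier ?P1. b (s x) = ?k x"
      proof
        fix x assume x: "x \<in> carrier ?P1"
        show "b (s x) = ?k x" unfolding bspec[OF s(2) x] by (rule kx[OF x])
      qed
      then show thesis by (rule that[OF s(1)])
    qed
    have "f x = b (s x) \<oplus>\<^bsub>?P0\<^esub> t (a x)" if x: "x \<in> carrier ?P1" for x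
    proof -
      have m: "sc (- 1) \<odot>\<^bsub>?P0\<^esub> t (a x) \<in> carrier ?P0" by (rule D0(3)[OF scalar_in_carrier ta[OF x]])
      have "b (s x) \<oplus>\<^bsub>?P0\<^esub> t (a x) = f x \<oplus>\<^bsub>?P0\<^esub> (sc (- 1) \<odot>\<^bsub>?P0\<^esub> t (a x) \<oplus>\<^bsub>?P0\<^esub> t (a x))"
        using s(2) x P0.a_assoc[OF f'(1)[OF x] m ta[OF x]] by simp
      also have "sc (- 1) \<odot>\<^bsub>?P0\<^esub> t (a x) \<oplus>\<^bsub>?P0\<^esub> t (a x) = \<zero>\<^bsub>?P0\<^esub>"
        using vectorspaceD(6)[OF vectorspace_underlying[OF L0], of "t (a x)"] ta[OF x]
        by (simp add: underlying_space_def)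
      finally show ?thesis using f'(1)[OF x] by simp
    qed
    then show "f \<in> ?B" unfolding homotopies_def using f s(1) t(1) by blast
  qed
  have fdB: "fdvs (?H\<lparr>carrier := ?B\<rparr>)"
    by (rule fdvs_subset(1)[OF fdH closed_ops_homotopies[OF a b]]) (use B in blast)
  have zT: "\<zero>\<^bsub>?HY\<^esub> \<in> ?T'"
    using imageI[OF closed_opsD(1)[OF closed_ops_hom_space[OF L0 Y]], of ?T]
    unfolding linD(2)[OF lin_precomp[OF L1 L0 Y a]] .
  have lB: "lin (?H\<lparr>carrier := ?B\<rparr>) (?HY\<lparr>carrier := ?T'\<rparr>) ?S"
    using S B unfolding lin_def by simp
  have T'sub: "?T' \<subseteq> carrier ?HY" using linD(1)[OF lin_precomp[OF L1 L0 Y a]] by blast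
  have surjB: "?S ` ?B = ?T'"
  proof
    show "?S ` ?B \<subseteq> ?T'"
    proof (rule image_subsetI)
      fix f assume "f \<in> ?B"
      then show "?S f \<in> ?T'" unfolding B by (elim conjE)
    qed
    show "?T' \<subseteq> ?S ` ?B"
    proof
      fix k assume k: "k \<in> ?T'"
      then have "k \<in> ?S ` carrier ?H" using T'sub unfolding Ssurj by (rule subsetD[rotated])
      then obtain f where f: "f \<in> carrier ?H" "k = ?S f" by (elim imageE)
      have "f \<in> ?B" unfolding B using f k by (simp only: simp_thms)
      then show "k \<in> ?S ` ?B" unfolding f(2) by (rule imageI)
    qed
  qed
  have "{f \<in> ?B. ?S f = \<zero>\<^bsub>?HY\<^esub>} = ?K"
  proof (intro equalityI subsetI; unfold mem_Collect_eq; elim conjE; intro conjI)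
    fix f assume "f \<in> carrier ?H" "?S f = \<zero>\<^bsub>?HY\<^esub>"
    then show "f \<in> ?B" unfolding B using zT by (simp only: simp_thms)
  qed (simp_all only: B)
  then have "vdim (?H\<lparr>carrier := ?B\<rparr>) = vdim (?HY\<lparr>carrier := ?T'\<rparr>) + vdim (?H\<lparr>carrier := ?K\<rparr>)"
    using fdvs_surj(2)[OF fdB lB] surjB by simp
  then show ?thesis using rn1 by simp
qed


section \<open>Chain maps up to homotopy between two-term complexes\<close>

lemma proj_zero_carrier: "x \<in> carrier (proj Q I (\<lambda>_. 0)) \<Longrightarrow> x = \<zero>\<^bsub>proj Q I (\<lambda>_. 0)\<^esub>"
  by (simp add: proj_simps gens_def extensional_def fun_eq_iff)

lemma hom_zero_hom:
  assumes "left_module \<Lambda> M" "left_module \<Lambda> N" "f \<in> carrier (hom_space Q I M N)"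
  shows "f \<zero>\<^bsub>M\<^esub> = \<zero>\<^bsub>N\<^esub>" and "x \<in> carrier M \<Longrightarrow> f x \<in> carrier N"
proof -
  have f: "f \<in> module_hom \<Lambda> M N" using assms(3) unfolding hom_space_simps by (elim conjE)
  show "f \<zero>\<^bsub>M\<^esub> = \<zero>\<^bsub>N\<^esub>" by (rule module_hom_zero[OF f assms(1) left_moduleD(2)[OF assms(2)]])
  show "x \<in> carrier M \<Longrightarrow> f x \<in> carrier N" by (rule module_homD(1)[OF f])
qed

text \<open>This disposes of all degrees in which one of the two complexes is zero.\<close>

lemma hom_space_trivial:
  assumes M: "left_module \<Lambda> M" and N: "left_module \<Lambda> N" and f: "f \<in> carrier (hom_space Q I M N)"
    and triv: "(\<forall>x\<in>carrier M. x = \<zero>\<^bsub>M\<^esub>) \<or> (\<forall>y\<in>carrier N. y = \<zero>\<^bsub>N\<^esub>)"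
  shows "f = \<zero>\<^bsub>hom_space Q I M N\<^esub>"
proof (rule extensionalityI[where A = "carrier M"])
  show "f \<in> extensional (carrier M)" using f unfolding hom_space_simps by (elim conjE)
  show "\<zero>\<^bsub>hom_space Q I M N\<^esub> \<in> extensional (carrier M)" unfolding hom_space_simps by (rule restrict_extensional)
  fix x assume x: "x \<in> carrier M"
  have "f x = \<zero>\<^bsub>N\<^esub>"
    using triv
  proof
    assume "\<forall>x\<in>carrier M. x = \<zero>\<^bsub>M\<^esub>"
    then have "x = \<zero>\<^bsub>M\<^esub>" using x by (rule bspec)
    then show ?thesis using hom_zero_hom(1)[OF M N f] by (simp only:)
  next
    assume "\<forall>y\<in>carrier N. y = \<zero>\<^bsub>N\<^esub>"
    then show ?thesis using hom_zero_hom(2)[OF M N f x] by (rule bspec)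
  qed
  then show "f x = \<zero>\<^bsub>hom_space Q I M N\<^esub> x" unfolding hom_space_simps restrict_apply'[OF x] .
qed

lemma uminus_scalar:
  assumes N: "left_module \<Lambda> N" and x: "x \<in> carrier N"
  shows "\<ominus>\<^bsub>N\<^esub> x = sc (- 1) \<odot>\<^bsub>N\<^esub> x"
proof -
  interpret N: abelian_group N by (rule left_moduleD(2)[OF N])
  have m: "sc (- 1) \<odot>\<^bsub>N\<^esub> x \<in> carrier N" by (rule left_moduleD(3)[OF N scalar_in_carrier x])
  have "sc (- 1) \<odot>\<^bsub>N\<^esub> x \<oplus>\<^bsub>N\<^esub> x = \<zero>\<^bsub>N\<^esub>"
    using vectorspaceD(6)[OF vectorspace_underlying[OF N], of x] x by (simp add: underlying_space_def)
  from N.minus_equality[OF this x m] show ?thesis .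
qed

text \<open>The complex of \<open>a\<close> lives in degrees -1 and 0, the shifted complex of
  \<open>b\<close> in degrees -2 and -1. They overlap in degree -1 only, where the terms are P1 and
  P0, so a chain map is nothing but a map from P1 to P0. Of a homotopy, which lowers degrees by one,
  only the components in degrees -1 and 0 survive: an endomorphism of P1 and one of P0.\<close>

lemma E_pair_formula:
  assumes a: "a \<in> carrier (presentation_space Q I g)" and b: "b \<in> carrier (presentation_space Q I g)"
  shows "E_pair Q I g a g b +
      vdim ((presentation_space Q I g)\<lparr>carrier := homotopies (pos_mult g) (neg_mult g) a b\<rparr>) =
    vdim (presentation_space Q I g)"
proof -
  let ?m = "pos_mult g" and ?n = "neg_mult g"
  let ?P1 = "proj Q I ?n" and ?P0 = "proj Q I ?m" and ?Z = "proj Q I (\<lambda>_. 0)"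
  let ?H = "hom_space Q I ?P1 ?P0"
  define X where "X = two_term Q I g a"
  define T where "T = two_term Q I g b"
  define Y where "Y = shift T"
  have aH: "a \<in> carrier ?H" and bH: "b \<in> carrier ?H" using a b by (simp_all add: presentation_space_def)
  have ah: "a \<in> module_hom \<Lambda> ?P1 ?P0" using aH unfolding hom_space_simps by (elim conjE)
  have bh: "b \<in> module_hom \<Lambda> ?P1 ?P0" using bH unfolding hom_space_simps by (elim conjE)
  note L1 = left_module_proj[of ?n] and L0 = left_module_proj[of ?m] and LZ = left_module_proj[of "\<lambda>_. 0"]
  interpret P0: abelian_group ?P0 by (rule left_moduleD(2)[OF L0])
  have two_obj: "obj (two_term Q I g c) i = (if i = -1 then ?P1 else if i = 0 then ?P0 else ?Z)" for c i
    by (simp add: two_term_def)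
  have LX: "left_module \<Lambda> (obj (two_term Q I g c) i)" for c i unfolding two_obj by (simp add: left_module_proj)
  have Yobj: "obj Y i = obj T (i + 1)" for i by (simp add: Y_def shift_def)
  have LY: "left_module \<Lambda> (obj Y i)" for i unfolding Yobj T_def by (rule LX)
  have LX': "left_module \<Lambda> (obj X i)" for i unfolding X_def by (rule LX)
  have triv: "(\<forall>x\<in>carrier (obj X i). x = \<zero>\<^bsub>obj X i\<^esub>) \<or> (\<forall>y\<in>carrier (obj Y j). y = \<zero>\<^bsub>obj Y j\<^esub>)"
    if "(i \<noteq> -1 \<and> i \<noteq> 0) \<or> (j \<noteq> -2 \<and> j \<noteq> -1)" for i j
    using that proj_zero_carrier unfolding X_def T_def Yobj two_obj by auto
  have zhom: "\<zero>\<^bsub>hom_space Q I M N\<^esub> \<in> carrier (hom_space Q I M N)" if "left_module \<Lambda> M" "left_module \<Lambda> N"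
    for M :: "(('v, 'a, 'k) residue, ('v, 'a, 'k) proj_element) module" and N :: "(('v, 'a, 'k) residue, ('v, 'a, 'k) proj_element) module"
    by (rule closed_opsD(1)[OF closed_ops_hom_space[OF that]])
  have two_diff: "diff (two_term Q I g c) i \<in> carrier (hom_space Q I (obj (two_term Q I g c) i) (obj (two_term Q I g c) (i + 1)))"
    if c: "c \<in> carrier ?H" for c i
  proof -
    consider "i = -1" | "i = 0" | "i = -2" | "i \<noteq> -1" "i \<noteq> 0" "i \<noteq> -2" by blast
    then show ?thesis
    proof cases
      case 1 then show ?thesis using c by (simp add: two_term_def)
    next
      case 2 then show ?thesis using zhom[OF L0 LZ] by (simp add: two_term_def hom_space_simps(2))
    next
      case 3 then show ?thesis using zhom[OF LZ L1] by (simp add: two_term_def hom_space_simps(2))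
    next
      case 4
      then have "i + 1 \<noteq> 0" "i + 1 \<noteq> -1" by arith+
      then show ?thesis using 4 zhom[OF LZ LZ] by (simp add: two_term_def hom_space_simps(2))
    qed
  qed
  have Xd: "diff X i \<in> carrier (hom_space Q I (obj X i) (obj X (i + 1)))" for i
    unfolding X_def by (rule two_diff[OF aH])
  have Xd0: "diff X i \<zero>\<^bsub>obj X i\<^esub> = \<zero>\<^bsub>obj X (i + 1)\<^esub>"
    and Xdc: "x \<in> carrier (obj X i) \<Longrightarrow> diff X i x \<in> carrier (obj X (i + 1))" for i x
    using hom_zero_hom[OF LX' LX' Xd] by blast+
  have Td: "diff T i \<in> carrier (hom_space Q I (obj T i) (obj T (i + 1)))" and LT: "left_module \<Lambda> (obj T i)" for i
    unfolding T_def by (rule two_diff[OF bH], rule LX)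
  have Yd: "diff Y i x = \<ominus>\<^bsub>obj T (i + 2)\<^esub> diff T (i + 1) x" if "x \<in> carrier (obj Y i)" for i x
    using that unfolding Yobj by (simp add: Y_def shift_def)
  have Yd0: "diff Y i \<zero>\<^bsub>obj Y i\<^esub> = \<zero>\<^bsub>obj Y (i + 1)\<^esub>" for i
  proof -
    interpret N: abelian_group "obj T (i + 2)" by (rule left_moduleD(2)[OF LT])
    have "diff T (i + 1) \<zero>\<^bsub>obj T (i + 1)\<^esub> = \<zero>\<^bsub>obj T (i + 1 + 1)\<^esub>"
      by (rule hom_zero_hom(1)[OF LT LT Td])
    then have "diff T (i + 1) \<zero>\<^bsub>obj Y i\<^esub> = \<zero>\<^bsub>obj T (i + 2)\<^esub>" unfolding Yobj by (simp add: add.assoc)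
    then show ?thesis unfolding Yd[OF left_moduleD(9)[OF LY]] by (simp add: Yobj add.assoc)
  qed
  have Ydc: "diff Y i x \<in> carrier (obj Y (i + 1))" if x: "x \<in> carrier (obj Y i)" for i x
  proof -
    interpret N: abelian_group "obj T (i + 2)" by (rule left_moduleD(2)[OF LT])
    have "diff T (i + 1) x \<in> carrier (obj T (i + 1 + 1))"
      by (rule hom_zero_hom(2)[OF LT LT Td]) (use x Yobj in simp)
    then have "diff T (i + 1) x \<in> carrier (obj T (i + 2))" by (simp add: add.assoc)
    then show ?thesis unfolding Yd[OF x] Yobj by (simp add: add.assoc)
  qed
  have X1: "obj X (-1) = ?P1" and X0: "obj X 0 = ?P0" and Y1: "obj Y (-1) = ?P0" and Y2: "obj Y (-2) = ?P1"
    unfolding Yobj X_def T_def two_obj by simp_all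
  define C where "C = chain_maps Q I X Y"
  define N where "N = null_homotopic Q I X Y"
  let ?hom = "\<lambda>i. hom_space Q I (obj X i) (obj Y i)"
  have hom1: "?hom (-1) = ?H" unfolding X1 Y1 ..
  define emb where "emb f i = (if i = -1 then f else \<zero>\<^bsub>?hom i\<^esub>)" for f and i :: int
  have emb_hom: "emb f i \<in> carrier (?hom i)" if "f \<in> carrier ?H" for f i
    using that hom1 zhom[OF LX' LY] by (cases "i = -1") (simp_all add: emb_def)
  have emb_C: "emb f \<in> carrier C" if f: "f \<in> carrier ?H" for f
    unfolding C_def chain_maps_def partial_object.simps mem_Collect_eq
  proof (intro conjI allI ballI)
    show "emb f i \<in> carrier (?hom i)" for i by (rule emb_hom[OF f])
    fix i x assume x: "x \<in> carrier (obj X i)"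
    note e = hom_zero_hom[OF LX' LY emb_hom[OF f]]
    have l: "emb f (i + 1) (diff X i x) \<in> carrier (obj Y (i + 1))" by (rule e(2)[OF Xdc[OF x]])
    have r: "diff Y i (emb f i x) \<in> carrier (obj Y (i + 1))" by (rule Ydc[OF e(2)[OF x]])
    \<comment> \<open>The chain condition compares two maps from degree i of X to degree i + 1 of Y.
      For both terms to be nonzero, i would have to be at least -1 and at most -2.\<close>
    have "(i \<noteq> -1 \<and> i \<noteq> 0) \<or> (i + 1 \<noteq> -2 \<and> i + 1 \<noteq> -1)" by arith
    from triv[OF this] show "emb f (i + 1) (diff X i x) = diff Y i (emb f i x)"
    proof
      assume "\<forall>x\<in>carrier (obj X i). x = \<zero>\<^bsub>obj X i\<^esub>"
      from bspec[OF this x] show ?thesis by (simp only: Xd0 e(1) Yd0)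
    next
      assume z: "\<forall>y\<in>carrier (obj Y (i + 1)). y = \<zero>\<^bsub>obj Y (i + 1)\<^esub>"
      show ?thesis using bspec[OF z l] bspec[OF z r] by (simp only:)
    qed
  qed
  have C_emb: "\<phi> = emb (\<phi> (-1))" and C_hom: "\<phi> (-1) \<in> carrier ?H" if \<phi>: "\<phi> \<in> carrier C" for \<phi>
  proof -
    have h: "\<phi> i \<in> carrier (?hom i)" for i
      using \<phi> unfolding C_def chain_maps_def partial_object.simps mem_Collect_eq by (elim conjE) (rule spec)
    show "\<phi> (-1) \<in> carrier ?H" using h[of "-1"] unfolding hom1 .
    show "\<phi> = emb (\<phi> (-1))"
    proof
      fix i show "\<phi> i = emb (\<phi> (-1)) i"
      proof (cases "i = -1")
        case False
        then have "(i \<noteq> -1 \<and> i \<noteq> 0) \<or> (i \<noteq> -2 \<and> i \<noteq> -1)" by arith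
        from hom_space_trivial[OF LX' LY h triv[OF this]] False show ?thesis by (simp add: emb_def)
      qed (simp add: emb_def)
    qed
  qed
  have vs: "vectorspace class_ring (?hom i)" for i by (rule vectorspace_hom_space[OF LX' LY])
  have l: "lin ?H C emb"
  proof (rule linI)
    show "emb f \<in> carrier C" if "f \<in> carrier ?H" for f by (rule emb_C[OF that])
    show "emb \<zero>\<^bsub>?H\<^esub> = \<zero>\<^bsub>C\<^esub>" using hom1 by (auto simp: emb_def C_def chain_maps_def fun_eq_iff)
    show "emb (f \<oplus>\<^bsub>?H\<^esub> h) = emb f \<oplus>\<^bsub>C\<^esub> emb h" if "f \<in> carrier ?H" "h \<in> carrier ?H" for f h
    proof
      fix i
      have C: "(emb f \<oplus>\<^bsub>C\<^esub> emb h) i = emb f i \<oplus>\<^bsub>?hom i\<^esub> emb h i" by (simp add: C_def chain_maps_def)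
      show "emb (f \<oplus>\<^bsub>?H\<^esub> h) i = (emb f \<oplus>\<^bsub>C\<^esub> emb h) i"
        unfolding C using hom1 vectorspaceD(4)[OF vs zhom[OF LX' LY], of i] by (cases "i = -1") (simp_all add: emb_def)
    qed
    show "emb (c \<odot>\<^bsub>?H\<^esub> f) = c \<odot>\<^bsub>C\<^esub> emb f" for c f
    proof
      fix i
      have C: "(c \<odot>\<^bsub>C\<^esub> emb f) i = c \<odot>\<^bsub>?hom i\<^esub> emb f i" by (simp add: C_def chain_maps_def)
      show "emb (c \<odot>\<^bsub>?H\<^esub> f) i = (c \<odot>\<^bsub>C\<^esub> emb f) i"
        unfolding C using hom1 vectorspaceD(12)[OF vs, of i c] by (cases "i = -1") (simp_all add: emb_def)
    qed
  qed
  have inj: "inj_on emb (carrier ?H)"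
  proof (rule inj_onI)
    fix f h assume "emb f = emb h"
    from fun_cong[OF this, of "-1"] show "f = h" by (simp add: emb_def)
  qed
  have surj: "emb ` carrier ?H = carrier C"
  proof
    show "emb ` carrier ?H \<subseteq> carrier C" by (rule image_subsetI) (rule emb_C)
    show "carrier C \<subseteq> emb ` carrier ?H"
    proof
      fix \<phi> assume \<phi>: "\<phi> \<in> carrier C"
      show "\<phi> \<in> emb ` carrier ?H" by (rule image_eqI[where f = emb, OF C_emb[OF \<phi>] C_hom[OF \<phi>]])
    qed
  qed
  have fdH: "fdvs ?H" by (rule fdvs_presentation_space)
  have fdC: "fdvs C" by (rule fdvs_surj(1)[OF fdH l surj])
  have dC: "vdim C = vdim ?H" by (rule vdim_bij[OF fdH l bij_betw_imageI[OF inj surj]])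
  let ?B = "homotopies ?m ?n a b"
  have Xm: "diff X (-1) = a" by (simp add: X_def two_term_def)
  have Ym: "diff Y (-2) y = \<ominus>\<^bsub>?P0\<^esub> b y" if "y \<in> carrier ?P1" for y
  proof -
    have "y \<in> carrier (obj Y (-2))" using that Y2 by simp
    from Yd[OF this] show ?thesis by (simp add: T_def two_term_def)
  qed
  \<comment> \<open>The shift negates the differential. Negating \<open>s\<close> cancels this sign,
    in both directions of the comparison below.\<close>
  have bsc: "b (sc (- 1) \<odot>\<^bsub>?P1\<^esub> y) = \<ominus>\<^bsub>?P0\<^esub> b y" if y: "y \<in> carrier ?P1" for y
    unfolding module_homD(3)[OF bh scalar_in_carrier y] by (rule uminus_scalar[OF L0 module_homD(1)[OF bh y], symmetric])
  let ?S1 = "hom_space Q I ?P1 ?P1" and ?S0 = "hom_space Q I ?P0 ?P0"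
  have S1: "s x \<in> carrier ?P1" if "s \<in> carrier ?S1" "x \<in> carrier ?P1" for s x
    by (rule hom_zero_hom(2)[OF L1 L1 that])
  have N: "emb f \<in> N \<longleftrightarrow> f \<in> ?B" if f: "f \<in> carrier ?H" for f
  proof
    assume "emb f \<in> N"
    then obtain s where s: "\<And>i. s i \<in> carrier (hom_space Q I (obj X i) (obj Y (i - 1)))"
      "\<And>i x. x \<in> carrier (obj X i) \<Longrightarrow> emb f i x = diff Y (i - 1) (s i x) \<oplus>\<^bsub>obj Y i\<^esub> s (i + 1) (diff X i x)"
      unfolding N_def null_homotopic_def mem_Collect_eq by blast
    have s1: "s (-1) \<in> carrier ?S1" using s(1)[of "-1"] unfolding X1 by (simp add: Y2)
    have s0: "s 0 \<in> carrier ?S0" using s(1)[of 0] unfolding X0 by (simp add: Y1)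
    have s1': "(- 1) \<odot>\<^bsub>?S1\<^esub> s (-1) \<in> carrier ?S1"
      by (rule closed_opsD(3)[OF closed_ops_hom_space[OF L1 L1] s1])
    have "f x = b (((- 1) \<odot>\<^bsub>?S1\<^esub> s (-1)) x) \<oplus>\<^bsub>?P0\<^esub> s 0 (a x)" if x: "x \<in> carrier ?P1" for x
    proof -
      have "x \<in> carrier (obj X (-1))" using x X1 by simp
      from s(2)[OF this] have "f x = diff Y (-2) (s (-1) x) \<oplus>\<^bsub>?P0\<^esub> s 0 (a x)"
        by (simp add: emb_def Xm Y1)
      then show ?thesis
        unfolding Ym[OF S1[OF s1 x]] hom_space_simps restrict_apply'[OF x] bsc[OF S1[OF s1 x]] .
    qed
    then show "f \<in> ?B" unfolding homotopies_def using f s1' s0 by blast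
  next
    assume "f \<in> ?B"
    then obtain s t where s: "s \<in> carrier ?S1" and t: "t \<in> carrier ?S0"
      and st: "\<And>x. x \<in> carrier ?P1 \<Longrightarrow> f x = b (s x) \<oplus>\<^bsub>?P0\<^esub> t (a x)" unfolding homotopies_def by blast
    let ?hom' = "\<lambda>i. hom_space Q I (obj X i) (obj Y (i - 1))"
    define S where "S i = (if i = -1 then (- 1) \<odot>\<^bsub>?S1\<^esub> s else if i = 0 then t else \<zero>\<^bsub>?hom' i\<^esub>)" for i :: int
    have s': "(- 1) \<odot>\<^bsub>?S1\<^esub> s \<in> carrier ?S1"
      by (rule closed_opsD(3)[OF closed_ops_hom_space[OF L1 L1] s])
    have S: "S i \<in> carrier (?hom' i)" for i
    proof -
      consider "i = -1" | "i = 0" | "i \<noteq> -1" "i \<noteq> 0" by blast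
      then show ?thesis
      proof cases
        case 1 then show ?thesis using s' by (simp add: S_def X1 Y2)
      next
        case 2 then show ?thesis using t by (simp add: S_def X0 Y1)
      next
        case 3 then show ?thesis using zhom[OF LX' LY, of i "i - 1"] by (simp add: S_def)
      qed
    qed
    note S' = hom_zero_hom[OF LX' LY S] and e = hom_zero_hom[OF LX' LY emb_hom[OF f]]
    have "emb f i x = diff Y (i - 1) (S i x) \<oplus>\<^bsub>obj Y i\<^esub> S (i + 1) (diff X i x)" if x: "x \<in> carrier (obj X i)" for i x
    proof (cases "i = -1")
      case True
      have xP: "x \<in> carrier ?P1" using x True X1 by simp
      have "diff Y (-2) (((- 1) \<odot>\<^bsub>?S1\<^esub> s) x) = b (s x)"
      proof -
        have "((- 1) \<odot>\<^bsub>?S1\<^esub> s) x = sc (- 1) \<odot>\<^bsub>?P1\<^esub> s x" unfolding hom_space_simps restrict_apply'[OF xP] ..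
        then have "diff Y (-2) (((- 1) \<odot>\<^bsub>?S1\<^esub> s) x) = \<ominus>\<^bsub>?P0\<^esub> (\<ominus>\<^bsub>?P0\<^esub> b (s x))"
          using Ym[OF S1[OF s' xP]] bsc[OF S1[OF s xP]] by simp
        also have "\<dots> = b (s x)" by (rule P0.minus_minus[OF module_homD(1)[OF bh S1[OF s xP]]])
        finally show ?thesis .
      qed
      then show ?thesis using st[OF xP] True by (simp add: emb_def S_def Xm Y1)
    next
      case False
      have d: "diff Y (i - 1) (S i x) \<in> carrier (obj Y i)" using Ydc[OF S'(2)[OF x]] by simp
      have S2: "S (i + 1) (diff X i x) \<in> carrier (obj Y i)" using S'(2)[OF Xdc[OF x]] by simp
      have r: "diff Y (i - 1) (S i x) \<oplus>\<^bsub>obj Y i\<^esub> S (i + 1) (diff X i x) \<in> carrier (obj Y i)"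
        by (rule left_moduleD(8)[OF LY d S2])
      have "(i \<noteq> -1 \<and> i \<noteq> 0) \<or> (i \<noteq> -2 \<and> i \<noteq> -1)" using False by arith
      from triv[OF this] show ?thesis
      proof
        assume "\<forall>x\<in>carrier (obj X i). x = \<zero>\<^bsub>obj X i\<^esub>"
        then have x0: "x = \<zero>\<^bsub>obj X i\<^esub>" using x by (rule bspec)
        have "diff Y (i - 1) (S i x) = \<zero>\<^bsub>obj Y i\<^esub>" unfolding x0 S'(1) using Yd0[of "i - 1"] by simp
        moreover have "S (i + 1) (diff X i x) = \<zero>\<^bsub>obj Y i\<^esub>" unfolding x0 Xd0 S'(1) by simp
        moreover have "emb f i x = \<zero>\<^bsub>obj Y i\<^esub>" unfolding x0 by (rule e(1))
        moreover have "\<zero>\<^bsub>obj Y i\<^esub> \<oplus>\<^bsub>obj Y i\<^esub> \<zero>\<^bsub>obj Y i\<^esub> = \<zero>\<^bsub>obj Y i\<^esub>"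
        proof -
          interpret N: abelian_group "obj Y i" by (rule left_moduleD(2)[OF LY])
          show ?thesis by simp
        qed
        ultimately show ?thesis by (simp only:)
      next
        assume z: "\<forall>y\<in>carrier (obj Y i). y = \<zero>\<^bsub>obj Y i\<^esub>"
        show ?thesis using bspec[OF z e(2)[OF x]] bspec[OF z r] by (simp only:)
      qed
    qed
    then show "emb f \<in> N"
      unfolding N_def null_homotopic_def mem_Collect_eq C_def[symmetric] using emb_C[OF f] S by blast
  qed
  have NC: "N \<subseteq> carrier C" unfolding N_def null_homotopic_def C_def by blast
  have BH: "?B \<subseteq> carrier ?H" unfolding homotopies_def by blast
  have NB: "emb ` ?B = N"
  proof
    show "emb ` ?B \<subseteq> N"
    proof (rule image_subsetI)
      fix f assume f: "f \<in> ?B"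
      then show "emb f \<in> N" using N[OF subsetD[OF BH f]] by (simp only:)
    qed
    show "N \<subseteq> emb ` ?B"
    proof
      fix \<phi> assume n: "\<phi> \<in> N"
      then have "\<phi> \<in> emb ` carrier ?H" unfolding surj by (rule subsetD[OF NC])
      then obtain f where f: "f \<in> carrier ?H" "\<phi> = emb f" by (elim imageE)
      have "f \<in> ?B" using N[OF f(1)] n f(2) by (simp only:)
      then show "\<phi> \<in> emb ` ?B" unfolding f(2) by (rule imageI)
    qed
  qed
  note cB = closed_ops_homotopies[OF ah bh]
  have fdB: "fdvs (?H\<lparr>carrier := ?B\<rparr>)" by (rule fdvs_subset(1)[OF fdH cB BH])
  have lB: "lin (?H\<lparr>carrier := ?B\<rparr>) (C\<lparr>carrier := N\<rparr>) emb"
  proof (rule linI)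
    note l' = linD[OF l]
    show "emb f \<in> carrier (C\<lparr>carrier := N\<rparr>)" if "f \<in> carrier (?H\<lparr>carrier := ?B\<rparr>)" for f
      using that NB by auto
    show "emb \<zero>\<^bsub>?H\<lparr>carrier := ?B\<rparr>\<^esub> = \<zero>\<^bsub>C\<lparr>carrier := N\<rparr>\<^esub>" using l'(2) by simp
    show "emb (x \<oplus>\<^bsub>?H\<lparr>carrier := ?B\<rparr>\<^esub> y) = emb x \<oplus>\<^bsub>C\<lparr>carrier := N\<rparr>\<^esub> emb y"
      if "x \<in> carrier (?H\<lparr>carrier := ?B\<rparr>)" "y \<in> carrier (?H\<lparr>carrier := ?B\<rparr>)" for x y
      using l'(3)[of x y] that BH by auto
    show "emb (c \<odot>\<^bsub>?H\<lparr>carrier := ?B\<rparr>\<^esub> x) = c \<odot>\<^bsub>C\<lparr>carrier := N\<rparr>\<^esub> emb x"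
      if "x \<in> carrier (?H\<lparr>carrier := ?B\<rparr>)" for c x
      using l'(4)[of x c] that BH by auto
  qed
  have "bij_betw emb ?B N" by (rule bij_betw_imageI[OF inj_on_subset[OF inj BH] NB])
  then have dN: "vdim (C\<lparr>carrier := N\<rparr>) = vdim (?H\<lparr>carrier := ?B\<rparr>)" using vdim_bij[OF fdB lB] by simp
  have vsN: "vectorspace class_ring (C\<lparr>carrier := N\<rparr>)"
    using vectorspace_surj[OF _ lB] fdB NB by (simp add: fdvs_def)
  have "vdim (quot_module C N) + vdim (C\<lparr>carrier := N\<rparr>) = vdim C"
    by (rule vdim_quot_module[OF fdC vectorspaceD(1)[OF vsN] NC])
  then have "vdim (quot_module C N) + vdim (?H\<lparr>carrier := ?B\<rparr>) = vdim ?H" unfolding dC dN .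
  then show ?thesis
    unfolding E_pair_def homotopy_hom_dim_def presentation_space_def C_def N_def X_def Y_def T_def .
qed

end


section \<open>Semicontinuity and the main formula\<close>

context bound_quiver
begin

lemma pairing_eq:
  "pairing Q g d = int (\<Sum>v\<in>verts Q. pos_mult g v * d v) - int (\<Sum>v\<in>verts Q. neg_mult g v * d v)"
proof -
  have "g v * int (d v) = int (pos_mult g v * d v) - int (neg_mult g v * d v)" for v
    by (cases "0 \<le> g v") (simp_all add: pos_mult_def neg_mult_def)
  then show ?thesis unfolding pairing_def by (simp only: sum_subtractf of_nat_sum)
qed

text \<open>Three counts are added: hom plus the rank of composition with \<open>a\<close> is the
  dimension of Hom(P0, Y), \<open>vdim_homotopies\<close> relates that rank to the homotopies, and
  \<open>E_pair\<close> is their codimension in Hom(P1, P0). The rank and the dimensions of the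
  homotopies and of Hom(P1, P0) cancel. The remaining difference between the dimensions of Hom(P0,
  Y) and Hom(P1, Y) is the pairing.\<close>

lemma hom_dim_eq_E_pair:
  assumes gc: "generic_cokernel Q I g d U \<phi>" and ab: "a \<in> U" "b \<in> U"
    and MN: "M \<in> orbit Q I d (\<phi> a)" "N \<in> orbit Q I d (\<phi> b)"
  shows "int (hom_dim Q I (rep_module Q d M) (rep_module Q d N)) = int (E_pair Q I g a g b) + pairing Q g d"
proof -
  let ?m = "pos_mult g" and ?n = "neg_mult g"
  let ?P1 = "proj Q I ?n" and ?P0 = "proj Q I ?m"
  have "openin (presentation_topology Q I g) U" using gc by (simp add: generic_cokernel_def)
  from openin_subset[OF this] have U: "U \<subseteq> carrier (presentation_space Q I g)"
    by (simp add: presentation_topology_def topspace_zariski)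
  have hom: "c \<in> module_hom \<Lambda> ?P1 ?P0" if "c \<in> U" for c
    using subsetD[OF U that] unfolding presentation_space_def hom_space_simps by (elim conjE)
  \<comment> \<open>The presentation of a point in one of the orbits makes its
    \<open>rep_module\<close> a quotient of P0 and thereby a module.\<close>
  have lm: "left_module \<Lambda> (rep_module Q d L)"
    if c: "c \<in> U" and p: "p \<in> module_hom \<Lambda> ?P0 (rep_module Q d L)" "p ` carrier ?P0 = carrier (rep_module Q d L)"
      "\<forall>x\<in>carrier ?P0. p x = \<zero>\<^bsub>rep_module Q d L\<^esub> \<longleftrightarrow> x \<in> c ` carrier ?P1" for c p L
  proof (rule left_module_surj[OF left_module_proj p(1,2)])
    have "c \<zero>\<^bsub>?P1\<^esub> = \<zero>\<^bsub>?P0\<^esub>" by (rule module_hom_zero[OF hom[OF c] left_module_proj left_moduleD(2)[OF left_module_proj]])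
    then have "\<zero>\<^bsub>?P0\<^esub> \<in> c ` carrier ?P1" using imageI[OF left_moduleD(9)[OF left_module_proj[of ?n]], of c] by simp
    then show "p \<zero>\<^bsub>?P0\<^esub> = \<zero>\<^bsub>rep_module Q d L\<^esub>"
      by (rule iffD2[OF bspec[OF p(3) left_moduleD(9)[OF left_module_proj[of ?m]]]])
  qed
  have ex: "\<exists>p\<in>module_hom \<Lambda> ?P0 (rep_module Q d L). p ` carrier ?P0 = carrier (rep_module Q d L) \<and>
    (\<forall>x\<in>carrier ?P0. p x = \<zero>\<^bsub>rep_module Q d L\<^esub> \<longleftrightarrow> x \<in> c ` carrier ?P1)"
    if c: "c \<in> U" and L: "L \<in> orbit Q I d (\<phi> c)" for c L
    by (rule presentation[where U = U and \<phi> = \<phi> and d = d and a = c and M = L and g = g, OF gc c L])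
  obtain p where p0: "p \<in> module_hom \<Lambda> ?P0 (rep_module Q d M)" "p ` carrier ?P0 = carrier (rep_module Q d M) \<and>
      (\<forall>x\<in>carrier ?P0. p x = \<zero>\<^bsub>rep_module Q d M\<^esub> \<longleftrightarrow> x \<in> a ` carrier ?P1)"
    by (rule bexE[OF ex[OF ab(1) MN(1)]])
  note p = p0(1) conjunct1[OF p0(2)] conjunct2[OF p0(2)]
  obtain q where q0: "q \<in> module_hom \<Lambda> ?P0 (rep_module Q d N)" "q ` carrier ?P0 = carrier (rep_module Q d N) \<and>
      (\<forall>x\<in>carrier ?P0. q x = \<zero>\<^bsub>rep_module Q d N\<^esub> \<longleftrightarrow> x \<in> b ` carrier ?P1)"
    by (rule bexE[OF ex[OF ab(2) MN(2)]])
  note q = q0(1) conjunct1[OF q0(2)] conjunct2[OF q0(2)]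
  note LM = lm[OF ab(1) p] and LN = lm[OF ab(2) q]
  have NV: "N \<in> rep_variety Q I d" using MN(2) by (simp add: orbit_def)
  note dims = vdim_hom_proj_rep[OF NV LN]
  have 1: "hom_dim Q I (rep_module Q d M) (rep_module Q d N) + vdim ((hom_space Q I ?P1 (rep_module Q d N))\<lparr>carrier :=
      (\<lambda>h. \<lambda>x\<in>carrier ?P1. h (a x)) ` carrier (hom_space Q I ?P0 (rep_module Q d N))\<rparr>) = (\<Sum>v\<in>verts Q. ?m v * d v)"
    unfolding dims(2)[of ?m, symmetric]
    by (rule vdim_hom_cokernel[OF LM LN hom[OF ab(1)] p(1,2) bspec[OF p(3)] dims(1)])
  have 2: "vdim ((hom_space Q I ?P1 ?P0)\<lparr>carrier := homotopies ?m ?n a b\<rparr>) + (\<Sum>v\<in>verts Q. ?n v * d v) =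
    vdim ((hom_space Q I ?P1 (rep_module Q d N))\<lparr>carrier :=
      (\<lambda>h. \<lambda>x\<in>carrier ?P1. h (a x)) ` carrier (hom_space Q I ?P0 (rep_module Q d N))\<rparr>) + vdim (hom_space Q I ?P1 ?P0)"
    unfolding dims(2)[of ?n, symmetric]
    by (rule vdim_homotopies[OF LN hom[OF ab(1)] hom[OF ab(2)] q(1,2) bspec[OF q(3)]])
  have 3: "E_pair Q I g a g b + vdim ((hom_space Q I ?P1 ?P0)\<lparr>carrier := homotopies ?m ?n a b\<rparr>) = vdim (hom_space Q I ?P1 ?P0)"
    using E_pair_formula[OF subsetD[OF U ab(1)] subsetD[OF U ab(2)]] unfolding presentation_space_def .
  show ?thesis using 1 2 3 unfolding pairing_eq by linarith
qed

text \<open>The maps \<alpha> and \<beta> are the identity or constant in the applications, so that either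
  argument of E can be varied alone.\<close>
lemma E_pair_semicontinuous:
  assumes A: "\<And>x. x \<in> carrier (presentation_space Q I g) \<Longrightarrow> \<alpha> x \<in> carrier (presentation_space Q I g)"
      "\<And>l. l \<in> linear_forms (presentation_space Q I g) \<Longrightarrow>
        (\<lambda>x. l (\<alpha> x)) \<in> polynomial_functions (linear_forms (presentation_space Q I g))"
    and B: "\<And>x. x \<in> carrier (presentation_space Q I g) \<Longrightarrow> \<beta> x \<in> carrier (presentation_space Q I g)"
      "\<And>l. l \<in> linear_forms (presentation_space Q I g) \<Longrightarrow>
        (\<lambda>x. l (\<beta> x)) \<in> polynomial_functions (linear_forms (presentation_space Q I g))"
    and x0: "x0 \<in> carrier (presentation_space Q I g)"
  shows "\<exists>p\<in>polynomial_functions (linear_forms (presentation_space Q I g)). p x0 \<noteq> 0 \<and>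
    (\<forall>x\<in>carrier (presentation_space Q I g). p x \<noteq> 0 \<longrightarrow>
      E_pair Q I g (\<alpha> x) g (\<beta> x) \<le> E_pair Q I g (\<alpha> x0) g (\<beta> x0))"
proof -
  let ?m = "pos_mult g" and ?n = "neg_mult g"
  let ?P1 = "proj Q I ?n" and ?P0 = "proj Q I ?m"
  let ?H = "presentation_space Q I g"
  note L1 = left_module_proj[of ?n] and L0 = left_module_proj[of ?m]
  let ?B = "\<lambda>x. homotopies ?m ?n (\<alpha> x) (\<beta> x)"
  have hom: "c \<in> module_hom \<Lambda> ?P1 ?P0" if "c \<in> carrier ?H" for c
    using that unfolding presentation_space_def hom_space_simps by (elim conjE)
  have hom': "c \<in> module_hom \<Lambda> X Z" if "c \<in> carrier (hom_space Q I X Z)"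
    for c and X Z :: "(('v, 'a, 'k) residue, ('v, 'a, 'k) proj_element) module"
    using that unfolding hom_space_simps by (elim conjE)
  have "\<exists>p\<in>polynomial_functions (linear_forms ?H). p x0 \<noteq> 0 \<and>
    (\<forall>x\<in>carrier ?H. p x \<noteq> 0 \<longrightarrow> vdim (?H\<lparr>carrier := ?B x0\<rparr>) \<le> vdim (?H\<lparr>carrier := ?B x\<rparr>))"
  proof (rule rank_semicontinuous[OF _ _ x0])
    show "fdvs ?H" unfolding presentation_space_def by (rule fdvs_presentation_space)
    show "?B x \<subseteq> carrier ?H \<and> closed_ops (?H\<lparr>carrier := ?B x\<rparr>)" if x: "x \<in> carrier ?H" for x
    proof
      show "?B x \<subseteq> carrier ?H" unfolding homotopies_def presentation_space_def by blast
      show "closed_ops (?H\<lparr>carrier := ?B x\<rparr>)"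
        unfolding presentation_space_def by (rule closed_ops_homotopies[OF hom[OF A(1)[OF x]] hom[OF B(1)[OF x]]])
    qed
    fix f assume f: "f \<in> ?B x0"
    then obtain s t where st: "s \<in> carrier (hom_space Q I ?P1 ?P1)" "t \<in> carrier (hom_space Q I ?P0 ?P0)"
      "\<And>x. x \<in> carrier ?P1 \<Longrightarrow> f x = \<beta> x0 (s x) \<oplus>\<^bsub>?P0\<^esub> t (\<alpha> x0 x)"
      and fH: "f \<in> carrier (hom_space Q I ?P1 ?P0)" unfolding homotopies_def by blast
    let ?s = "\<lambda>c. \<lambda>x\<in>carrier ?P1. c (s x)" and ?t = "\<lambda>c. \<lambda>x\<in>carrier ?P1. t (c x)"
    have ls: "lin ?H ?H ?s" unfolding presentation_space_def by (rule lin_precomp[OF L1 L1 L0 hom'[OF st(1)]])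
    have lt: "lin ?H ?H ?t" unfolding presentation_space_def by (rule lin_postcomp[OF L1 L0 L0 hom'[OF st(2)]])
    \<comment> \<open>Keep \<open>s\<close> and \<open>t\<close> fixed and let only the
      presentations vary: this gives a homotopy for every x that equals \<open>f\<close> at
      \<open>x0\<close>.\<close>
    define \<sigma> where "\<sigma> x = ?s (\<beta> x) \<oplus>\<^bsub>?H\<^esub> ?t (\<alpha> x)" for x
    have cl: "?s (\<beta> x) \<in> carrier ?H" "?t (\<alpha> x) \<in> carrier ?H" if "x \<in> carrier ?H" for x
      using linD(1)[OF ls B(1)[OF that]] linD(1)[OF lt A(1)[OF that]] .
    have \<sigma>x: "\<sigma> x y = \<beta> x (s y) \<oplus>\<^bsub>?P0\<^esub> t (\<alpha> x y)" if "y \<in> carrier ?P1" for x y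
      unfolding \<sigma>_def presentation_space_def hom_space_simps restrict_apply'[OF that] ..
    have \<sigma>H: "\<sigma> x \<in> carrier ?H" if x: "x \<in> carrier ?H" for x
      unfolding \<sigma>_def using cl[OF x] closed_opsD(2)[OF closed_ops_hom_space[OF L1 L0]]
      unfolding presentation_space_def by blast
    have "\<sigma> x0 = f"
    proof (rule extensionalityI[where A = "carrier ?P1"])
      show "\<sigma> x0 \<in> extensional (carrier ?P1)" using \<sigma>H[OF x0] unfolding presentation_space_def hom_space_simps by (elim conjE)
      show "f \<in> extensional (carrier ?P1)" using fH unfolding hom_space_simps by (elim conjE)
      show "\<sigma> x0 y = f y" if "y \<in> carrier ?P1" for y unfolding \<sigma>x[OF that] st(3)[OF that] ..
    qed
    moreover have "\<sigma> x \<in> ?B x" if x: "x \<in> carrier ?H" for x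
      unfolding homotopies_def mem_Collect_eq
    proof (intro conjI bexI[OF _ st(1)] bexI[OF _ st(2)] ballI)
      show "\<sigma> x \<in> carrier (hom_space Q I ?P1 ?P0)" using \<sigma>H[OF x] unfolding presentation_space_def .
    qed (rule \<sigma>x)
    moreover have "\<exists>p\<in>polynomial_functions (linear_forms ?H). \<forall>x\<in>carrier ?H. l (\<sigma> x) = p x" if l: "l \<in> linear_forms ?H" for l
    proof -
      have comp: "(\<lambda>c. l (h c)) \<in> linear_forms ?H" if h: "lin ?H ?H h" for h
        using l linD[OF h] unfolding linear_forms_iff by simp
      show ?thesis
      proof (rule bexI[where x = "\<lambda>x. l (?s (\<beta> x)) + l (?t (\<alpha> x))"])
        show "(\<lambda>x. l (?s (\<beta> x)) + l (?t (\<alpha> x))) \<in> polynomial_functions (linear_forms ?H)"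
          by (rule polynomial_functions.add[OF B(2)[OF comp[OF ls]] A(2)[OF comp[OF lt]]])
        show "\<forall>x\<in>carrier ?H. l (\<sigma> x) = l (?s (\<beta> x)) + l (?t (\<alpha> x))"
        proof
          fix x assume x: "x \<in> carrier ?H"
          show "l (\<sigma> x) = l (?s (\<beta> x)) + l (?t (\<alpha> x))"
            unfolding \<sigma>_def using l cl[OF x] unfolding linear_forms_iff by blast
        qed
      qed
    qed
    ultimately show "\<exists>\<sigma>. \<sigma> x0 = f \<and> (\<forall>x\<in>carrier ?H. \<sigma> x \<in> ?B x) \<and>
      (\<forall>l\<in>linear_forms ?H. \<exists>p\<in>polynomial_functions (linear_forms ?H). \<forall>x\<in>carrier ?H. l (\<sigma> x) = p x)"
      by (intro exI[of _ \<sigma>] conjI ballI)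
  qed
  then obtain p where p0: "p \<in> polynomial_functions (linear_forms ?H)" "p x0 \<noteq> 0 \<and>
    (\<forall>x\<in>carrier ?H. p x \<noteq> 0 \<longrightarrow> vdim (?H\<lparr>carrier := ?B x0\<rparr>) \<le> vdim (?H\<lparr>carrier := ?B x\<rparr>))"
    by (rule bexE)
  note p = p0(1) conjunct1[OF p0(2)] bspec[OF conjunct2[OF p0(2)], THEN mp]
  have "E_pair Q I g (\<alpha> x) g (\<beta> x) \<le> E_pair Q I g (\<alpha> x0) g (\<beta> x0)" if x: "x \<in> carrier ?H" "p x \<noteq> 0" for x
    using p(3)[OF x] E_pair_formula[OF A(1)[OF x(1)] B(1)[OF x(1)]] E_pair_formula[OF A(1)[OF x0] B(1)[OF x0]]
    by linarith
  then show ?thesis by (intro bexI[OF _ p(1)] conjI p(2) ballI impI)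
qed

section \<open>The generic value of E\<close>

lemma E_inv_le:
  assumes "a \<in> carrier (presentation_space Q I g)" "b \<in> carrier (presentation_space Q I g)"
  shows "E_inv Q I g g \<le> E_pair Q I g a g b"
  unfolding E_inv_def by (rule Least_le) (use assms in blast)

text \<open>By irreducibility, the open set on which E does not rise meets U. Starting from a
  minimising pair, the first entry is moved into U while the second stays, then the second is moved;
  E cannot fall below its minimum.\<close>

lemma E_inv_attained_generically:
  assumes U: "openin (presentation_topology Q I g) U" "U \<noteq> {}"
  shows "\<exists>a\<in>U. \<exists>b\<in>U. E_pair Q I g a g b = E_inv Q I g g"
proof -
  let ?H = "presentation_space Q I g"
  have vs: "vectorspace class_ring ?H" unfolding presentation_space_def
    by (rule vectorspace_hom_space[OF left_module_proj left_module_proj])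
  have zero: "\<zero>\<^bsub>?H\<^esub> \<in> carrier ?H" by (rule closed_opsD(1)[OF vectorspaceD(1)[OF vs]])
  have "\<exists>n. \<exists>a\<in>carrier ?H. \<exists>b\<in>carrier ?H. n = E_pair Q I g a g b" using zero by blast
  from LeastI_ex[OF this] have "\<exists>a\<in>carrier ?H. \<exists>b\<in>carrier ?H. E_inv Q I g g = E_pair Q I g a g b"
    unfolding E_inv_def[symmetric] .
  then obtain a0 where a0: "a0 \<in> carrier ?H" "\<exists>b\<in>carrier ?H. E_inv Q I g g = E_pair Q I g a0 g b" by (rule bexE)
  from a0(2) obtain b0 where b0: "b0 \<in> carrier ?H" "E_inv Q I g g = E_pair Q I g a0 g b0" by (rule bexE)
  note ab = a0(1) b0(1) and E = b0(2)[symmetric]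
  obtain u where u: "u \<in> U" using U(2) by blast
  have UH: "U \<subseteq> carrier ?H" using openin_subset[OF U(1)] by (simp add: presentation_topology_def topspace_zariski)
  \<comment> \<open>\<open>q\<close> cuts out a principal open set inside U, so a point where
    neither \<open>p\<close> nor \<open>q\<close> vanishes lies in U.\<close>
  obtain q where q0: "q \<in> polynomial_functions (linear_forms ?H)" "q u \<noteq> 0 \<and> {y \<in> carrier ?H. q y \<noteq> 0} \<subseteq> U"
    by (rule bexE[OF openin_zariski_neighbourhood[OF U(1)[unfolded presentation_topology_def] u]])
  note q = q0(1) conjunct1[OF q0(2)] conjunct2[OF q0(2)]
  have uH: "u \<in> carrier ?H" using u UH by blast
  have meet: "\<exists>z\<in>U. p z \<noteq> 0" if p: "p \<in> polynomial_functions (linear_forms ?H)" "p x \<noteq> 0" and x: "x \<in> carrier ?H" for p x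
  proof -
    obtain z where z: "z \<in> carrier ?H" "p z \<noteq> 0 \<and> q z \<noteq> 0"
      by (rule bexE[OF polynomial_functions_nonzero_meet[where p = p and q = q and x = x and y = u, OF vs x uH p q(1,2)]])
    have "z \<in> U" by (rule subsetD[OF q(3)]) (use z in simp)
    then show ?thesis by (rule bexI[rotated]) (rule conjunct1[OF z(2)])
  qed
  \<comment> \<open>\<open>b0\<close> stays in place for now, although it may lie outside U;
    semicontinuity in the first argument holds for any fixed second one.\<close>
  have "\<exists>p\<in>polynomial_functions (linear_forms ?H). p a0 \<noteq> 0 \<and>
    (\<forall>x\<in>carrier ?H. p x \<noteq> 0 \<longrightarrow> E_pair Q I g x g b0 \<le> E_pair Q I g a0 g b0)"
    by (rule E_pair_semicontinuous[where \<alpha> = "\<lambda>x. x" and \<beta> = "\<lambda>_. b0", OF _ _ ab(2) polynomial_functions.const ab(1)])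
      (assumption, rule polynomial_functions.coord)
  then obtain p where p0: "p \<in> polynomial_functions (linear_forms ?H)" "p a0 \<noteq> 0 \<and>
    (\<forall>x\<in>carrier ?H. p x \<noteq> 0 \<longrightarrow> E_pair Q I g x g b0 \<le> E_pair Q I g a0 g b0)" by (rule bexE)
  note p = p0(1) conjunct1[OF p0(2)] conjunct2[OF p0(2)]
  obtain a where a: "a \<in> U" "p a \<noteq> 0" by (rule bexE[OF meet[OF p(1,2) ab(1)]])
  have aH: "a \<in> carrier ?H" using a(1) UH by blast
  have E1: "E_pair Q I g a g b0 \<le> E_inv Q I g g" using p(3) aH a(2) E by simp
  have "\<exists>p\<in>polynomial_functions (linear_forms ?H). p b0 \<noteq> 0 \<and>
    (\<forall>x\<in>carrier ?H. p x \<noteq> 0 \<longrightarrow> E_pair Q I g a g x \<le> E_pair Q I g a g b0)"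
    by (rule E_pair_semicontinuous[where \<alpha> = "\<lambda>_. a" and \<beta> = "\<lambda>x. x", OF aH polynomial_functions.const _ _ ab(2)])
      (assumption, rule polynomial_functions.coord)
  then obtain p' where p0': "p' \<in> polynomial_functions (linear_forms ?H)" "p' b0 \<noteq> 0 \<and>
    (\<forall>x\<in>carrier ?H. p' x \<noteq> 0 \<longrightarrow> E_pair Q I g a g x \<le> E_pair Q I g a g b0)" by (rule bexE)
  note p' = p0'(1) conjunct1[OF p0'(2)] conjunct2[OF p0'(2)]
  obtain b where b: "b \<in> U" "p' b \<noteq> 0" by (rule bexE[OF meet[OF p'(1,2) ab(2)]])
  have bH: "b \<in> carrier ?H" using b(1) UH by blast
  have "E_pair Q I g a g b \<le> E_inv Q I g g" using p'(3) bH b(2) E1 by (meson le_trans)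
  then have "E_pair Q I g a g b = E_inv Q I g g" using E_inv_le[OF aH bH] by simp
  then show ?thesis using a(1) b(1) by blast
qed

section \<open>Semicontinuity of the Hom dimension on the representation variety\<close>

text \<open>With \<open>c\<close> and the other representation fixed, each entry has degree at most
  one. Membership of \<open>e\<close> in \<open>arrow_index\<close> guarantees that only coordinates
  within the sizes of the matrices occur.\<close>

lemma commutator_polynomial:
  assumes e: "e \<in> arrow_index d d'"
  shows "(\<lambda>M. commutator d d' M N c e) \<in> polynomial_functions (rep_coordinates Q d)"
    and "(\<lambda>N. commutator d d' M N c e) \<in> polynomial_functions (rep_coordinates Q d')"
proof -
  obtain \<alpha> i j where e': "e = (\<alpha>, i, j)" by (cases e)
  have ij: "\<alpha> \<in> arcs Q" "i < d' (head Q \<alpha>)" "j < d (tail Q \<alpha>)" using e by (auto simp: e' arrow_index_def)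
  have eq: "commutator d d' M N c e = (\<Sum>k = 0..<d' (tail Q \<alpha>). N \<alpha> $$ (i, k) * c (tail Q \<alpha>, k, j)) +
    (-1) * (\<Sum>k = 0..<d (head Q \<alpha>). c (head Q \<alpha>, i, k) * M \<alpha> $$ (k, j))" for M N
    using e by (simp add: commutator_def e')
  have M: "(\<lambda>M. M \<alpha> $$ (k, j)) \<in> polynomial_functions (rep_coordinates Q d)" if "k < d (head Q \<alpha>)" for k
    by (rule polynomial_functions.coord) (use that ij in \<open>auto simp: rep_coordinates_def\<close>)
  have N: "(\<lambda>N. N \<alpha> $$ (i, k)) \<in> polynomial_functions (rep_coordinates Q d')" if "k < d' (tail Q \<alpha>)" for k
    by (rule polynomial_functions.coord) (use that ij in \<open>auto simp: rep_coordinates_def\<close>)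
  show "(\<lambda>M. commutator d d' M N c e) \<in> polynomial_functions (rep_coordinates Q d)"
    unfolding eq
    by (intro polynomial_functions.add polynomial_functions.mult polynomial_functions.const polynomial_functions_sum M) simp
  show "(\<lambda>N. commutator d d' M N c e) \<in> polynomial_functions (rep_coordinates Q d')"
    unfolding eq
    by (intro polynomial_functions.add polynomial_functions.mult polynomial_functions.const polynomial_functions_sum N) simp
qed

text \<open>In the applications one of \<open>\<alpha>\<close> and \<open>\<beta>\<close> is the
  identity and the other constant. Where the polynomial from \<open>rank_semicontinuous\<close> does
  not vanish, the commutator has at least the rank it has at \<open>x0\<close>; this set is an open
  neighbourhood of \<open>x0\<close>, so it meets S.\<close>

lemma hom_dim_semicontinuous:
  assumes A: "\<And>x. x \<in> rep_variety Q I d \<Longrightarrow> \<alpha> x \<in> rep_variety Q I d" "\<And>x. x \<in> rep_variety Q I d \<Longrightarrow> \<beta> x \<in> rep_variety Q I d"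
    and poly: "\<And>c e. e \<in> arrow_index d d \<Longrightarrow>
      (\<lambda>x. commutator d d (\<alpha> x) (\<beta> x) c e) \<in> polynomial_functions (rep_coordinates Q d)"
    and x0: "x0 \<in> rep_topology Q I d closure_of S"
  shows "\<exists>x\<in>S. hom_dim Q I (rep_module Q d (\<alpha> x)) (rep_module Q d (\<beta> x)) \<le>
    hom_dim Q I (rep_module Q d (\<alpha> x0)) (rep_module Q d (\<beta> x0))"
proof -
  let ?V = "coord_space (arrow_index d d) :: ('k, 'a \<times> nat \<times> nat \<Rightarrow> 'k) module"
  let ?W = "coord_space (hom_index d d) :: ('k, 'v \<times> nat \<times> nat \<Rightarrow> 'k) module"
  let ?T = "\<lambda>x. commutator d d (\<alpha> x) (\<beta> x)"
  let ?B = "\<lambda>x. ?T x ` carrier ?W"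
  let ?F = "rep_coordinates Q d :: (('a \<Rightarrow> 'k mat) \<Rightarrow> 'k) set"
  have x0V: "x0 \<in> rep_variety Q I d"
    using x0 closure_of_subset_topspace[of "rep_topology Q I d" S] by (auto simp: rep_topology_def topspace_zariski)
  have "\<exists>p\<in>polynomial_functions ?F. p x0 \<noteq> 0 \<and>
    (\<forall>x\<in>rep_variety Q I d. p x \<noteq> 0 \<longrightarrow> vdim (?V\<lparr>carrier := ?B x0\<rparr>) \<le> vdim (?V\<lparr>carrier := ?B x\<rparr>))"
  proof (rule rank_semicontinuous[OF vdim_coord_space(1)[OF finite_arrow_index] _ x0V])
    show "?B x \<subseteq> carrier ?V \<and> closed_ops (?V\<lparr>carrier := ?B x\<rparr>)" if "x \<in> rep_variety Q I d" for x
    proof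
      note T = linD[OF lin_commutator[of d d "\<alpha> x" "\<beta> x"]]
      show "?B x \<subseteq> carrier ?V" by (rule image_subsetI) (rule T(1))
      have "lin ?W (?V\<lparr>carrier := ?B x\<rparr>) (?T x)" using lin_commutator[of d d "\<alpha> x" "\<beta> x"] by (simp add: lin_def)
      from vectorspace_surj[OF vectorspace_coord_space this]
      have "vectorspace class_ring (?V\<lparr>carrier := ?B x\<rparr>)" by simp
      then show "closed_ops (?V\<lparr>carrier := ?B x\<rparr>)" by (rule vectorspaceD(1))
    qed
    fix v assume "v \<in> ?B x0"
    then obtain c where c: "c \<in> carrier ?W" "v = ?T x0 c" by (elim imageE)
    \<comment> \<open>The section through \<open>v\<close> keeps the family of matrices
      \<open>c\<close> and varies the representations only.\<close>
    have "\<exists>p\<in>polynomial_functions ?F. \<forall>x\<in>rep_variety Q I d. l (?T x c) = p x" if l: "l \<in> linear_forms ?V" for l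
    proof (rule bexI[where x = "\<lambda>x. \<Sum>e\<in>arrow_index d d. ?T x c e * l (\<lambda>i. if i = e then 1 else 0)"])
      show "\<forall>x\<in>rep_variety Q I d. l (?T x c) =
        (\<Sum>e\<in>arrow_index d d. ?T x c e * l (\<lambda>i. if i = e then 1 else 0))"
        using coord_linear_form[OF finite_arrow_index l linD(1)[OF lin_commutator c(1)]] by blast
      show "(\<lambda>x. \<Sum>e\<in>arrow_index d d. ?T x c e * l (\<lambda>i. if i = e then 1 else 0)) \<in> polynomial_functions ?F"
        by (intro polynomial_functions_sum polynomial_functions.mult polynomial_functions.const poly)
    qed
    then show "\<exists>\<sigma>. \<sigma> x0 = v \<and> (\<forall>x\<in>rep_variety Q I d. \<sigma> x \<in> ?B x) \<and>
      (\<forall>l\<in>linear_forms ?V. \<exists>p\<in>polynomial_functions ?F. \<forall>x\<in>rep_variety Q I d. l (\<sigma> x) = p x)"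
      using c by (intro exI[of _ "\<lambda>x. ?T x c"] conjI ballI imageI) simp_all
  qed
  then obtain p where p0: "p \<in> polynomial_functions ?F" "p x0 \<noteq> 0 \<and>
    (\<forall>x\<in>rep_variety Q I d. p x \<noteq> 0 \<longrightarrow> vdim (?V\<lparr>carrier := ?B x0\<rparr>) \<le> vdim (?V\<lparr>carrier := ?B x\<rparr>))"
    by (rule bexE)
  note p = p0(1) conjunct1[OF p0(2)] conjunct2[OF p0(2)]
  have o: "openin (rep_topology Q I d) {x \<in> rep_variety Q I d. p x \<noteq> 0}"
    unfolding rep_topology_def by (rule openin_zariski_principal[OF p(1)])
  have m: "x0 \<in> {x \<in> rep_variety Q I d. p x \<noteq> 0}" using x0V p(2) by simp
  have c: "\<forall>T. x0 \<in> T \<and> openin (rep_topology Q I d) T \<longrightarrow> (\<exists>y. y \<in> S \<and> y \<in> T)"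
    using x0 unfolding in_closure_of by (rule conjunct2)
  have "\<exists>y. y \<in> S \<and> y \<in> {x \<in> rep_variety Q I d. p x \<noteq> 0}" by (rule mp[OF spec[OF c] conjI[OF m o]])
  then obtain x where "x \<in> S \<and> x \<in> {x \<in> rep_variety Q I d. p x \<noteq> 0}" by (rule exE)
  then have x: "x \<in> S" "x \<in> rep_variety Q I d" "p x \<noteq> 0" by simp_all
  have "vdim (?V\<lparr>carrier := ?B x0\<rparr>) \<le> vdim (?V\<lparr>carrier := ?B x\<rparr>)"
    by (rule mp[OF bspec[OF p(3) x(2)] x(3)])
  then have "hom_dim Q I (rep_module Q d (\<alpha> x)) (rep_module Q d (\<beta> x)) \<le>
    hom_dim Q I (rep_module Q d (\<alpha> x0)) (rep_module Q d (\<beta> x0))"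
    using hom_dim_rep[OF A(1)[OF x(2)] A(2)[OF x(2)]] hom_dim_rep[OF A(1)[OF x0V] A(2)[OF x0V]] by linarith
  then show ?thesis using x(1) by blast
qed

lemma orbit_self:
  assumes M: "M \<in> rep_variety Q I d"
  shows "M \<in> orbit Q I d M"
  unfolding orbit_def mem_Collect_eq
proof (intro conjI M exI[of _ "\<lambda>v. 1\<^sub>m (d v)"] ballI)
  show "1\<^sub>m (d v) \<in> carrier_mat (d v) (d v)" for v by simp
  show "invertible_mat (1\<^sub>m (d v) :: 'k mat)" for v
    unfolding invertible_mat_def inverts_mat_def by (auto intro!: exI[of _ "1\<^sub>m (d v)"])
  show "M \<alpha> * 1\<^sub>m (d (tail Q \<alpha>)) = 1\<^sub>m (d (head Q \<alpha>)) * M \<alpha>" if "\<alpha> \<in> arcs Q" for \<alpha>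
    using left_mult_one_mat[OF rep_variety_dim[OF M that]] right_mult_one_mat[OF rep_variety_dim[OF M that]] by simp
qed

section \<open>The minimum on the generic component\<close>

text \<open>A pair in U attaining \<open>E_inv\<close> provides the value. No pair in the closure
  lies below it: first X and then Y is replaced by a point of the orbits without raising the Hom
  dimension, and for points of the orbits \<open>hom_dim_eq_E_pair\<close> and
  \<open>E_inv_le\<close> give the bound.\<close>

theorem min_hom_generic_closure:
  assumes gc: "generic_cokernel Q I g d U \<phi>"
  shows "int (min_hom Q I d (generic_closure Q I d U \<phi>) d (generic_closure Q I d U \<phi>)) =
    int (E_inv Q I g g) + pairing Q g d"
proof -
  let ?Z = "generic_closure Q I d U \<phi>" and ?S = "\<Union>a\<in>U. orbit Q I d (\<phi> a)"
  let ?h = "\<lambda>M N. hom_dim Q I (rep_module Q d M) (rep_module Q d N)"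
  have Uo: "openin (presentation_topology Q I g) U" "U \<noteq> {}"
    and \<phi>: "\<And>a. a \<in> U \<Longrightarrow> \<phi> a \<in> rep_variety Q I d" using gc by (simp_all add: generic_cokernel_def)
  have UH: "U \<subseteq> carrier (presentation_space Q I g)"
    using openin_subset[OF Uo(1)] by (simp add: presentation_topology_def topspace_zariski)
  have top: "topspace (rep_topology Q I d) = rep_variety Q I d" by (simp add: rep_topology_def topspace_zariski)
  have SV: "?S \<subseteq> rep_variety Q I d" by (auto simp: orbit_def)
  have SZ: "?S \<subseteq> ?Z" unfolding generic_closure_def by (rule closure_of_subset) (use SV top in blast)
  have ZV: "?Z \<subseteq> rep_variety Q I d" unfolding generic_closure_def top[symmetric] by (rule closure_of_subset_topspace)
  obtain a where a: "a \<in> U" "\<exists>b\<in>U. E_pair Q I g a g b = E_inv Q I g g"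
    by (rule bexE[OF E_inv_attained_generically[OF Uo]])
  from a(2) obtain b where b: "b \<in> U" "E_pair Q I g a g b = E_inv Q I g g" by (rule bexE)
  note ab = a(1) b
  have orb: "\<phi> c \<in> orbit Q I d (\<phi> c)" if "c \<in> U" for c by (rule orbit_self[OF \<phi>[OF that]])
  have h0: "int (?h (\<phi> a) (\<phi> b)) = int (E_inv Q I g g) + pairing Q g d"
    using hom_dim_eq_E_pair[where \<phi> = \<phi> and a = a and b = b and M = "\<phi> a" and N = "\<phi> b",
        OF gc ab(1,2) orb[OF ab(1)] orb[OF ab(2)]] ab(3) by simp
  have low: "?h (\<phi> a) (\<phi> b) \<le> ?h X Y" if X: "X \<in> ?Z" and Y: "Y \<in> ?Z" for X Y
  proof -
    have YV: "Y \<in> rep_variety Q I d" using Y ZV by blast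
    have "\<exists>M\<in>?S. ?h M Y \<le> ?h X Y"
    proof (rule hom_dim_semicontinuous[where \<alpha> = "\<lambda>x. x" and \<beta> = "\<lambda>_. Y" and S = ?S and ?x0.0 = X])
      show "(\<lambda>x. commutator d d x Y c e) \<in> polynomial_functions (rep_coordinates Q d)"
        if "e \<in> arrow_index d d" for c e by (rule commutator_polynomial(1)[OF that])
      show "X \<in> rep_topology Q I d closure_of ?S" using X unfolding generic_closure_def .
    qed (assumption, rule YV)
    then obtain M where M: "M \<in> ?S" "?h M Y \<le> ?h X Y" by (rule bexE)
    have MV: "M \<in> rep_variety Q I d" using M(1) SV by blast
    have "\<exists>N\<in>?S. ?h M N \<le> ?h M Y"
    proof (rule hom_dim_semicontinuous[where \<alpha> = "\<lambda>_. M" and \<beta> = "\<lambda>x. x" and S = ?S and ?x0.0 = Y])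
      show "(\<lambda>x. commutator d d M x c e) \<in> polynomial_functions (rep_coordinates Q d)"
        if "e \<in> arrow_index d d" for c e by (rule commutator_polynomial(2)[OF that])
      show "Y \<in> rep_topology Q I d closure_of ?S" using Y unfolding generic_closure_def .
    qed (rule MV, assumption)
    then obtain N where N: "N \<in> ?S" "?h M N \<le> ?h M Y" by (rule bexE)
    obtain a' where a': "a' \<in> U" "M \<in> orbit Q I d (\<phi> a')" using M(1) by (elim UN_E)
    obtain b' where b': "b' \<in> U" "N \<in> orbit Q I d (\<phi> b')" using N(1) by (elim UN_E)
    have "E_inv Q I g g \<le> E_pair Q I g a' g b'"
      by (rule E_inv_le) (use a' b' UH in blast)+
    then have "?h (\<phi> a) (\<phi> b) \<le> ?h M N"
      using hom_dim_eq_E_pair[where \<phi> = \<phi> and a = a' and b = b' and M = M and N = N,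
          OF gc a'(1) b'(1) a'(2) b'(2)] h0 by linarith
    then show ?thesis using M(2) N(2) by linarith
  qed
  have "\<phi> a \<in> ?Z" "\<phi> b \<in> ?Z" using ab orb SZ by blast+
  then have "min_hom Q I d ?Z d ?Z = ?h (\<phi> a) (\<phi> b)"
    unfolding min_hom_def by (intro Least_equality) (blast, use low in blast)
  then show ?thesis using h0 by simp
qed

end

theorem theorem5:
  fixes Q :: "('v, 'a) pre_digraph"
    and I :: "(('v, 'a) path \<Rightarrow> 'k::alg_closed_field) set"
    and g :: "'v \<Rightarrow> int"
    and d :: "'v \<Rightarrow> nat"
  assumes "bound_quiver Q I"
    and "g \<in> gvectors Q"
    and "no_negative_summand Q I g"
    and "generic_cokernel Q I g d U \<phi>"
  shows "wild Q I g \<longleftrightarrow>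
    int (min_hom Q I d (generic_closure Q I d U \<phi>) d (generic_closure Q I d U \<phi>)) > pairing Q g d"
proof -
  interpret bound_quiver Q I by (rule assms(1))
  show ?thesis
    using min_hom_generic_closure[OF assms(4)] unfolding wild_def tame_def by linarith
qed

end
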